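(* Let $d\ge1$ be an integer and let $q>1$. Then the shape optimisation problem $$\max\big\{F_q(\Omega)\ :\ \Omega\text{ nonempty, open, bounded, convex in }\mathbb{R}^d\big\}$$ has a maximiser $\Omega^+$ (depending on $d$ and $q$). Furthermore $$\frac{r(\Omega^+)}{\operatorname{diam}(\Omega^+)}\ \ge\ \frac{\omega_{d-1}\pi^d}{d\,\omega_d\,2^d}\,\big(d(d+2)\big)^{dq/(2(1-q))}\,\big(j_{(d-2)/2}\big)^{d/(q-1)}.$$
   Context: $\omega_m$ is the Lebesgue measure of the unit ball of $\mathbb{R}^m$ ($\omega_0=1$); $j_\nu$ is the first positive zero of the Bessel function $J_\nu$. For an open set $\Omega\subset\mathbb{R}^d$ with Lebesgue measure $0<|\Omega|<\infty$: $\lambda(\Omega)=\min\{\int_\Omega|\nabla u|^2dx\,/\int_\Omega u^2dx : u\in H^1_0(\Omega),\ u\ne0\}$ is the first eigenvalue of the Dirichlet Laplacian; $T(\Omega)=\int_\Omega w_\Omega\,dx$ is the torsional rigidity, where $w_\Omega\in H^1_0(\Omega)$ is the unique weak solution of $-\Delta w=1$ in $\Omega$. For $q>0$, $$F_q(\Omega)=\frac{\lambda(\Omega)\,T(\Omega)^q}{|\Omega|^{(dq+2q-2)/d}}.$$ For a nonempty bounded open set $\Omega$, $r(\Omega)=\sup\{\operatorname{dist}(x,\partial\Omega):x\in\Omega\}$ is the inradius and $\operatorname{diam}(\Omega)=\sup\{|x_1-x_2|:x_1,x_2\in\Omega\}$ is the diameter. *)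

theory Defs
  imports "HOL-Analysis.Analysis"
begin

text \<open>The series is the usual one for \<open>x > 0\<close>; the reciprocal Gamma function makes it
  meaningful for every real order.\<close>

definition Bessel_J :: "real \<Rightarrow> real \<Rightarrow> real" where
  "Bessel_J \<nu> x =
     (\<Sum>k. (- 1) ^ k * rGamma (real k + \<nu> + 1) / fact k * (x / 2) powr (2 * real k + \<nu>))"

definition Bessel_J_zero :: "real \<Rightarrow> real" where
  "Bessel_J_zero \<nu> = (LEAST x. 0 < x \<and> Bessel_J \<nu> x = 0)"

definition grad :: "('a::real_inner \<Rightarrow> real) \<Rightarrow> 'a \<Rightarrow> 'a" where
  "grad f x = (THE g. GDERIV f x :> g)"

fun C_k :: "nat \<Rightarrow> ('a::euclidean_space \<Rightarrow> real) \<Rightarrow> bool" where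
  "C_k 0 f \<longleftrightarrow> continuous_on UNIV f"
| "C_k (Suc k) f \<longleftrightarrow> (\<forall>x. f differentiable (at x)) \<and>
     (\<forall>b\<in>Basis. C_k k (\<lambda>x. frechet_derivative f (at x) b))"

definition test_functions :: "'a::euclidean_space set \<Rightarrow> ('a \<Rightarrow> real) set" where
  "test_functions \<Omega> =
     {\<phi>. (\<forall>k. C_k k \<phi>) \<and> compact (closure {x. \<phi> x \<noteq> 0}) \<and> closure {x. \<phi> x \<noteq> 0} \<subseteq> \<Omega>}"

text \<open>Elements of the Sobolev spaces are functions rather than classes of functions modulo
  equality almost everywhere; their values outside \<open>\<Omega>\<close> are irrelevant.\<close>

definition square_integrable ::
    "'a::euclidean_space set \<Rightarrow> ('a \<Rightarrow> 'b::euclidean_space) \<Rightarrow> bool" where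
  "square_integrable \<Omega> f \<longleftrightarrow> f \<in> borel_measurable (lebesgue_on \<Omega>) \<and>
     integrable (lebesgue_on \<Omega>) (\<lambda>x. (norm (f x))\<^sup>2)"

definition is_weak_grad ::
    "'a::euclidean_space set \<Rightarrow> ('a \<Rightarrow> real) \<Rightarrow> ('a \<Rightarrow> 'a) \<Rightarrow> bool" where
  "is_weak_grad \<Omega> u g \<longleftrightarrow> square_integrable \<Omega> g \<and>
     (\<forall>\<phi>\<in>test_functions \<Omega>.
        (\<integral>x. u x *\<^sub>R grad \<phi> x \<partial>lebesgue_on \<Omega>) = - (\<integral>x. \<phi> x *\<^sub>R g x \<partial>lebesgue_on \<Omega>))"

definition H1 :: "'a::euclidean_space set \<Rightarrow> ('a \<Rightarrow> real) set" where
  "H1 \<Omega> = {u. square_integrable \<Omega> u \<and> (\<exists>g. is_weak_grad \<Omega> u g)}"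

text \<open>The weak gradient is unique up to a null subset of \<open>\<Omega>\<close>, so the choice below does
  not affect any of the integrals in which it occurs.\<close>

definition weak_grad :: "'a::euclidean_space set \<Rightarrow> ('a \<Rightarrow> real) \<Rightarrow> 'a \<Rightarrow> 'a" where
  "weak_grad \<Omega> u = (SOME g. is_weak_grad \<Omega> u g)"

definition H1_norm :: "'a::euclidean_space set \<Rightarrow> ('a \<Rightarrow> real) \<Rightarrow> real" where
  "H1_norm \<Omega> u = sqrt ((\<integral>x. (u x)\<^sup>2 \<partial>lebesgue_on \<Omega>) +
                       (\<integral>x. (norm (weak_grad \<Omega> u x))\<^sup>2 \<partial>lebesgue_on \<Omega>))"

definition H10 :: "'a::euclidean_space set \<Rightarrow> ('a \<Rightarrow> real) set" where
  "H10 \<Omega> = {u\<in>H1 \<Omega>. \<exists>\<phi>. (\<forall>n. \<phi> n \<in> test_functions \<Omega>) \<and>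
     (\<lambda>n. H1_norm \<Omega> (\<lambda>x. u x - \<phi> n x)) \<longlonglongrightarrow> 0}"

text \<open>The infimum of the Rayleigh quotient is attained when \<open>\<Omega>\<close> is open with
  \<open>0 < \<bar>\<Omega>\<bar> < \<infinity>\<close>, so it is the minimum in that case. The condition \<open>u \<noteq> 0\<close> is read
  almost everywhere.\<close>

definition first_eigenvalue :: "'a::euclidean_space set \<Rightarrow> real" where
  "first_eigenvalue \<Omega> =
     Inf {(\<integral>x. (norm (weak_grad \<Omega> u x))\<^sup>2 \<partial>lebesgue_on \<Omega>) / (\<integral>x. (u x)\<^sup>2 \<partial>lebesgue_on \<Omega>)
         | u. u \<in> H10 \<Omega> \<and> \<not> (AE x in lebesgue_on \<Omega>. u x = 0)}"

definition is_torsion_function :: "'a::euclidean_space set \<Rightarrow> ('a \<Rightarrow> real) \<Rightarrow> bool" where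
  "is_torsion_function \<Omega> w \<longleftrightarrow> w \<in> H10 \<Omega> \<and>
     (\<forall>\<phi>\<in>test_functions \<Omega>.
        (\<integral>x. weak_grad \<Omega> w x \<bullet> grad \<phi> x \<partial>lebesgue_on \<Omega>) = (\<integral>x. \<phi> x \<partial>lebesgue_on \<Omega>))"

text \<open>The torsion function is unique up to a null subset of \<open>\<Omega>\<close>.\<close>

definition torsional_rigidity :: "'a::euclidean_space set \<Rightarrow> real" where
  "torsional_rigidity \<Omega> = (\<integral>x. (SOME w. is_torsion_function \<Omega> w) x \<partial>lebesgue_on \<Omega>)"

definition shape_functional :: "real \<Rightarrow> 'a::euclidean_space set \<Rightarrow> real" where
  "shape_functional q \<Omega> =
     first_eigenvalue \<Omega> * torsional_rigidity \<Omega> powr q /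
     measure lebesgue \<Omega> powr ((real DIM('a) * q + 2 * q - 2) / real DIM('a))"

definition inradius :: "'a::euclidean_space set \<Rightarrow> real" where
  "inradius \<Omega> = (SUP x\<in>\<Omega>. infdist x (frontier \<Omega>))"

end

theory Submission
  imports Defs "HOL-Complex_Analysis.Great_Picard"
begin

text \<open>Let \<open>B\<close> be the unit ball, \<open>\<lambda>\<close> the eigenvalue, \<open>T\<close> the torsion and \<open>r\<close> the inradius.
  Polya's inequality \<open>\<lambda> T \<le> |\<Omega>|\<close> and the Hersch--Protter inequality
  \<open>\<lambda> \<ge> (\<pi> / 2r)\<^sup>2\<close> give \<open>F\<^sub>q(\<Omega>) \<le> ((2r / \<pi>)\<^sup>d / |\<Omega>|) powr (2(q - 1)/d)\<close>. If
  \<open>F\<^sub>q(\<Omega>) \<ge> F\<^sub>q(B)\<close>, comparison with the explicit value on the ball bounds \<open>|\<Omega>|\<close> by a multiple of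
  \<open>r\<^sup>d\<close>; since \<open>\<Omega>\<close> contains a double cone whose axis is a diameter, \<open>|\<Omega>|\<close> is at least
  a multiple of \<open>r\<^sup>d\<^sup>-\<^sup>1 diam(\<Omega>)\<close>, and the estimate follows. Consequently a maximising sequence,
  rescaled to diameter one, contains a fixed ball and has a convergent subsequence, and
  the monotonicity and homogeneity of \<open>\<lambda>\<close>, \<open>T\<close> and \<open>|\<Omega>|\<close> give the upper semicontinuity of \<open>F\<^sub>q\<close>.

  Only test functions enter the estimates: \<open>\<lambda>\<close> is an infimum of Rayleigh quotients and \<open>T\<close> the
  supremum of \<open>2 \<integral>\<phi> - \<integral>|grad \<phi>|\<^sup>2\<close> over them.\<close>

section \<open>Smooth functions\<close>

text \<open>The hypothesis q > 1 enters through the splitting \<lambda> T^q = (\<lambda> T) T^(q -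
  1): Polya controls the first factor, and Polya with Hersch--Protter gives T \<le> |\<Omega>| (2r /
  \<pi>)^2 for the second. A maximising sequence might collapse onto a lower-dimensional set; the
  bound on r / diam rules this out, so the estimate of the theorem is also the source of
  compactness, and it is proved for every body at least as good as the ball. In the constant, j
  stems from \<lambda>(B) \<ge> j^2 and d(d + 2) from T(B) \<ge> \<omega>_d / (d(d + 2)); these
  one-sided bounds suffice, and no eigenfunction has to be placed in \<open>H10\<close>. Both
  eigenvalue bounds are of Riccati type: a field X with div X + |X|^2 \<le> - \<mu> gives \<mu>
  \<integral>\<phi>^2 \<le> \<integral>|grad \<phi>|^2. The definitions choose weak gradients and
  torsion functions by \<open>SOME\<close>, so the passage to test functions rests on uniqueness of
  the former and existence of the latter.\<close>

lemma C_k_SucI: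
  assumes "\<And>x. (f has_derivative f' x) (at x)" "\<And>b. b \<in> Basis \<Longrightarrow> C_k k (\<lambda>x. f' x b)"
  shows "C_k (Suc k) f"
proof -
  have "frechet_derivative f (at x) = f' x" for x
    using frechet_derivative_at[OF assms(1)] by simp
  then show ?thesis using assms by (auto simp: differentiable_def)
qed

text \<open>With the preceding rule this replaces \<open>frechet_derivative\<close> in the recursion
  by any family of derivatives, so that the closure properties below reduce to the usual
  differentiation rules and an induction on the order.\<close>

lemma C_k_SucE:
  assumes "C_k (Suc k) f"
  obtains f' where "\<And>x. (f has_derivative f' x) (at x)" "\<And>b. b \<in> Basis \<Longrightarrow> C_k k (\<lambda>x. f' x b)"
proof (rule that[of "\<lambda>x. frechet_derivative f (at x)"])
  show "(f has_derivative frechet_derivative f (at x)) (at x)" for x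
    using assms frechet_derivative_works by auto
qed (use assms in auto)

lemma C_k_SucD:
  assumes "C_k (Suc k) f"
  shows "C_k k f"
  using assms
proof (induction k arbitrary: f)
  case 0
  then show ?case
    by (auto simp: continuous_on_eq_continuous_within intro: differentiable_imp_continuous_within)
next
  case (Suc k)
  from Suc.prems obtain f' where f': "\<And>x. (f has_derivative f' x) (at x)"
      "\<And>b. b \<in> Basis \<Longrightarrow> C_k (Suc k) (\<lambda>x. f' x b)"
    by (rule C_k_SucE) blast
  show ?case
    by (rule C_k_SucI[OF f'(1)]) (use Suc.IH[OF f'(2)] in auto)
qed

lemma C_k_const: "C_k k (\<lambda>x. c)"
proof (induction k arbitrary: c)
  case (Suc k)
  show ?case by (rule C_k_SucI[of _ "\<lambda>x h. 0"]) (use Suc in auto)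
qed auto

lemma C_k_add:
  assumes "C_k k f" "C_k k g"
  shows "C_k k (\<lambda>x. f x + g x)"
  using assms
proof (induction k arbitrary: f g)
  case 0
  then show ?case by (auto intro: continuous_intros)
next
  case (Suc k)
  from Suc.prems(1) obtain f' where f': "\<And>x. (f has_derivative f' x) (at x)"
      "\<And>b. b \<in> Basis \<Longrightarrow> C_k k (\<lambda>x. f' x b)"
    by (rule C_k_SucE) blast
  from Suc.prems(2) obtain g' where g': "\<And>x. (g has_derivative g' x) (at x)"
      "\<And>b. b \<in> Basis \<Longrightarrow> C_k k (\<lambda>x. g' x b)"
    by (rule C_k_SucE) blast
  show ?case
    by (rule C_k_SucI[where f'="\<lambda>x h. f' x h + g' x h"])
       (auto intro!: derivative_intros f' g' Suc.IH)
qed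

lemma C_k_mult:
  assumes "C_k k f" "C_k k g"
  shows "C_k k (\<lambda>x. f x * g x)"
  using assms
proof (induction k arbitrary: f g)
  case 0
  then show ?case by (auto intro: continuous_intros)
next
  case (Suc k)
  from Suc.prems(1) obtain f' where f': "\<And>x. (f has_derivative f' x) (at x)"
      "\<And>b. b \<in> Basis \<Longrightarrow> C_k k (\<lambda>x. f' x b)"
    by (rule C_k_SucE) blast
  from Suc.prems(2) obtain g' where g': "\<And>x. (g has_derivative g' x) (at x)"
      "\<And>b. b \<in> Basis \<Longrightarrow> C_k k (\<lambda>x. g' x b)"
    by (rule C_k_SucE) blast
  show ?case
    by (rule C_k_SucI[where f'="\<lambda>x h. f x * g' x h + f' x h * g x"])
       (auto intro!: has_derivative_mult C_k_add f' g' Suc.IH C_k_SucD[OF Suc.prems(1)] C_k_SucD[OF Suc.prems(2)])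
qed

lemma C_k_compose:
  fixes h :: "real \<Rightarrow> real"
  assumes "C_k k h" "C_k k g"
  shows "C_k k (\<lambda>x. h (g x))"
  using assms
proof (induction k arbitrary: h g)
  case 0
  then show ?case by (auto intro: continuous_on_compose2)
next
  case (Suc k)
  from Suc.prems(1) obtain h' where h': "\<And>x. (h has_derivative h' x) (at x)"
      "\<And>b. b \<in> Basis \<Longrightarrow> C_k k (\<lambda>x. h' x b)"
    by (rule C_k_SucE) blast
  from Suc.prems(2) obtain g' where g': "\<And>x. (g has_derivative g' x) (at x)"
      "\<And>b. b \<in> Basis \<Longrightarrow> C_k k (\<lambda>x. g' x b)"
    by (rule C_k_SucE) blast
  \<comment> \<open>A linear map on the reals is multiplication by its value at 1, so the partial
    derivatives of the composite are products and the product rule for \<open>C_k\<close>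
    applies.\<close>
  have lin: "h' t s = s * h' t 1" for t s
    using linear_scale[OF has_derivative_linear[OF h'(1)], of t s 1] by simp
  show ?case
  proof (rule C_k_SucI[where f'="\<lambda>x v. h' (g x) (g' x v)"])
    show "((\<lambda>x. h (g x)) has_derivative (\<lambda>v. h' (g x) (g' x v))) (at x)" for x
      using has_derivative_compose[OF g'(1) h'(1)] .
    show "C_k k (\<lambda>x. h' (g x) (g' x b))" if "b \<in> Basis" for b
    proof (subst lin, rule C_k_mult)
      show "C_k k (\<lambda>x. h' (g x) 1)"
        using Suc.IH[OF h'(2)[of 1] C_k_SucD[OF Suc.prems(2)]] by simp
    qed (use g' that in auto)
  qed
qed

lemma C_k_affine:
  assumes "C_k k f"
  shows "C_k k (\<lambda>x. f (a + t *\<^sub>R x))"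
  using assms
proof (induction k arbitrary: f)
  case 0
  then show ?case by (auto intro!: continuous_on_compose2[of UNIV f] continuous_intros)
next
  case (Suc k)
  from Suc.prems(1) obtain f' where f': "\<And>x. (f has_derivative f' x) (at x)"
      "\<And>b. b \<in> Basis \<Longrightarrow> C_k k (\<lambda>x. f' x b)"
    by (rule C_k_SucE) blast
  have lin: "f' y (t *\<^sub>R b) = t * f' y b" for y b
    using linear_scale[OF has_derivative_linear[OF f'(1)], of y t b] by simp
  show ?case
  proof (rule C_k_SucI[where f'="\<lambda>x v. f' (a + t *\<^sub>R x) (t *\<^sub>R v)"])
    show "((\<lambda>x. f (a + t *\<^sub>R x)) has_derivative (\<lambda>v. f' (a + t *\<^sub>R x) (t *\<^sub>R v))) (at x)" for x
      by (rule has_derivative_compose[OF _ f'(1)]) (auto intro!: derivative_eq_intros)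
    show "C_k k (\<lambda>x. f' (a + t *\<^sub>R x) (t *\<^sub>R b))" if "b \<in> Basis" for b
      unfolding lin by (intro C_k_mult C_k_const Suc.IH f' that)
  qed
qed

definition smooth :: "('a::euclidean_space \<Rightarrow> real) \<Rightarrow> bool" where
  "smooth f \<longleftrightarrow> (\<forall>k. C_k k f)"

lemma smooth_const [simp]: "smooth (\<lambda>x. c)"
  by (simp add: smooth_def C_k_const)

lemma smooth_add: "smooth f \<Longrightarrow> smooth g \<Longrightarrow> smooth (\<lambda>x. f x + g x)"
  by (simp add: smooth_def C_k_add)

lemma smooth_mult: "smooth f \<Longrightarrow> smooth g \<Longrightarrow> smooth (\<lambda>x. f x * g x)"
  by (simp add: smooth_def C_k_mult)

lemma smooth_diff: "smooth f \<Longrightarrow> smooth g \<Longrightarrow> smooth (\<lambda>x. f x - g x)"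
  using smooth_add[of f "\<lambda>x. (-1) * g x"] smooth_mult[of "\<lambda>x. -1" g] by simp

lemma smooth_compose: "smooth (h :: real \<Rightarrow> real) \<Longrightarrow> smooth g \<Longrightarrow> smooth (\<lambda>x. h (g x))"
  by (simp add: smooth_def C_k_compose)

lemma smooth_affine: "smooth f \<Longrightarrow> smooth (\<lambda>x. f (a + t *\<^sub>R x))"
  by (simp add: smooth_def C_k_affine)

lemma smooth_inner [simp]: "smooth (\<lambda>x. x \<bullet> a)"
proof -
  have "C_k k (\<lambda>x. x \<bullet> a)" for k
  proof (cases k)
    case (Suc k)
    show ?thesis unfolding Suc
      by (rule C_k_SucI[where f'="\<lambda>x h. h \<bullet> a"]) (auto intro!: derivative_eq_intros C_k_const)
  qed (auto intro!: continuous_intros)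
  then show ?thesis by (simp add: smooth_def)
qed

lemma smooth_id [simp]: "smooth (\<lambda>x::real. x)"
  using smooth_inner[of "1::real"] by simp

lemma smooth_sum: "finite A \<Longrightarrow> (\<And>i. i \<in> A \<Longrightarrow> smooth (f i)) \<Longrightarrow> smooth (\<lambda>x. \<Sum>i\<in>A. f i x)"
  by (induction A rule: finite_induct) (auto intro: smooth_add)

lemma smooth_prod: "finite A \<Longrightarrow> (\<And>i. i \<in> A \<Longrightarrow> smooth (f i)) \<Longrightarrow> smooth (\<lambda>x. \<Prod>i\<in>A. f i x)"
  by (induction A rule: finite_induct) (auto intro: smooth_mult)

lemma smooth_norm_squared: "smooth (\<lambda>x. (norm x)\<^sup>2)"
proof -
  have "(\<lambda>x::'a. (norm x)\<^sup>2) = (\<lambda>x. \<Sum>b\<in>Basis. (x \<bullet> b) * (x \<bullet> b))"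
    by (simp add: power2_norm_eq_inner euclidean_inner[symmetric])
  then show ?thesis by (auto intro!: smooth_sum smooth_mult)
qed

text \<open>For n = 0 this is the classical smooth function that vanishes to infinite order at 0.
  The powers of t in the denominator make the family closed, up to linear combinations, under
  differentiation.\<close>

definition flat :: "nat \<Rightarrow> real \<Rightarrow> real" where
  "flat n t = (if t \<le> 0 then 0 else exp (- (1 / t)) / t ^ n)"

text \<open>From the right, y = 1 / t turns the expression into y^n / exp y as y tends to infinity;
  from the left it is constantly 0.\<close>

lemma tendsto_flat_0: "(flat n \<longlongrightarrow> 0) (at 0)"
proof -
  have "((\<lambda>y. y ^ n / exp y) \<longlongrightarrow> 0) (at_top :: real filter)"
    by (rule tendsto_power_div_exp_0)
  then have "((\<lambda>t. (inverse t) ^ n / exp (inverse t)) \<longlongrightarrow> (0::real)) (at_right 0)"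
    by (rule filterlim_compose) (rule filterlim_inverse_at_top_right)
  then have "(flat n \<longlongrightarrow> 0) (at_right 0)"
    by (rule Lim_transform_eventually)
       (auto simp: eventually_at_filter flat_def exp_minus field_simps)
  moreover have "(flat n \<longlongrightarrow> 0) (at_left 0)"
    by (rule Lim_transform_eventually[OF tendsto_const])
       (auto simp: eventually_at_filter flat_def)
  ultimately show ?thesis by (simp add: filterlim_split_at)
qed

lemma flat_has_derivative: "(flat n has_real_derivative flat (n + 2) t - real n * flat (n + 1) t) (at t)"
proof -
  consider "t < 0" | "t = 0" | "t > 0" by linarith
  then show ?thesis
  proof cases
    case 1
    have "((\<lambda>_. 0) has_real_derivative 0) (at t)" by simp
    then have "(flat n has_real_derivative 0) (at t)"
      by (rule DERIV_cong_ev[THEN iffD1, rotated -1, OF _])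
         (use 1 eventually_nhds_in_open[of "{..<0}" t] in \<open>auto simp: flat_def elim!: eventually_mono\<close>)
    then show ?thesis using 1 by (simp add: flat_def)
  next
    case 2
    \<comment> \<open>The difference quotient of \<open>flat n\<close> at 0 is
      \<open>flat (Suc n)\<close>, which tends to 0.\<close>
    have "((\<lambda>h. (flat n (0 + h) - flat n 0) / h) \<longlongrightarrow> 0) (at 0)"
      by (rule Lim_transform_eventually[OF tendsto_flat_0[of "Suc n"]])
         (auto simp: eventually_at_filter flat_def field_simps)
    then show ?thesis using 2 by (simp add: DERIV_def flat_def)
  next
    case 3
    have pow: "t ^ m = t * t ^ (m - Suc 0)" if "m \<noteq> 0" for m
      using that by (cases m) auto
    have "((\<lambda>t. exp (- (1 / t)) / t ^ n) has_real_derivative flat (n + 2) t - real n * flat (n + 1) t) (at t)"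
      using 3 pow[of "n - 1"]
      by (cases "n = 0"; cases "n = 1")
         (auto intro!: derivative_eq_intros simp: flat_def field_simps power2_eq_square power_eq_if[of t n])
    then show ?thesis
      by (rule DERIV_cong_ev[THEN iffD1, rotated -1, OF _])
         (use 3 eventually_nhds_in_open[of "{0<..}" t] in \<open>auto simp: flat_def elim!: eventually_mono\<close>)
  qed
qed

text \<open>The derivative of a member of the family is a combination of two others, so the
  induction on the order must leave n free.\<close>

lemma smooth_flat: "smooth (flat n)"
proof -
  have "C_k k (flat n)" for k
  proof (induction k arbitrary: n)
    case 0
    show ?case
      using flat_has_derivative by (auto intro!: DERIV_continuous_on[of UNIV])
  next
    case (Suc k)
    show ?case
    proof (rule C_k_SucI)
      show "(flat n has_derivative (\<lambda>h. (flat (n + 2) t + (- real n) * flat (n + 1) t) * h)) (at t)" for t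
        using flat_has_derivative[of n t] by (simp add: has_field_derivative_def)
      show "C_k k (\<lambda>t. (flat (n + 2) t + (- real n) * flat (n + 1) t) * b)" for b
        by (intro C_k_mult C_k_add C_k_const Suc)
    qed
  qed
  then show ?thesis by (simp add: smooth_def)
qed

section \<open>Test functions\<close>

lemma grad_eqI: "GDERIV f x :> g \<Longrightarrow> grad f x = g"
  unfolding grad_def
proof (rule the_equality)
  fix g' assume "GDERIV f x :> g" "GDERIV f x :> g'"
  then have "(\<lambda>h. h \<bullet> g') = (\<lambda>h. h \<bullet> g)"
    unfolding gderiv_def by (rule has_derivative_unique[rotated])
  then show "g' = g" by (metis vector_eq_ldot)
qed

lemma smooth_GDERIV:
  assumes "smooth f"
  shows "GDERIV f x :> grad f x"
proof -
  from assms have "C_k (Suc 0) f" by (simp add: smooth_def)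
  then obtain f' where f': "(f has_derivative f' x) (at x)"
    by (rule C_k_SucE) blast
  have "f' x h = h \<bullet> (\<Sum>b\<in>Basis. f' x b *\<^sub>R b)" for h
  proof -
    have "f' x h = f' x (\<Sum>b\<in>Basis. (h \<bullet> b) *\<^sub>R b)" by (simp add: euclidean_representation)
    also have "\<dots> = (\<Sum>b\<in>Basis. (h \<bullet> b) * f' x b)"
      by (simp add: linear_sum[OF has_derivative_linear[OF f']] linear_scale[OF has_derivative_linear[OF f']])
    finally show ?thesis by (simp add: inner_sum_right mult.commute)
  qed
  then have "f' x = (\<lambda>h. h \<bullet> (\<Sum>b\<in>Basis. f' x b *\<^sub>R b))" by (rule ext)
  then have "GDERIV f x :> (\<Sum>b\<in>Basis. f' x b *\<^sub>R b)"
    using f' by (simp only: gderiv_def)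
  then show ?thesis by (simp add: grad_eqI)
qed

lemma smooth_has_derivative: "smooth f \<Longrightarrow> (f has_derivative (\<lambda>h. h \<bullet> grad f x)) (at x)"
  using smooth_GDERIV by (simp add: gderiv_def)

lemma smooth_continuous: "smooth f \<Longrightarrow> continuous_on A f"
  by (metis C_k.simps(1) continuous_on_subset smooth_def top_greatest)

lemma smooth_partial:
  assumes "smooth f" "b \<in> Basis"
  shows "smooth (\<lambda>x. grad f x \<bullet> b)"
proof -
  have "C_k k (\<lambda>x. grad f x \<bullet> b)" for k
  proof -
    have "C_k (Suc k) f" using assms by (simp add: smooth_def)
    then have "C_k k (\<lambda>x. frechet_derivative f (at x) b)" using assms by simp
    moreover have "frechet_derivative f (at x) b = grad f x \<bullet> b" for x
      using frechet_derivative_at[OF smooth_has_derivative[OF assms(1)]]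
      by (metis inner_commute)
    ultimately show ?thesis by simp
  qed
  then show ?thesis by (simp add: smooth_def)
qed

lemma smooth_grad_continuous: "smooth f \<Longrightarrow> continuous_on A (grad f)"
  by (subst continuous_on_componentwise) (auto intro: smooth_continuous smooth_partial)

lemma smooth_measurable:
  assumes "smooth f"
  shows "f \<in> borel_measurable borel" "grad f \<in> borel_measurable borel"
  using smooth_continuous[OF assms, of UNIV] smooth_grad_continuous[OF assms, of UNIV]
  by (auto intro: borel_measurable_continuous_onI)

lemma smooth_line_derivative:
  assumes "smooth f"
  shows "((\<lambda>u. f (x - u *\<^sub>R h)) has_real_derivative - (grad f (x - s *\<^sub>R h) \<bullet> h)) (at s)"
  unfolding has_field_derivative_def
  by (rule has_derivative_eq_rhs[OF has_derivative_compose[OF _ smooth_has_derivative[OF assms]]])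
     (auto intro!: derivative_eq_intros simp: inner_commute)

lemma grad_add: "smooth f \<Longrightarrow> smooth g \<Longrightarrow> grad (\<lambda>x. f x + g x) x = grad f x + grad g x"
  by (intro grad_eqI GDERIV_add smooth_GDERIV)

lemma grad_diff: "smooth f \<Longrightarrow> smooth g \<Longrightarrow> grad (\<lambda>x. f x - g x) x = grad f x - grad g x"
  by (intro grad_eqI GDERIV_diff smooth_GDERIV)

lemma grad_mult:
  "smooth f \<Longrightarrow> smooth g \<Longrightarrow> grad (\<lambda>x. f x * g x) x = f x *\<^sub>R grad g x + g x *\<^sub>R grad f x"
  by (intro grad_eqI GDERIV_mult smooth_GDERIV)

lemma grad_cmult: "smooth f \<Longrightarrow> grad (\<lambda>x. c * f x) x = c *\<^sub>R grad f x"
  using grad_mult[of "\<lambda>_. c" f x] grad_eqI[OF GDERIV_const[of c x]] by simp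

lemma grad_affine:
  assumes "smooth f"
  shows "grad (\<lambda>x. f (a + t *\<^sub>R x)) x = t *\<^sub>R grad f (a + t *\<^sub>R x)"
proof (rule grad_eqI, unfold gderiv_def)
  have "((\<lambda>x. f (a + t *\<^sub>R x)) has_derivative (\<lambda>h. (t *\<^sub>R h) \<bullet> grad f (a + t *\<^sub>R x))) (at x)"
    by (rule has_derivative_compose[OF _ smooth_has_derivative[OF assms]])
       (auto intro!: derivative_eq_intros)
  then show "((\<lambda>x. f (a + t *\<^sub>R x)) has_derivative (\<lambda>h. h \<bullet> t *\<^sub>R grad f (a + t *\<^sub>R x))) (at x)"
    by simp
qed

lemma grad_zero_open:
  assumes "open U" "x \<in> U" "\<And>y. y \<in> U \<Longrightarrow> f y = 0"
  shows "grad f x = 0"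
proof (rule grad_eqI, unfold gderiv_def)
  show "(f has_derivative (\<lambda>h. h \<bullet> 0)) (at x)"
    by (rule has_derivative_transform_within_open[of "\<lambda>_. 0" _ _ _ U]) (use assms in auto)
qed

lemma test_functionsI:
  assumes "smooth f" "compact K" "K \<subseteq> \<Omega>" "\<And>x. x \<notin> K \<Longrightarrow> f x = 0"
  shows "f \<in> test_functions \<Omega>"
proof -
  have "closure {x. f x \<noteq> 0} \<subseteq> K"
    using assms by (intro closure_minimal compact_imp_closed) auto
  moreover have "compact (closure {x. f x \<noteq> 0})"
    using calculation assms(2) by (metis closed_closure compact_Int_closed inf.absorb_iff2)
  ultimately show ?thesis
    using assms by (auto simp: test_functions_def smooth_def)
qed

lemma test_functionsE:
  assumes "f \<in> test_functions \<Omega>"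
  obtains K where "compact K" "K \<subseteq> \<Omega>" "\<And>x. x \<notin> K \<Longrightarrow> f x = 0" "\<And>x. x \<notin> K \<Longrightarrow> grad f x = 0"
proof
  let ?K = "closure {x. f x \<noteq> 0}"
  show "compact ?K" "?K \<subseteq> \<Omega>" using assms by (auto simp: test_functions_def)
  show "f x = 0" if "x \<notin> ?K" for x
    using that closure_subset[of "{x. f x \<noteq> 0}"] by blast
  show "grad f x = 0" if "x \<notin> ?K" for x
  proof (rule grad_zero_open[of "- ?K"])
    show "f y = 0" if "y \<in> - ?K" for y
      using that closure_subset[of "{x. f x \<noteq> 0}"] by blast
  qed (use that in auto)
qed

lemma test_smooth: "f \<in> test_functions \<Omega> \<Longrightarrow> smooth f"
  by (auto simp: test_functions_def smooth_def)

lemma test_functions_mono: "\<Omega> \<subseteq> \<Omega>' \<Longrightarrow> test_functions \<Omega> \<subseteq> test_functions \<Omega>'"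
  by (auto simp: test_functions_def)

lemma test_zero [simp]: "(\<lambda>x. 0) \<in> test_functions \<Omega>"
  by (rule test_functionsI[of _ "{}"]) auto

lemma test_mult_smooth:
  assumes "f \<in> test_functions \<Omega>" "smooth g"
  shows "(\<lambda>x. g x * f x) \<in> test_functions \<Omega>"
  using assms(1) by (rule test_functionsE)
    (auto intro!: test_functionsI smooth_mult assms test_smooth[OF assms(1)])

lemma test_cmult: "f \<in> test_functions \<Omega> \<Longrightarrow> (\<lambda>x. c * f x) \<in> test_functions \<Omega>"
  using test_mult_smooth[of f \<Omega> "\<lambda>_. c"] by simp

lemma test_add:
  assumes "f \<in> test_functions \<Omega>" "g \<in> test_functions \<Omega>"
  shows "(\<lambda>x. f x + g x) \<in> test_functions \<Omega>"
proof -
  obtain K where K: "compact K" "K \<subseteq> \<Omega>" "\<And>x. x \<notin> K \<Longrightarrow> f x = 0"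
    using assms(1) by (rule test_functionsE) blast
  obtain L where L: "compact L" "L \<subseteq> \<Omega>" "\<And>x. x \<notin> L \<Longrightarrow> g x = 0"
    using assms(2) by (rule test_functionsE) blast
  show ?thesis
    by (rule test_functionsI[of _ "K \<union> L"])
       (use K L assms in \<open>auto intro: smooth_add test_smooth\<close>)
qed

lemma test_diff:
  assumes "f \<in> test_functions \<Omega>" "g \<in> test_functions \<Omega>"
  shows "(\<lambda>x. f x - g x) \<in> test_functions \<Omega>"
  using test_add[OF assms(1) test_cmult[OF assms(2), of "-1"]] by simp

lemma test_affine:
  assumes "f \<in> test_functions ((\<lambda>x. a + t *\<^sub>R x) ` \<Omega>)" "t \<noteq> 0"
  shows "(\<lambda>x. f (a + t *\<^sub>R x)) \<in> test_functions \<Omega>"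
proof -
  obtain K where K: "compact K" "K \<subseteq> (\<lambda>x. a + t *\<^sub>R x) ` \<Omega>" "\<And>x. x \<notin> K \<Longrightarrow> f x = 0"
    using assms(1) by (rule test_functionsE) blast
  let ?g = "\<lambda>y. inverse t *\<^sub>R (y - a)"
  show ?thesis
  proof (rule test_functionsI[of _ "?g ` K"])
    show "compact (?g ` K)" using K(1) by (intro compact_continuous_image continuous_intros)
    show "?g ` K \<subseteq> \<Omega>" using K(2) assms(2) by auto
    show "f (a + t *\<^sub>R x) = 0" if "x \<notin> ?g ` K" for x
    proof (rule K(3))
      show "a + t *\<^sub>R x \<notin> K"
        using that assms(2) by (force intro: image_eqI[of _ ?g "a + t *\<^sub>R x"])
    qed
  qed (use assms in \<open>auto intro: smooth_affine test_smooth\<close>)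
qed

section \<open>Integrability of test functions and invariance under translations\<close>

lemma integrable_compact_support:
  fixes f :: "'a::euclidean_space \<Rightarrow> 'b::euclidean_space"
  assumes "continuous_on UNIV f" "compact K" "\<And>x. x \<notin> K \<Longrightarrow> f x = 0"
  shows "integrable lborel f"
proof -
  have "integrable lborel (\<lambda>x. indicator K x *\<^sub>R f x)"
    using borel_integrable_compact[OF assms(2) continuous_on_subset[OF assms(1)]]
    by auto
  also have "(\<lambda>x. indicator K x *\<^sub>R f x) = f"
    using assms(3) by (auto simp: indicator_def)
  finally show ?thesis .
qed

lemma test_integrable:
  assumes "f \<in> test_functions \<Omega>"
  shows "integrable lborel f" "integrable lborel (\<lambda>x. (f x)\<^sup>2)"
    "integrable lborel (\<lambda>x. (norm (grad f x))\<^sup>2)"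
proof -
  note [continuous_intros] = smooth_continuous[OF test_smooth[OF assms]]
    smooth_grad_continuous[OF test_smooth[OF assms]]
  obtain K where K: "compact K" "\<And>x. x \<notin> K \<Longrightarrow> f x = 0" "\<And>x. x \<notin> K \<Longrightarrow> grad f x = 0"
    using assms by (rule test_functionsE) blast
  show "integrable lborel f"
    by (rule integrable_compact_support[OF _ K(1)]) (auto intro!: continuous_intros simp: K)
  show "integrable lborel (\<lambda>x. (f x)\<^sup>2)"
    by (rule integrable_compact_support[OF _ K(1)]) (auto intro!: continuous_intros simp: K)
  show "integrable lborel (\<lambda>x. (norm (grad f x))\<^sup>2)"
    by (rule integrable_compact_support[OF _ K(1)]) (auto intro!: continuous_intros simp: K)
qed

lemma integrable_translate:
  fixes f :: "'a::euclidean_space \<Rightarrow> 'b::{banach, second_countable_topology}"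
  assumes "integrable lborel f"
  shows "integrable lborel (\<lambda>x. f (a + x))"
    and "(\<integral>x. f (a + x) \<partial>lborel) = (\<integral>x. f x \<partial>lborel)"
proof -
  have eq: "lborel = distr lborel borel (\<lambda>x. a + x)"
    by (rule lborel_distr_plus[symmetric])
  have [measurable]: "f \<in> borel_measurable borel" using assms by auto
  show "integrable lborel (\<lambda>x. f (a + x))"
    using assms by (subst (asm) eq) (simp add: integrable_distr_eq)
  show "(\<integral>x. f (a + x) \<partial>lborel) = (\<integral>x. f x \<partial>lborel)"
    by (subst (2) eq) (simp add: integral_distr)
qed

text \<open>A substitute for the divergence theorem: by translation invariance the difference
  quotients have a nonnegative integral.\<close>

lemma directional_derivative_integral_nonneg:
  fixes f f' :: "'a::euclidean_space \<Rightarrow> real"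
  assumes "\<epsilon> > 0" and R: "R \<in> sets borel"
    and meas: "f \<in> borel_measurable borel" "f' \<in> borel_measurable borel"
    and deriv: "\<And>x s. x \<in> R \<Longrightarrow> 0 \<le> s \<Longrightarrow> s \<le> \<epsilon> \<Longrightarrow>
      ((\<lambda>u. f (x - u *\<^sub>R h)) has_real_derivative - f' (x - s *\<^sub>R h)) (at s)"
    and bound: "\<And>x s. x \<in> R \<Longrightarrow> 0 \<le> s \<Longrightarrow> s \<le> \<epsilon> \<Longrightarrow> \<bar>f' (x - s *\<^sub>R h)\<bar> \<le> M"
    and bound0: "\<And>x s. x \<in> R \<Longrightarrow> 0 \<le> s \<Longrightarrow> s \<le> \<epsilon> \<Longrightarrow> \<bar>f (x - s *\<^sub>R h)\<bar> \<le> M"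
    and supp: "bounded K" "\<And>x. x \<notin> K \<Longrightarrow> f x = 0"
    and M_nonneg: "0 \<le> M"
    and mono: "\<And>y s. 0 \<le> s \<Longrightarrow> s \<le> \<epsilon> \<Longrightarrow>
      indicator R (y + s *\<^sub>R h) * f y \<le> indicator R y * f y"
  shows "integrable lborel (\<lambda>x. indicator R x * f' x) \<and> 0 \<le> (\<integral>x. indicator R x * f' x \<partial>lborel)"
proof -
  obtain B0 where B0: "\<And>x. x \<in> K \<Longrightarrow> norm x \<le> B0" using supp(1) by (auto simp: bounded_iff)
  \<comment> \<open>The support is enlarged by the longest shift, so that one ball dominates all
    translates.\<close>
  define B where "B = B0 + \<epsilon> * norm h"
  note [measurable] = R meas
  have out: "f (x - s *\<^sub>R h) = 0" if "x \<notin> cball 0 B" "0 \<le> s" "s \<le> \<epsilon>" for x s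
  proof (rule supp(2), rule notI)
    assume "x - s *\<^sub>R h \<in> K"
    then have "norm (x - s *\<^sub>R h) \<le> B0" by (rule B0)
    moreover have "norm x \<le> norm (x - s *\<^sub>R h) + norm (s *\<^sub>R h)"
      by (metis diff_add_cancel norm_triangle_ineq)
    moreover have "norm (s *\<^sub>R h) \<le> \<epsilon> * norm h" using that by (simp add: mult_right_mono)
    ultimately show False using that by (simp add: B_def)
  qed
  have int_ball: "integrable lborel (\<lambda>x::'a. M * indicator (cball 0 B) x)"
    by (intro integrable_mult_right integrable_real_indicator) (simp_all add: emeasure_bounded_finite less_top[symmetric] flip: infinity_ennreal_def)
  have I: "integrable lborel (\<lambda>x. indicator R x * f (x - s *\<^sub>R h))" if "0 \<le> s" "s \<le> \<epsilon>" for s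
    by (rule Bochner_Integration.integrable_bound[OF int_ball])
       (use bound0 that out M_nonneg in \<open>auto simp: indicator_def intro!: AE_I2\<close>)
  define s where "s n = \<epsilon> / real (Suc n)" for n
  have s: "0 < s n" "s n \<le> \<epsilon>" for n
    using \<open>\<epsilon> > 0\<close> by (auto simp: s_def divide_simps mult_left_le)
  have s0: "s \<longlonglongrightarrow> 0"
    unfolding s_def by (rule lim_const_over_n[THEN LIMSEQ_Suc])
  define q where "q n x = indicator R x * ((f (x - 0 *\<^sub>R h) - f (x - s n *\<^sub>R h)) / s n)" for n x
  have q_nonneg: "0 \<le> (\<integral>x. q n x \<partial>lborel)" for n
  proof -
    have i0: "integrable lborel (\<lambda>x. indicator R x * f x)"
      using I[of 0] \<open>\<epsilon> > 0\<close> by simp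
    have i1: "integrable lborel (\<lambda>x. indicator R x * f (x - s n *\<^sub>R h))"
      using I[of "s n"] s[of n] by simp
    \<comment> \<open>A translation moves the shift from f to the indicator of R, where
      \<open>mono\<close> compares the two integrands pointwise.\<close>
    have "(\<integral>x. indicator R x * f (x - s n *\<^sub>R h) \<partial>lborel)
        = (\<integral>y. indicator R (s n *\<^sub>R h + y) * f y \<partial>lborel)"
      using integrable_translate(2)[OF i1, of "s n *\<^sub>R h"] by simp
    also have "\<dots> \<le> (\<integral>x. indicator R x * f x \<partial>lborel)"
      using integrable_translate(1)[OF i1, of "s n *\<^sub>R h"] s[of n]
      by (intro integral_mono[OF _ i0]) (auto simp: add.commute less_imp_le intro!: mono)
    finally show ?thesis
      using s(1)[of n] i0 i1
      by (simp add: q_def right_diff_distrib diff_divide_distrib divide_right_mono)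
  qed
  \<comment> \<open>The difference quotients equal values of f' at intermediate points, hence are
    bounded by M uniformly in n; this is what dominated convergence needs.\<close>
  have mvt: "\<exists>\<xi>\<ge>0. \<xi> \<le> \<epsilon> \<and> f (x - 0 *\<^sub>R h) - f (x - s n *\<^sub>R h) = s n * f' (x - \<xi> *\<^sub>R h)"
    if "x \<in> R" for x n
  proof -
    have "\<exists>\<xi>>0. \<xi> < s n \<and> f (x - s n *\<^sub>R h) - f (x - 0 *\<^sub>R h) = (s n - 0) * (- f' (x - \<xi> *\<^sub>R h))"
      by (rule MVT2[OF s(1)]) (use s[of n] in \<open>auto intro!: deriv[OF that]\<close>)
    then show ?thesis using s(2)[of n] by (auto intro: exI[of _ "_::real"] less_imp_le)
  qed
  have ptw: "AE x in lborel. (\<lambda>n. q n x) \<longlonglongrightarrow> indicator R x * f' x"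
  proof (rule AE_I2)
    fix x
    show "(\<lambda>n. q n x) \<longlonglongrightarrow> indicator R x * f' x"
    proof (cases "x \<in> R")
      case True
      have "((\<lambda>u. (f (x - (0 + u) *\<^sub>R h) - f (x - 0 *\<^sub>R h)) / u) \<longlongrightarrow> - f' (x - 0 *\<^sub>R h)) (at 0)"
        using deriv[OF True, of 0] \<open>\<epsilon> > 0\<close> by (simp add: DERIV_def)
      then have "(\<lambda>n. (f (x - (0 + s n) *\<^sub>R h) - f (x - 0 *\<^sub>R h)) / s n) \<longlonglongrightarrow> - f' (x - 0 *\<^sub>R h)"
      proof (rule filterlim_compose)
        show "filterlim s (at 0) sequentially"
          using s0 s(1) by (auto simp: filterlim_at eventually_sequentially intro!: less_imp_neq[symmetric])
      qed
      then have "(\<lambda>n. - ((f (x - (0 + s n) *\<^sub>R h) - f (x - 0 *\<^sub>R h)) / s n)) \<longlonglongrightarrow> - (- f' (x - 0 *\<^sub>R h))"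
        by (rule tendsto_minus)
      moreover have "- ((f (x - (0 + s n) *\<^sub>R h) - f (x - 0 *\<^sub>R h)) / s n) = q n x" for n
        using True by (simp add: q_def minus_divide_left)
      ultimately show ?thesis using True by simp
    qed (simp add: q_def)
  qed
  have dom: "AE x in lborel. norm (q n x) \<le> M * indicator (cball 0 B) x" for n
  proof (rule AE_I2)
    fix x
    show "norm (q n x) \<le> M * indicator (cball 0 B) x"
    proof (cases "x \<in> R \<and> x \<in> cball 0 B")
      case True
      then obtain \<xi> where "\<xi> \<ge> 0" "\<xi> \<le> \<epsilon>" "f (x - 0 *\<^sub>R h) - f (x - s n *\<^sub>R h) = s n * f' (x - \<xi> *\<^sub>R h)"
        using mvt by blast
      then show ?thesis using True bound[of x \<xi>] s(1)[of n] by (simp add: q_def)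
    next
      case False
      then consider "x \<notin> R" "x \<in> cball 0 B" | "x \<notin> cball 0 B" by blast
      then show ?thesis
      proof cases
        case 1
        then show ?thesis using 1 M_nonneg by (auto simp: q_def)
      next
        case 2
        then show ?thesis using out[of x 0] out[of x "s n"] s[of n] \<open>\<epsilon> > 0\<close> by (simp add: q_def)
      qed
    qed
  qed
  have [measurable]: "q n \<in> borel_measurable lborel" for n
    unfolding q_def by measurable
  have int: "integrable lborel (\<lambda>x. indicator R x * f' x)"
    by (rule integrable_dominated_convergence[OF _ _ int_ball ptw dom]) auto
  have lim: "(\<lambda>n. \<integral>x. q n x \<partial>lborel) \<longlonglongrightarrow> (\<integral>x. indicator R x * f' x \<partial>lborel)"
    by (rule integral_dominated_convergence[OF _ _ int_ball ptw dom]) auto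
  moreover have "0 \<le> (\<integral>x. indicator R x * f' x \<partial>lborel)"
    by (rule LIMSEQ_le_const[OF lim]) (use q_nonneg in auto)
  ultimately show ?thesis using int by blast
qed

section \<open>The Hersch--Protter inequality\<close>

lemma test_bounded:
  assumes "f \<in> test_functions \<Omega>"
  obtains A where "A \<ge> 0" "\<And>x. \<bar>f x\<bar> \<le> A" "\<And>x. norm (grad f x) \<le> A"
proof -
  obtain K where K: "compact K" "\<And>x. x \<notin> K \<Longrightarrow> f x = 0" "\<And>x. x \<notin> K \<Longrightarrow> grad f x = 0"
    using assms by (rule test_functionsE) blast
  have "bounded (f ` K)" "bounded (grad f ` K)"
    using K(1) smooth_continuous[OF test_smooth[OF assms]] smooth_grad_continuous[OF test_smooth[OF assms]]
    by (auto intro!: compact_imp_bounded compact_continuous_image)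
  then obtain A B where "\<And>x. x \<in> K \<Longrightarrow> \<bar>f x\<bar> \<le> A" "\<And>x. x \<in> K \<Longrightarrow> norm (grad f x) \<le> B"
    by (auto simp: bounded_iff)
  then have "\<bar>f x\<bar> \<le> max 0 (max A B)" "norm (grad f x) \<le> max 0 (max A B)" for x
    using K(2,3)[of x] by (cases "x \<in> K"; fastforce)+
  then show ?thesis by (intro that[of "max 0 (max A B)"]) auto
qed

text \<open>The weight \<open>p(t) = a tan (a (H - t))\<close> solves the Riccati equation \<open>p' = - a\<^sup>2 - p\<^sup>2\<close>, so that
  \<open>(\<partial>\<phi>)\<^sup>2 - a\<^sup>2 \<phi>\<^sup>2 \<ge> \<partial>(\<phi>\<^sup>2 p)\<close>. The set \<open>R\<close> is the part of the
  body which is nearest to one of the bounding hyperplanes.\<close>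

lemma poincare_region:
  fixes nv :: "nat \<Rightarrow> 'a::euclidean_space" and c :: "nat \<Rightarrow> real"
  assumes \<phi>: "\<phi> \<in> test_functions \<Omega>"
    and unit: "\<And>i. i < m \<Longrightarrow> norm (nv i) = 1"
    and pos: "\<And>i x. i < m \<Longrightarrow> x \<in> \<Omega> \<Longrightarrow> c i < x \<bullet> nv i"
    and a: "a > 0" "a * H < pi / 2" and H: "H > 0" and i: "i < m"
  defines "\<delta> j x \<equiv> x \<bullet> nv j - c j"
  defines "R \<equiv> {x. 0 < \<delta> i x \<and> \<delta> i x \<le> H \<and> (\<forall>j\<in>{..<i}. \<delta> i x < \<delta> j x) \<and> (\<forall>j\<in>{i<..<m}. \<delta> i x \<le> \<delta> j x)}"
  shows "a\<^sup>2 * (\<integral>x. indicator R x * (\<phi> x)\<^sup>2 \<partial>lborel) \<le> (\<integral>x. indicator R x * (norm (grad \<phi> x))\<^sup>2 \<partial>lborel)"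
proof -
  define h where "h = nv i"
  define p where "p t = a * tan (a * (H - t))" for t
  define f where "f x = (\<phi> x)\<^sup>2 * p (\<delta> i x)" for x
  define f' where "f' x = 2 * \<phi> x * (grad \<phi> x \<bullet> h) * p (\<delta> i x) - (\<phi> x)\<^sup>2 * (a\<^sup>2 + (p (\<delta> i x))\<^sup>2)" for x
  \<comment> \<open>This makes a (H + \<epsilon>) the midpoint of a H and pi / 2: shifts up to
    \<epsilon> keep the argument of the tangent away from its pole. P below is the largest value of
    p on the resulting range [- \<epsilon>, H].\<close>
  define \<epsilon> where "\<epsilon> = (pi / 2 - a * H) / (2 * a)"
  have \<epsilon>: "\<epsilon> > 0" "a * (H + \<epsilon>) < pi / 2"
    using a by (auto simp: \<epsilon>_def field_simps)
  have hh: "h \<bullet> h = 1" using unit[OF i] by (simp add: h_def norm_eq_1)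
  have sm: "smooth \<phi>" using test_smooth[OF \<phi>] .
  note [measurable] = smooth_measurable[OF sm]
  have [measurable]: "\<delta> j \<in> borel_measurable borel" for j
    unfolding \<delta>_def by measurable
  have [measurable]: "R \<in> sets borel"
    unfolding R_def by measurable
  have [measurable]: "p \<in> borel_measurable borel"
    unfolding p_def tan_def by measurable
  obtain A where A: "A \<ge> 0" "\<And>x. \<bar>\<phi> x\<bar> \<le> A" "\<And>x. norm (grad \<phi> x) \<le> A"
    using \<phi> by (rule test_bounded) blast
  have A': "\<bar>grad \<phi> x \<bullet> h\<bar> \<le> A" for x
    using Cauchy_Schwarz_ineq2[of "grad \<phi> x" h] A(3)[of x] unit[OF i] by (simp add: h_def)
  define P where "P = p (- \<epsilon>)"
  have p_bd: "0 \<le> p t" "p t \<le> P" if "- \<epsilon> \<le> t" "t \<le> H" for t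
  proof -
    have "0 \<le> a * (H - t)" "a * (H - t) \<le> a * (H - - \<epsilon>)"
      using that a by (auto intro!: mult_left_mono)
    moreover have "a * (H - - \<epsilon>) < pi / 2" using \<epsilon> by simp
    ultimately have "0 \<le> tan (a * (H - t))" "tan (a * (H - t)) \<le> tan (a * (H - - \<epsilon>))"
      using tan_gt_zero[of "a * (H - t)"] pi_gt_zero
      by (cases "a * (H - t) = 0"; force intro!: tan_mono_le)+
    then show "0 \<le> p t" "p t \<le> P"
      using a by (auto simp: p_def P_def intro!: mult_left_mono)
  qed
  have P0: "P \<ge> 0" using p_bd[of H] H \<epsilon> by simp
  have p_deriv: "(p has_real_derivative - (a\<^sup>2 + (p t)\<^sup>2)) (at t)" if "- \<epsilon> \<le> t" "t \<le> H" for t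
  proof -
    have "0 \<le> a * (H - t)" "a * (H - t) \<le> a * (H + \<epsilon>)"
      using that a by (auto intro!: mult_left_mono)
    then have c: "cos (a * (H - t)) > 0" using \<epsilon> by (intro cos_gt_zero_pi) auto
    have "((\<lambda>t. a * tan (a * (H - t))) has_real_derivative a * (inverse ((cos (a * (H - t)))\<^sup>2) * (- a))) (at t)"
      using c by (auto intro!: derivative_eq_intros)
    moreover have "inverse ((cos (a * (H - t)))\<^sup>2) = 1 + (tan (a * (H - t)))\<^sup>2"
      using tan_sec[of "a * (H - t)"] c by (simp add: power_inverse)
    ultimately show ?thesis
      unfolding p_def[abs_def] by (simp add: power2_eq_square algebra_simps)
  qed
  have \<delta>_line: "\<delta> i (x - s *\<^sub>R h) = \<delta> i x - s" for x s
    using hh by (simp add: \<delta>_def h_def inner_diff_left)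
  have range: "- \<epsilon> \<le> \<delta> i (x - s *\<^sub>R h)" "\<delta> i (x - s *\<^sub>R h) \<le> H" if "x \<in> R" "0 \<le> s" "s \<le> \<epsilon>" for x s
    using that by (auto simp: \<delta>_line R_def)
  obtain K where K: "compact K" "\<And>x. x \<notin> K \<Longrightarrow> \<phi> x = 0" "K \<subseteq> \<Omega>"
    using \<phi> by (rule test_functionsE) blast
  have \<phi>2: "(\<phi> x)\<^sup>2 \<le> A\<^sup>2" for x using A by (simp add: abs_le_square_iff[symmetric])
  define M where "M = 2 * A * A * P + A\<^sup>2 * (a\<^sup>2 + P\<^sup>2) + A\<^sup>2 * P"
  have DI: "integrable lborel (\<lambda>x. indicator R x * f' x) \<and> 0 \<le> (\<integral>x. indicator R x * f' x \<partial>lborel)"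
  proof (rule directional_derivative_integral_nonneg[of \<epsilon> R f f' h M K, rotated -1], goal_cases)
    show "f \<in> borel_measurable borel" "f' \<in> borel_measurable borel"
      unfolding f_def f'_def by measurable
    show "((\<lambda>u. f (x - u *\<^sub>R h)) has_real_derivative - f' (x - s *\<^sub>R h)) (at s)"
      if "x \<in> R" "0 \<le> s" "s \<le> \<epsilon>" for x s
    proof -
      have 1: "((\<lambda>u. \<phi> (x - u *\<^sub>R h)) has_real_derivative - (grad \<phi> (x - s *\<^sub>R h) \<bullet> h)) (at s)"
      by (rule smooth_line_derivative[OF sm])
      have 2: "((\<lambda>u. p (\<delta> i x - u)) has_real_derivative - (- (a\<^sup>2 + (p (\<delta> i x - s))\<^sup>2))) (at s)"
      proof -
        have "((\<lambda>u. \<delta> i x - u) has_real_derivative -1) (at s)"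
          by (auto intro!: derivative_eq_intros)
        moreover have "(p has_real_derivative - (a\<^sup>2 + (p (\<delta> i x - s))\<^sup>2)) (at (\<delta> i x - s))"
          using p_deriv range[OF that] by (simp add: \<delta>_line)
        ultimately show ?thesis
          using DERIV_chain2[of p _ "\<lambda>u. \<delta> i x - u" s "-1" UNIV] by fastforce
      qed
      show ?thesis
        unfolding f_def f'_def \<delta>_line
        by (rule derivative_eq_intros 1 2 refl)+ (simp add: algebra_simps)
    qed
    show "\<bar>f' (x - s *\<^sub>R h)\<bar> \<le> M" if "x \<in> R" "0 \<le> s" "s \<le> \<epsilon>" for x s
    proof -
      let ?y = "x - s *\<^sub>R h"
      have pb: "0 \<le> p (\<delta> i ?y)" "p (\<delta> i ?y) \<le> P" using p_bd range[OF that] by auto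
      have "\<bar>2 * \<phi> ?y * (grad \<phi> ?y \<bullet> h) * p (\<delta> i ?y)\<bar> \<le> 2 * A * A * P"
        using A A'[of ?y] pb P0 unfolding abs_mult by (intro mult_mono) auto
      moreover have "\<bar>(\<phi> ?y)\<^sup>2 * (a\<^sup>2 + (p (\<delta> i ?y))\<^sup>2)\<bar> \<le> A\<^sup>2 * (a\<^sup>2 + P\<^sup>2)"
        using \<phi>2[of ?y] pb P0 unfolding abs_mult by (intro mult_mono) (auto intro: power_mono)
      moreover have "0 \<le> A\<^sup>2 * P" using P0 by simp
      ultimately show ?thesis unfolding f'_def M_def by linarith
    qed
    show "\<bar>f (x - s *\<^sub>R h)\<bar> \<le> M" if "x \<in> R" "0 \<le> s" "s \<le> \<epsilon>" for x s
    proof -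
      let ?y = "x - s *\<^sub>R h"
      have pb: "0 \<le> p (\<delta> i ?y)" "p (\<delta> i ?y) \<le> P" using p_bd range[OF that] by auto
      have "\<bar>f ?y\<bar> \<le> A\<^sup>2 * P"
        using \<phi>2[of ?y] pb P0 unfolding f_def abs_mult by (intro mult_mono) auto
      moreover have "0 \<le> 2 * A * A * P" "0 \<le> A\<^sup>2 * (a\<^sup>2 + P\<^sup>2)" using P0 A by auto
      ultimately show ?thesis unfolding M_def by linarith
    qed
    show "bounded K" using K compact_imp_bounded by auto
    show "f x = 0" if "x \<notin> K" for x using K that by (auto simp: f_def)
    show "0 \<le> M" using A P0 by (auto simp: M_def)
    show "indicator R (y + s *\<^sub>R h) * f y \<le> indicator R y * f y" if "0 \<le> s" "s \<le> \<epsilon>" for y s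
    proof (cases "y + s *\<^sub>R h \<in> R")
      case True
      show ?thesis
      proof (cases "y \<in> \<Omega>")
        case False
        then have "\<phi> y = 0" using K by blast
        then show ?thesis by (simp add: f_def)
      next
        case yO: True
        \<comment> \<open>The distance to hyperplane j grows at most at unit speed in the direction
          h, the distance to hyperplane i exactly at unit speed. Hence a point of \<Omega> whose
          translate lies in R lies in R itself.\<close>
        have 1: "\<delta> j (y + s *\<^sub>R h) \<le> \<delta> j y + s" if "j < m" for j
        proof -
          have "h \<bullet> nv j \<le> 1"
            using Cauchy_Schwarz_ineq2[of h "nv j"] unit[OF i] unit[OF that] by (simp add: h_def)
          then have "s * (h \<bullet> nv j) \<le> s" using \<open>0 \<le> s\<close> by (simp add: mult_left_le)
          then show ?thesis by (simp add: \<delta>_def inner_add_left)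
        qed
        have 2: "\<delta> i (y + s *\<^sub>R h) = \<delta> i y + s"
          using \<delta>_line[of y "- s"] by simp
        have 3: "0 < \<delta> i y" using pos[OF i yO] by (simp add: \<delta>_def)
        have "\<delta> i y < \<delta> j y" if "j < i" for j
        proof -
          have "\<delta> i (y + s *\<^sub>R h) < \<delta> j (y + s *\<^sub>R h)" using True that by (simp add: R_def)
          then show ?thesis using 1[of j] 2 that i by linarith
        qed
        moreover have "\<delta> i y \<le> \<delta> j y" if "i < j" "j < m" for j
        proof -
          have "\<delta> i (y + s *\<^sub>R h) \<le> \<delta> j (y + s *\<^sub>R h)" using True that by (simp add: R_def)
          then show ?thesis using 1[of j] 2 that by linarith
        qed
        moreover have "\<delta> i y \<le> H"
          using True 2 that by (simp add: R_def)
        ultimately have "y \<in> R"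
          using 3 by (simp add: R_def)
        then show ?thesis using True by simp
      qed
    next
      case False
      have "0 \<le> f y" if "y \<in> R"
        using p_bd(1)[of "\<delta> i y"] that \<epsilon> by (auto simp: f_def R_def)
      then show ?thesis using False by (auto simp: indicator_def)
    qed
  qed (use \<epsilon> in auto)
  note int_f' = DI[THEN conjunct1] and nonneg = DI[THEN conjunct2]
  have int1: "integrable lborel (\<lambda>x. indicator R x * (\<phi> x)\<^sup>2)"
    "integrable lborel (\<lambda>x. indicator R x * (norm (grad \<phi> x))\<^sup>2)"
    using test_integrable[OF \<phi>] by (auto intro!: integrable_real_mult_indicator simp: mult.commute[of "indicator _ _"])
  have "a\<^sup>2 * (\<integral>x. indicator R x * (\<phi> x)\<^sup>2 \<partial>lborel)
      \<le> (\<integral>x. indicator R x * f' x \<partial>lborel) + a\<^sup>2 * (\<integral>x. indicator R x * (\<phi> x)\<^sup>2 \<partial>lborel)"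
    using nonneg by simp
  also have "\<dots> = (\<integral>x. indicator R x * f' x + a\<^sup>2 * (indicator R x * (\<phi> x)\<^sup>2) \<partial>lborel)"
    using int_f' int1(1) by simp
  also have "\<dots> \<le> (\<integral>x. indicator R x * (norm (grad \<phi> x))\<^sup>2 \<partial>lborel)"
  proof (rule integral_mono)
    fix x
    have "f' x + a\<^sup>2 * (\<phi> x)\<^sup>2 = (grad \<phi> x \<bullet> h)\<^sup>2 - (grad \<phi> x \<bullet> h - \<phi> x * p (\<delta> i x))\<^sup>2"
      by (simp add: f'_def power2_eq_square algebra_simps)
    also have "\<dots> \<le> (norm (grad \<phi> x))\<^sup>2"
      using Cauchy_Schwarz_ineq[of "grad \<phi> x" h]
        zero_le_power2[of "grad \<phi> x \<bullet> h - \<phi> x * p (\<delta> i x)"]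
      unfolding hh power2_norm_eq_inner by linarith
    finally show "indicator R x * f' x + a\<^sup>2 * (indicator R x * (\<phi> x)\<^sup>2) \<le> indicator R x * (norm (grad \<phi> x))\<^sup>2"
      by (auto simp: indicator_def)
  qed (use int_f' int1 in auto)
  finally show ?thesis .
qed

text \<open>The regions are disjoint and cover the points where \<phi> is nonzero, so the estimates
  on the single regions add up. The bound H on the distance to the nearest hyperplane is asked only
  where \<phi> is nonzero, which later allows finitely many hyperplanes to suffice.\<close>

lemma poincare_halfspaces:
  fixes nv :: "nat \<Rightarrow> 'a::euclidean_space" and c :: "nat \<Rightarrow> real"
  assumes \<phi>: "\<phi> \<in> test_functions \<Omega>"
    and unit: "\<And>i. i < m \<Longrightarrow> norm (nv i) = 1"
    and pos: "\<And>i x. i < m \<Longrightarrow> x \<in> \<Omega> \<Longrightarrow> c i < x \<bullet> nv i"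
    and near: "\<And>x. \<phi> x \<noteq> 0 \<Longrightarrow> \<exists>i<m. x \<bullet> nv i - c i \<le> H"
    and a: "a > 0" "a * H < pi / 2" and H: "H > 0"
  shows "a\<^sup>2 * (\<integral>x. (\<phi> x)\<^sup>2 \<partial>lborel) \<le> (\<integral>x. (norm (grad \<phi> x))\<^sup>2 \<partial>lborel)"
proof -
  define \<delta> where "\<delta> j x = x \<bullet> nv j - c j" for j x
  \<comment> \<open>Ties go to the least index: strict inequality for smaller indices and weak
    inequality for larger ones make the regions disjoint.\<close>
  define R where "R i = {x. 0 < \<delta> i x \<and> \<delta> i x \<le> H \<and> (\<forall>j\<in>{..<i}. \<delta> i x < \<delta> j x) \<and> (\<forall>j\<in>{i<..<m}. \<delta> i x \<le> \<delta> j x)}" for i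
  have region: "a\<^sup>2 * (\<integral>x. indicator (R i) x * (\<phi> x)\<^sup>2 \<partial>lborel) \<le> (\<integral>x. indicator (R i) x * (norm (grad \<phi> x))\<^sup>2 \<partial>lborel)"
    if "i < m" for i
    unfolding R_def \<delta>_def using \<phi> unit pos a H that by (rule poincare_region)
  have [measurable]: "\<delta> j \<in> borel_measurable borel" for j
    unfolding \<delta>_def by measurable
  have [measurable]: "R i \<in> sets borel" for i
    unfolding R_def by measurable
  have disj: "disjoint_family_on R {..<m}"
  proof -
    have "R i \<inter> R j = {}" if "i < j" "j < m" for i j
    proof (rule ccontr)
      assume "R i \<inter> R j \<noteq> {}"
      then obtain x where x: "x \<in> R i" "x \<in> R j" by blast
      have "\<delta> i x \<le> \<delta> j x" using x(1) that by (simp add: R_def)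
      moreover have "\<delta> j x < \<delta> i x" using x(2) that by (simp add: R_def)
      ultimately show False by simp
    qed
    then show ?thesis
      unfolding disjoint_family_on_def by (metis inf_commute lessThan_iff linorder_neqE_nat)
  qed
  have cover: "x \<in> (\<Union>i<m. R i)" if nz: "\<phi> x \<noteq> 0" for x
  proof -
    have xO: "x \<in> \<Omega>" using nz by (rule_tac test_functionsE[OF \<phi>]) blast
    obtain i0 where i0: "i0 < m" "\<delta> i0 x \<le> H" using near[OF nz] by (auto simp: \<delta>_def)
    define \<mu> where "\<mu> = Min ((\<lambda>j. \<delta> j x) ` {..<m})"
    have ne: "(\<lambda>j. \<delta> j x) ` {..<m} \<noteq> {}" using i0 by auto
    have \<mu>_le: "\<mu> \<le> \<delta> j x" if "j < m" for j using that by (auto simp: \<mu>_def)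
    have "\<exists>i. i < m \<and> \<delta> i x = \<mu>"
      using Min_in[OF _ ne] by (auto simp: \<mu>_def)
    define i where "i = (LEAST i. i < m \<and> \<delta> i x = \<mu>)"
    have i: "i < m" "\<delta> i x = \<mu>"
      using LeastI_ex[OF \<open>\<exists>i. i < m \<and> \<delta> i x = \<mu>\<close>] by (auto simp: i_def)
    have "\<delta> i x < \<delta> j x" if "j < i" for j
      using not_less_Least[of j "\<lambda>i. i < m \<and> \<delta> i x = \<mu>"] that i \<mu>_le[of j]
      unfolding i_def[symmetric] by force
    moreover have "\<delta> i x \<le> H" using \<mu>_le[OF i0(1)] i i0 by simp
    moreover have "0 < \<delta> i x" using pos[OF i(1) xO] by (simp add: \<delta>_def)
    ultimately have "x \<in> R i" using i \<mu>_le by (auto simp: R_def)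
    then show ?thesis using i by auto
  qed
  have ind: "(\<Sum>i<m. indicator (R i) x) = (indicator (\<Union>i<m. R i) x :: real)" for x
    by (rule indicator_UN_disjoint[OF _ disj, symmetric]) simp
  have int1: "integrable lborel (\<lambda>x. indicator (R i) x * (\<phi> x)\<^sup>2)"
    "integrable lborel (\<lambda>x. indicator (R i) x * (norm (grad \<phi> x))\<^sup>2)" for i
    using test_integrable[OF \<phi>] by (auto intro!: integrable_real_mult_indicator simp: mult.commute[of "indicator _ _"])
  have "a\<^sup>2 * (\<integral>x. (\<phi> x)\<^sup>2 \<partial>lborel) = a\<^sup>2 * (\<integral>x. (\<Sum>i<m. indicator (R i) x * (\<phi> x)\<^sup>2) \<partial>lborel)"
    unfolding sum_distrib_right[symmetric] ind using cover
    by (intro arg_cong[where f="\<lambda>t. a\<^sup>2 * t"] Bochner_Integration.integral_cong) (auto simp: indicator_def)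
  also have "\<dots> = (\<Sum>i<m. a\<^sup>2 * (\<integral>x. indicator (R i) x * (\<phi> x)\<^sup>2 \<partial>lborel))"
    by (subst Bochner_Integration.integral_sum) (auto simp: sum_distrib_left int1)
  also have "\<dots> \<le> (\<Sum>i<m. \<integral>x. indicator (R i) x * (norm (grad \<phi> x))\<^sup>2 \<partial>lborel)"
    by (intro sum_mono region) auto
  also have "\<dots> = (\<integral>x. (\<Sum>i<m. indicator (R i) x * (norm (grad \<phi> x))\<^sup>2) \<partial>lborel)"
    by (subst Bochner_Integration.integral_sum) (auto simp: int1)
  also have "\<dots> \<le> (\<integral>x. (norm (grad \<phi> x))\<^sup>2 \<partial>lborel)"
  proof (rule integral_mono)
    show "(\<Sum>i<m. indicator (R i) x * (norm (grad \<phi> x))\<^sup>2) \<le> (norm (grad \<phi> x))\<^sup>2" for x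
      unfolding sum_distrib_right[symmetric] ind by (auto simp: indicator_def)
  qed (intro Bochner_Integration.integrable_sum int1 test_integrable[OF \<phi>])+
  finally show ?thesis .
qed

section \<open>Inradius and supporting half-spaces\<close>

lemma frontier_nonempty_bounded_open:
  assumes "open \<Omega>" "bounded \<Omega>" "\<Omega> \<noteq> {}"
  shows "frontier (\<Omega> :: 'a::euclidean_space set) \<noteq> {}"
  using assms frontier_eq_empty not_bounded_UNIV by blast

lemma inradius_ge:
  assumes "open \<Omega>" "bounded \<Omega>" "x \<in> (\<Omega> :: 'a::euclidean_space set)"
  shows "infdist x (frontier \<Omega>) \<le> inradius \<Omega>"
proof -
  have "frontier \<Omega> \<noteq> {}" using frontier_nonempty_bounded_open assms by blast
  then obtain y where y: "y \<in> frontier \<Omega>" by blast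
  obtain B where B: "\<And>x. x \<in> \<Omega> \<Longrightarrow> dist x y \<le> B"
    using assms(2) by (metis bounded_any_center dist_commute)
  have "bdd_above ((\<lambda>x. infdist x (frontier \<Omega>)) ` \<Omega>)"
    using B infdist_le[OF y] by (intro bdd_aboveI2[of _ _ B]) (meson order_trans)
  then show ?thesis unfolding inradius_def using assms(3) by (rule cSUP_upper[rotated])
qed

lemma infdist_frontier_pos:
  assumes "open \<Omega>" "bounded \<Omega>" "x \<in> (\<Omega> :: 'a::euclidean_space set)"
  shows "0 < infdist x (frontier \<Omega>)"
proof -
  have "frontier \<Omega> \<noteq> {}" using frontier_nonempty_bounded_open assms by blast
  moreover have "x \<notin> frontier \<Omega>" using assms by (simp add: frontier_def interior_open)
  ultimately show ?thesis
    using in_closed_iff_infdist_zero[OF frontier_closed] infdist_nonneg by (metis order_le_less)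
qed

lemma inradius_pos:
  assumes "open \<Omega>" "bounded \<Omega>" "\<Omega> \<noteq> {}"
  shows "0 < inradius (\<Omega> :: 'a::euclidean_space set)"
  using infdist_frontier_pos inradius_ge assms by (metis all_not_in_conv order_less_le_trans)

text \<open>Take a frontier point y nearest to x and a hyperplane supporting \<Omega> at y: the
  distance from x to the hyperplane is at most |x - y|, hence at most the inradius. The inequality
  on \<Omega> is strict because \<Omega> is open.\<close>

lemma supporting_halfspace_near:
  assumes "open \<Omega>" "bounded \<Omega>" "convex \<Omega>" "x \<in> (\<Omega> :: 'a::euclidean_space set)"
  obtains n c where "norm n = 1" "\<And>y. y \<in> \<Omega> \<Longrightarrow> c < y \<bullet> n" "x \<bullet> n - c \<le> inradius \<Omega>"
proof -
  have "frontier \<Omega> \<noteq> {}" using frontier_nonempty_bounded_open assms by blast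
  then obtain y where y: "y \<in> frontier \<Omega>" "infdist x (frontier \<Omega>) = dist x y"
    using infdist_attains_inf[OF frontier_closed] by metis
  have "rel_interior \<Omega> = \<Omega>" using assms by (simp add: rel_interior_open)
  moreover have "y \<notin> \<Omega>" "y \<in> closure \<Omega>" using y assms by (auto simp: frontier_def interior_open)
  ultimately obtain a where a: "a \<noteq> 0" "\<And>z. z \<in> \<Omega> \<Longrightarrow> a \<bullet> y < a \<bullet> z"
    using supporting_hyperplane_relative_frontier[OF assms(3), of y] by metis
  define n where "n = inverse (norm a) *\<^sub>R a"
  have nn: "norm n = 1" using a by (simp add: n_def)
  show ?thesis
  proof (rule that[of n "y \<bullet> n"])
    show "y \<bullet> n < z \<bullet> n" if "z \<in> \<Omega>" for z
      using a(2)[OF that] a(1) by (simp add: n_def inner_commute)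
    have "x \<bullet> n - y \<bullet> n \<le> norm (x - y) * norm n"
      using norm_cauchy_schwarz[of "x - y" n] by (simp add: inner_diff_left)
    then show "x \<bullet> n - y \<bullet> n \<le> inradius \<Omega>"
      using inradius_ge[OF assms(1,2,4)] y nn by (simp add: dist_norm)
  qed (rule nn)
qed

text \<open>Each point has a supporting hyperplane within distance r. Relaxing r to some H > r makes
  the condition open, so the compact support of \<phi> needs only finitely many of these
  hyperplanes. The price is a constant a < pi / (2r), removed at the end by a limit.\<close>

theorem hersch_protter:
  fixes \<Omega> :: "'a::euclidean_space set"
  assumes \<Omega>: "open \<Omega>" "bounded \<Omega>" "convex \<Omega>" "\<Omega> \<noteq> {}" and \<phi>: "\<phi> \<in> test_functions \<Omega>"
  shows "(pi / (2 * inradius \<Omega>))\<^sup>2 * (\<integral>x. (\<phi> x)\<^sup>2 \<partial>lborel) \<le> (\<integral>x. (norm (grad \<phi> x))\<^sup>2 \<partial>lborel)"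
proof -
  define r where "r = inradius \<Omega>"
  have r: "r > 0" using inradius_pos \<Omega> by (auto simp: r_def)
  obtain K where K: "compact K" "\<And>x. x \<notin> K \<Longrightarrow> \<phi> x = 0" "K \<subseteq> \<Omega>"
    using \<phi> by (rule test_functionsE) blast
  have main: "a\<^sup>2 * (\<integral>x. (\<phi> x)\<^sup>2 \<partial>lborel) \<le> (\<integral>x. (norm (grad \<phi> x))\<^sup>2 \<partial>lborel)"
    if a: "0 < a" "a < pi / (2 * r)" for a
  proof -
    \<comment> \<open>H lies halfway between r and pi / (2a), so that r < H and a H < pi / 2 both
      hold.\<close>
    define H where "H = (r + pi / (2 * a)) / 2"
    have "r < pi / (2 * a)" using a r by (simp add: field_simps)
    moreover have "0 < pi / (2 * a)" "0 < a * (r * 2)" using a r by simp_all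
    then have "0 < pi + a * (r * 2)" using pi_gt_zero by linarith
    with calculation have H: "r < H" "H > 0" "a * H < pi / 2"
      using a r by (auto simp: H_def field_simps)
    have "\<exists>n c. norm n = 1 \<and> (\<forall>y\<in>\<Omega>. c < y \<bullet> n) \<and> x \<bullet> n - c \<le> r" if "x \<in> \<Omega>" for x
      unfolding r_def using supporting_halfspace_near[OF \<Omega>(1-3) that] by metis
    then obtain n c where nc: "\<And>x. x \<in> \<Omega> \<Longrightarrow> norm (n x) = 1"
      "\<And>x y. x \<in> \<Omega> \<Longrightarrow> y \<in> \<Omega> \<Longrightarrow> c x < y \<bullet> n x" "\<And>x. x \<in> \<Omega> \<Longrightarrow> x \<bullet> n x - c x \<le> r"
      by metis
    define U where "U x = {z. z \<bullet> n x - c x < H}" for x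
    have U: "open (U x)" for x
      unfolding U_def by (intro open_Collect_less continuous_intros)
    have "K \<subseteq> (\<Union>x\<in>K. U x)"
      using nc(3) K(3) H by (fastforce simp: U_def)
    then obtain X where X: "X \<subseteq> K" "finite X" "K \<subseteq> (\<Union>x\<in>X. U x)"
      using compactE_image[OF K(1), of K U] U by metis
    obtain e :: "nat \<Rightarrow> 'a" and m where e: "bij_betw e {..<m} X"
      using ex_bij_betw_nat_finite[OF X(2)] by (metis atLeast0LessThan)
    have eX: "e i \<in> \<Omega>" if "i < m" for i
      using e that X(1) K(3) by (auto simp: bij_betw_def)
    show ?thesis
    proof (rule poincare_halfspaces[OF \<phi>, of m "\<lambda>i. n (e i)" "\<lambda>i. c (e i)" H])
      show "\<exists>i<m. x \<bullet> n (e i) - c (e i) \<le> H" if "\<phi> x \<noteq> 0" for x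
      proof -
        have "x \<in> K" using K(2) that by blast
        then obtain z where "z \<in> X" "x \<in> U z" using X(3) by blast
        then show ?thesis using e by (force simp: bij_betw_def U_def)
      qed
    qed (use nc eX H a in auto)
  qed
  show ?thesis
  proof (rule field_le_mult_one_interval)
    \<comment> \<open>The factor t < 1 corresponds to a = sqrt t * pi / (2r), since a enters
      squared.\<close>
    fix t :: real assume t: "0 < t" "t < 1"
    have "sqrt t * (pi / (2 * r)) < 1 * (pi / (2 * r))"
      using t r by (intro mult_strict_right_mono) auto
    then show "t * ((pi / (2 * inradius \<Omega>))\<^sup>2 * (\<integral>x. (\<phi> x)\<^sup>2 \<partial>lborel)) \<le> (\<integral>x. (norm (grad \<phi> x))\<^sup>2 \<partial>lborel)"
      using main[of "sqrt t * (pi / (2 * r))"] t r by (simp add: r_def power_mult_distrib power_divide)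
  qed
qed

text \<open>With R the whole space the monotonicity condition is trivial; applying the nonnegativity
  to h and to - h leaves only the value 0.\<close>

lemma test_integral_directional_zero:
  assumes "\<phi> \<in> test_functions \<Omega>"
  shows "(\<integral>x. grad \<phi> x \<bullet> h \<partial>lborel) = 0"
proof -
  have sm: "smooth \<phi>" using test_smooth[OF assms] .
  note [measurable] = smooth_measurable[OF sm]
  obtain A where A: "A \<ge> 0" "\<And>x. \<bar>\<phi> x\<bar> \<le> A" "\<And>x. norm (grad \<phi> x) \<le> A"
    using assms by (rule test_bounded) blast
  obtain K where K: "compact K" "\<And>x. x \<notin> K \<Longrightarrow> \<phi> x = 0"
    using assms by (rule test_functionsE) blast
  have *: "0 \<le> (\<integral>x. indicator UNIV x * (grad \<phi> x \<bullet> h) \<partial>lborel)" for h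
  proof (rule directional_derivative_integral_nonneg[THEN conjunct2, of 1 UNIV \<phi> _ h "A + A * norm h" K])
    show "((\<lambda>u. \<phi> (x - u *\<^sub>R h)) has_real_derivative - (grad \<phi> (x - s *\<^sub>R h) \<bullet> h)) (at s)" for x s
      by (rule smooth_line_derivative[OF sm])
    show "\<bar>grad \<phi> (x - s *\<^sub>R h) \<bullet> h\<bar> \<le> A + A * norm h" for x s
    proof -
      have "\<bar>grad \<phi> (x - s *\<^sub>R h) \<bullet> h\<bar> \<le> norm (grad \<phi> (x - s *\<^sub>R h)) * norm h"
        by (rule Cauchy_Schwarz_ineq2)
      also have "\<dots> \<le> A * norm h" using A by (intro mult_right_mono) auto
      finally show ?thesis using A by simp
    qed
    show "\<bar>\<phi> (x - s *\<^sub>R h)\<bar> \<le> A + A * norm h" for x s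
      using A(2)[of "x - s *\<^sub>R h"] mult_nonneg_nonneg[OF A(1) norm_ge_zero, of h] by linarith
    show "(\<lambda>x. grad \<phi> x \<bullet> h) \<in> borel_measurable borel" "\<phi> \<in> borel_measurable borel"
      by measurable
  qed (use K(2) compact_imp_bounded[OF K(1)] A(1) in simp_all)
  have "(\<integral>x. grad \<phi> x \<bullet> (- h) \<partial>lborel) = - (\<integral>x. grad \<phi> x \<bullet> h \<partial>lborel)"
    by (simp only: inner_minus_right integral_minus)
  moreover have "0 \<le> (\<integral>x. grad \<phi> x \<bullet> h \<partial>lborel)" "0 \<le> (\<integral>x. grad \<phi> x \<bullet> (- h) \<partial>lborel)"
    using *[of h] *[of "- h"] by (simp_all only: indicator_UNIV mult_1)
  ultimately show ?thesis by linarith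
qed

lemma test_integral_square_pos:
  assumes "\<phi> \<in> test_functions \<Omega>" "\<phi> x0 \<noteq> 0"
  shows "0 < (\<integral>x. (\<phi> x)\<^sup>2 \<partial>lborel)"
proof (rule ccontr)
  have c: "continuous_on UNIV \<phi>" using smooth_continuous[OF test_smooth[OF assms(1)]] .
  assume "\<not> ?thesis"
  moreover have "0 \<le> (\<integral>x. (\<phi> x)\<^sup>2 \<partial>lborel)" by simp
  ultimately have "(\<integral>x. (\<phi> x)\<^sup>2 \<partial>lborel) = 0" by linarith
  then have "AE x in lborel. (\<phi> x)\<^sup>2 = 0"
    using test_integrable[OF assms(1)] by (subst (asm) integral_nonneg_eq_0_iff_AE) auto
  then have "AE x in lebesgue. \<phi> x = 0" by (auto simp: AE_completion_iff)
  then have "negligible {x. \<phi> x \<noteq> 0}"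
    unfolding eventually_ae_filter_negligible by (blast intro: negligible_subset)
  moreover have "open {x. \<phi> x \<noteq> 0}"
    using c by (intro open_Collect_neq) (auto intro: continuous_intros)
  ultimately show False using open_not_negligible assms(2) by blast
qed

section \<open>The Bessel function as the profile of a radial eigenfunction\<close>

definition bessel_coeff :: "real \<Rightarrow> nat \<Rightarrow> real" where
  "bessel_coeff \<nu> k = (- 1) ^ k * rGamma (real k + \<nu> + 1) / fact k"

text \<open>\<open>J\<^sub>\<nu> x = (x / 2) powr \<nu> * bessel_entire \<nu> (x\<^sup>2 / 4)\<close>\<close>

definition bessel_entire :: "real \<Rightarrow> real \<Rightarrow> real" where
  "bessel_entire \<nu> s = (\<Sum>k. bessel_coeff \<nu> k * s ^ k)"

text \<open>This is the functional equation of the reciprocal Gamma function; read as an identity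
  between coefficients of s^k it is the differential equation s G'' + (\<nu> + 1) G' + G =
  0.\<close>

lemma bessel_coeff_Suc:
  "real (Suc k) * (real k + \<nu> + 1) * bessel_coeff \<nu> (Suc k) = - bessel_coeff \<nu> k"
proof -
  have "real (Suc k) * (real k + \<nu> + 1) * bessel_coeff \<nu> (Suc k)
      = - ((- 1) ^ k * ((real k + \<nu> + 1) * rGamma (real k + \<nu> + 1 + 1)) / fact k)"
    by (simp add: bessel_coeff_def add_ac)
  then show ?thesis unfolding rGamma_plus1 by (simp add: bessel_coeff_def)
qed

lemma summable_bessel:
  assumes "\<nu> > -1"
  shows "summable (\<lambda>k. bessel_coeff \<nu> k * s ^ k)"
proof (rule summable_ratio_test[of "1/2" "nat \<lceil>2 * \<bar>s\<bar>\<rceil> + 1"])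
  \<comment> \<open>Beyond this index k + 1 \<ge> 2 |s| and k + \<nu> + 1 \<ge> 1, so by the
    recursion each term is at most half the preceding one.\<close>
  fix k assume k: "nat \<lceil>2 * \<bar>s\<bar>\<rceil> + 1 \<le> k"
  then have "2 * \<bar>s\<bar> \<le> real k" "1 \<le> real k" by linarith+
  then have "(2 * \<bar>s\<bar>) * 1 \<le> real (Suc k) * (real k + \<nu> + 1)"
    using assms by (intro mult_mono) auto
  then have "\<bar>s\<bar> \<le> 1/2 * (real (Suc k) * (real k + \<nu> + 1))" by simp
  then have "\<bar>bessel_coeff \<nu> (Suc k)\<bar> * \<bar>s\<bar> \<le> \<bar>bessel_coeff \<nu> (Suc k)\<bar> * (1/2 * (real (Suc k) * (real k + \<nu> + 1)))"
    by (intro mult_left_mono) auto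
  also have "\<dots> = 1/2 * \<bar>real (Suc k) * (real k + \<nu> + 1) * bessel_coeff \<nu> (Suc k)\<bar>"
    using assms by (simp add: abs_mult)
  also have "\<dots> = 1/2 * \<bar>bessel_coeff \<nu> k\<bar>"
    by (simp only: bessel_coeff_Suc abs_minus_cancel)
  finally have "\<bar>bessel_coeff \<nu> (Suc k)\<bar> * \<bar>s\<bar> * \<bar>s\<bar> ^ k \<le> 1/2 * \<bar>bessel_coeff \<nu> k\<bar> * \<bar>s\<bar> ^ k"
    by (intro mult_right_mono) auto
  then show "norm (bessel_coeff \<nu> (Suc k) * s ^ Suc k) \<le> 1/2 * norm (bessel_coeff \<nu> k * s ^ k)"
    by (simp add: abs_mult power_abs mult_ac)
qed simp

text \<open>The two derivatives are the formally differentiated power series; the equation follows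
  by comparing coefficients. Continuity of the second derivative is recorded for the bounds on
  compact sets in the ball estimate.\<close>

lemma bessel_ode:
  assumes "\<nu> > -1"
  obtains G1 G2 where
    "\<And>s. (bessel_entire \<nu> has_real_derivative G1 s) (at s)"
    "\<And>s. (G1 has_real_derivative G2 s) (at s)"
    "continuous_on UNIV G2"
    "\<And>s. s * G2 s + (\<nu> + 1) * G1 s + bessel_entire \<nu> s = 0"
proof
  let ?c = "bessel_coeff \<nu>"
  define G1 where "G1 s = (\<Sum>k. diffs ?c k * s ^ k)" for s :: real
  define G2 where "G2 s = (\<Sum>k. diffs (diffs ?c) k * s ^ k)" for s :: real
  have s0: "summable (\<lambda>k. ?c k * s ^ k)" for s using summable_bessel[OF assms] .
  have s1: "summable (\<lambda>k. diffs ?c k * s ^ k)" for s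
    by (rule termdiff_converges_all[OF s0])
  have s2: "summable (\<lambda>k. diffs (diffs ?c) k * s ^ k)" for s
    by (rule termdiff_converges_all[OF s1])
  show "(bessel_entire \<nu> has_real_derivative G1 s) (at s)" for s
    unfolding bessel_entire_def[abs_def] G1_def by (rule termdiffs_strong_converges_everywhere[OF s0])
  show "(G1 has_real_derivative G2 s) (at s)" for s
    unfolding G1_def[abs_def] G2_def by (rule termdiffs_strong_converges_everywhere[OF s1])
  have "\<exists>D. (G2 has_real_derivative D) (at s)" for s
    unfolding G2_def[abs_def] using termdiffs_strong_converges_everywhere[OF s2] by blast
  then show "continuous_on UNIV G2"
    by (metis DERIV_continuous_on has_field_derivative_at_within)
  show "s * G2 s + (\<nu> + 1) * G1 s + bessel_entire \<nu> s = 0" for s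
  proof -
    \<comment> \<open>The factor k makes the term at index 0 vanish, so the shift by one that comes
      from multiplying G2 by s costs nothing.\<close>
    define e where "e k = real k * diffs ?c k * s ^ k" for k
    have e: "e (Suc k) = s * (diffs (diffs ?c) k * s ^ k)" for k
      by (simp add: e_def diffs_def)
    have "(\<lambda>k. e (Suc k)) sums (s * G2 s)"
      unfolding e G2_def by (rule sums_mult) (rule summable_sums[OF s2])
    then have 2: "e sums (s * G2 s)"
      by (subst (asm) sums_Suc_iff) (simp add: e_def)
    have 1: "(\<lambda>k. (\<nu> + 1) * (diffs ?c k * s ^ k)) sums ((\<nu> + 1) * G1 s)"
      unfolding G1_def by (rule sums_mult) (rule summable_sums[OF s1])
    have 0: "(\<lambda>k. ?c k * s ^ k) sums bessel_entire \<nu> s"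
      unfolding bessel_entire_def by (rule summable_sums[OF s0])
    have "(\<lambda>k. e k + (\<nu> + 1) * (diffs ?c k * s ^ k) + ?c k * s ^ k)
        sums (s * G2 s + (\<nu> + 1) * G1 s + bessel_entire \<nu> s)"
      by (intro sums_add 0 1 2)
    moreover have "e k + (\<nu> + 1) * (diffs ?c k * s ^ k) + ?c k * s ^ k = 0" for k
    proof -
      have "e k + (\<nu> + 1) * (diffs ?c k * s ^ k) + ?c k * s ^ k
          = (real (Suc k) * (real k + \<nu> + 1) * ?c (Suc k) + ?c k) * s ^ k"
        by (simp add: e_def diffs_def algebra_simps)
      then show ?thesis by (simp only: bessel_coeff_Suc) simp
    qed
    ultimately show ?thesis using sums_unique2[OF _ sums_zero] by simp
  qed
qed

lemma Bessel_J_eq: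
  assumes "\<nu> > -1" "x > 0"
  shows "Bessel_J \<nu> x = (x / 2) powr \<nu> * bessel_entire \<nu> (x\<^sup>2 / 4)"
proof -
  have "(- 1) ^ k * rGamma (real k + \<nu> + 1) / fact k * (x / 2) powr (2 * real k + \<nu>)
      = (x / 2) powr \<nu> * (bessel_coeff \<nu> k * (x\<^sup>2 / 4) ^ k)" for k
  proof -
    have "(x / 2) powr (2 * real k) = (x\<^sup>2 / 4) ^ k"
    proof -
      have "(x / 2) powr (2 * real k) = (x / 2) ^ (2 * k)"
        using assms powr_realpow[of "x / 2" "2 * k"] by simp
      also have "\<dots> = ((x / 2)\<^sup>2) ^ k" by (rule power_mult)
      finally show ?thesis by (simp add: power_divide)
    qed
    then show ?thesis by (simp add: powr_add bessel_coeff_def)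
  qed
  then show ?thesis
    unfolding Bessel_J_def bessel_entire_def
    using suminf_mult[OF summable_bessel[OF assms(1)]] by simp
qed

text \<open>With \<open>G(c|x|\<^sup>2)\<close> the positive radial solution of \<open>\<Delta>v + 4cv = 0\<close> and
  \<open>X = grad v / v\<close>, one has \<open>div X + |X|\<^sup>2 = - 4c\<close>, hence
  \<open>|grad \<phi>|\<^sup>2 - 4c\<phi>\<^sup>2 = div (\<phi>\<^sup>2 X) + |grad \<phi> - \<phi> X|\<^sup>2\<close>.\<close>

lemma ball_poincare:
  fixes \<phi> :: "'a::euclidean_space \<Rightarrow> real"
  assumes \<phi>: "\<phi> \<in> test_functions (ball 0 1)" and c: "c > 0"
    and pos: "\<And>s. 0 \<le> s \<Longrightarrow> s < c \<Longrightarrow> 0 < bessel_entire ((real DIM('a) - 2) / 2) s"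
  shows "4 * c * (\<integral>x. (\<phi> x)\<^sup>2 \<partial>lborel) \<le> (\<integral>x. (norm (grad \<phi> x))\<^sup>2 \<partial>lborel)"
proof -
  define \<nu> where "\<nu> = (real DIM('a) - 2) / 2"
  have \<nu>: "\<nu> > -1" by (simp add: \<nu>_def)
  define G where "G = bessel_entire \<nu>"
  obtain G1 G2 where G: "\<And>s. (G has_real_derivative G1 s) (at s)"
    "\<And>s. (G1 has_real_derivative G2 s) (at s)" "continuous_on UNIV G2"
    "\<And>s. s * G2 s + (\<nu> + 1) * G1 s + G s = 0"
    using bessel_ode[OF \<nu>] unfolding G_def by metis
  have cont: "continuous_on A G" "continuous_on A G1" "continuous_on A G2" for A
    using G by (auto intro: DERIV_continuous_on has_field_derivative_at_within continuous_on_subset)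
  have [measurable]: "G \<in> borel_measurable borel" "G1 \<in> borel_measurable borel" "G2 \<in> borel_measurable borel"
    using cont by (auto intro: borel_measurable_continuous_onI)
  have sm: "smooth \<phi>" using test_smooth[OF \<phi>] .
  note [measurable] = smooth_measurable[OF sm]
  obtain K where K: "compact K" "K \<subseteq> ball 0 1" "\<And>x. x \<notin> K \<Longrightarrow> \<phi> x = 0" "\<And>x. x \<notin> K \<Longrightarrow> grad \<phi> x = 0"
    using \<phi> by (rule test_functionsE) blast
  define \<sigma> where "\<sigma> x = c * (x \<bullet> x)" for x :: 'a
  have \<sigma>: "0 < G (\<sigma> x)" if "x \<in> ball 0 1" for x
  proof -
    have "norm x * norm x < 1 * 1" using that by (intro mult_strict_mono') auto
    then have "x \<bullet> x < 1" by (simp add: dot_square_norm power2_eq_square)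
    then show ?thesis
      using pos[of "\<sigma> x"] c by (auto simp: \<sigma>_def G_def \<nu>_def)
  qed
  define h where "h s = G1 s / G s" for s
  define h' where "h' s = G2 s / G s - (h s)\<^sup>2" for s
  have h: "(h has_real_derivative h' s) (at s)" if "G s \<noteq> 0" for s
    unfolding h_def[abs_def] h'_def using that
    by (auto intro!: derivative_eq_intros G simp: field_simps power2_eq_square)
  define X where "X x = (2 * c * h (\<sigma> x)) *\<^sub>R x" for x
  \<comment> \<open>The components of \<phi>^2 X and their partial derivatives. Off K both vanish
    because of the factor \<phi>, whatever the quotient by G may be there.\<close>
  define f where "f b x = (\<phi> x)\<^sup>2 * (X x \<bullet> b)" for b x
  define f' where "f' b x = 2 * \<phi> x * (grad \<phi> x \<bullet> b) * (X x \<bullet> b) +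
    (\<phi> x)\<^sup>2 * (2 * c * h (\<sigma> x) + 4 * c\<^sup>2 * h' (\<sigma> x) * (x \<bullet> b)\<^sup>2)" for b x
  have [measurable]: "\<sigma> \<in> borel_measurable borel" "h \<in> borel_measurable borel" "h' \<in> borel_measurable borel"
    unfolding \<sigma>_def h_def h'_def by measurable
  have [measurable]: "X \<in> borel_measurable borel" unfolding X_def by measurable
  have contK: "continuous_on K (f b)" "continuous_on K (f' b)" for b
  proof -
    have nz: "G (c * (x \<bullet> x)) \<noteq> 0" if "x \<in> K" for x
      using \<sigma>[of x] K(2) that by (force simp: \<sigma>_def)
    have compose: "continuous_on K (\<lambda>x. F (c * (x \<bullet> x)))" if "continuous_on UNIV F" for F :: "real \<Rightarrow> real"
      by (rule continuous_on_compose2[OF that]) (auto intro!: continuous_intros)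
    note [continuous_intros] = smooth_continuous[OF sm] smooth_grad_continuous[OF sm]
      compose[OF cont(1)] compose[OF cont(2)] compose[OF cont(3)]
    show "continuous_on K (f b)" "continuous_on K (f' b)"
      unfolding f_def f'_def X_def h_def h'_def \<sigma>_def
      by (auto intro!: continuous_intros nz)
  qed
  have zero: "f b x = 0" "f' b x = 0" if "x \<notin> K" for b x
    using K that by (auto simp: f_def f'_def)
  have DI: "integrable lborel (\<lambda>x. f' b x) \<and> 0 \<le> (\<integral>x. f' b x \<partial>lborel)" if b: "b \<in> Basis" for b
  proof -
    have "bounded (f b ` K)" "bounded (f' b ` K)"
      using contK K(1) by (auto intro!: compact_imp_bounded compact_continuous_image)
    then obtain M1 M2 where M: "\<And>x. x \<in> K \<Longrightarrow> \<bar>f b x\<bar> \<le> M1" "\<And>x. x \<in> K \<Longrightarrow> \<bar>f' b x\<bar> \<le> M2"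
      by (auto simp: bounded_iff)
    define M where "M = max 0 (max M1 M2)"
    have bd: "\<bar>f b x\<bar> \<le> M" "\<bar>f' b x\<bar> \<le> M" for x
      using M[of x] zero[of x b] by (cases "x \<in> K"; force simp: M_def)+
    have "integrable lborel (\<lambda>x. indicator UNIV x * f' b x) \<and> 0 \<le> (\<integral>x. indicator UNIV x * f' b x \<partial>lborel)"
    proof (rule directional_derivative_integral_nonneg[of 1 UNIV "f b" _ b M K])
      show "f b \<in> borel_measurable borel" "f' b \<in> borel_measurable borel"
        unfolding f_def f'_def by measurable
      show "((\<lambda>u. f b (x - u *\<^sub>R b)) has_real_derivative - f' b (x - s *\<^sub>R b)) (at s)" for x s
      proof (cases "x - s *\<^sub>R b \<in> K")
        case True
        have 1: "((\<lambda>u. \<phi> (x - u *\<^sub>R b)) has_real_derivative - (grad \<phi> (x - s *\<^sub>R b) \<bullet> b)) (at s)"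
      by (rule smooth_line_derivative[OF sm])
        have \<sigma>': "((\<lambda>u. \<sigma> (x - u *\<^sub>R b)) has_real_derivative - (2 * c * ((x - s *\<^sub>R b) \<bullet> b))) (at s)"
          unfolding \<sigma>_def using b
          by (auto intro!: derivative_eq_intros simp: inner_diff_left inner_diff_right inner_commute algebra_simps)
        have nz: "G (\<sigma> (x - s *\<^sub>R b)) \<noteq> 0" using \<sigma>[of "x - s *\<^sub>R b"] K(2) True by fastforce
        have 2: "((\<lambda>u. h (\<sigma> (x - u *\<^sub>R b))) has_real_derivative
            h' (\<sigma> (x - s *\<^sub>R b)) * - (2 * c * ((x - s *\<^sub>R b) \<bullet> b))) (at s)"
          by (rule DERIV_chain2[OF h[OF nz] \<sigma>'])
        have 3: "((\<lambda>u. (x - u *\<^sub>R b) \<bullet> b) has_real_derivative - 1) (at s)"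
          using b by (auto intro!: derivative_eq_intros simp: inner_diff_left)
        show ?thesis
          unfolding f_def f'_def X_def inner_scaleR_left
          by (rule derivative_eq_intros 1 2 3 refl)+ (simp add: algebra_simps power2_eq_square)
      next
        case False
        have "((\<lambda>u. 0) has_real_derivative 0) (at s)" by simp
        \<comment> \<open>K is closed, so the line stays off K near s and \<open>f b\<close> is
          locally zero; differentiability of X is thus required on K alone.\<close>
        moreover have "eventually (\<lambda>u. x - u *\<^sub>R b \<in> - K) (nhds s)"
        proof -
          have "open ((\<lambda>u. x - u *\<^sub>R b) -` (- K))"
            using K(1) by (intro open_vimage continuous_intros) (auto simp: compact_imp_closed open_Compl)
          then show ?thesis using False eventually_nhds_in_open[of _ s] by fastforce
        qed
        then have "eventually (\<lambda>u. f b (x - u *\<^sub>R b) = 0) (nhds s)"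
          by eventually_elim (auto intro: zero)
        ultimately have "((\<lambda>u. f b (x - u *\<^sub>R b)) has_real_derivative 0) (at s)"
          by (subst DERIV_cong_ev[OF refl _ refl])
        then show ?thesis using zero(2)[OF False] by simp
      qed
    qed (use bd zero(1) compact_imp_bounded[OF K(1)] in \<open>simp_all add: M_def\<close>)
    then show ?thesis by simp
  qed
  have N: "integrable lborel (\<lambda>x. (\<phi> x)\<^sup>2)" "integrable lborel (\<lambda>x. (norm (grad \<phi> x))\<^sup>2)"
    using test_integrable[OF \<phi>] by auto
  have "4 * c * (\<integral>x. (\<phi> x)\<^sup>2 \<partial>lborel) \<le> 4 * c * (\<integral>x. (\<phi> x)\<^sup>2 \<partial>lborel) + (\<Sum>b\<in>Basis. \<integral>x. f' b x \<partial>lborel)"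
    using DI by (auto intro!: sum_nonneg)
  also have "\<dots> = (\<integral>x. 4 * c * (\<phi> x)\<^sup>2 + (\<Sum>b\<in>Basis. f' b x) \<partial>lborel)"
    using DI N by (subst Bochner_Integration.integral_add) (auto simp: Bochner_Integration.integral_sum)
  also have "\<dots> \<le> (\<integral>x. (norm (grad \<phi> x))\<^sup>2 \<partial>lborel)"
  proof (rule integral_mono)
    show "integrable lborel (\<lambda>x. 4 * c * (\<phi> x)\<^sup>2 + (\<Sum>b\<in>Basis. f' b x))"
      using DI N by (intro Bochner_Integration.integrable_add Bochner_Integration.integrable_sum) auto
    show "4 * c * (\<phi> x)\<^sup>2 + (\<Sum>b\<in>Basis. f' b x) \<le> (norm (grad \<phi> x))\<^sup>2" for x
    proof (cases "x \<in> K")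
      case False
      then show ?thesis using K zero by simp
    next
      case True
      define s where "s = \<sigma> x"
      have Gs: "G s > 0" using \<sigma> True K(2) by (auto simp: s_def)
      have sum1: "(\<Sum>b\<in>Basis. (grad \<phi> x \<bullet> b) * (X x \<bullet> b)) = grad \<phi> x \<bullet> X x"
        by (rule euclidean_inner[symmetric])
      have sum2: "(\<Sum>b\<in>Basis. (x \<bullet> b)\<^sup>2) = x \<bullet> x"
        by (subst euclidean_inner) (simp add: power2_eq_square)
      have "(\<Sum>b\<in>Basis. f' b x) = 2 * \<phi> x * (\<Sum>b\<in>Basis. (grad \<phi> x \<bullet> b) * (X x \<bullet> b))
          + (\<phi> x)\<^sup>2 * (real DIM('a) * (2 * c * h s) + 4 * c\<^sup>2 * h' s * (\<Sum>b\<in>Basis. (x \<bullet> b)\<^sup>2))"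
        by (simp add: f'_def sum.distrib sum_distrib_left s_def algebra_simps)
      also have "\<dots> = 2 * \<phi> x * (grad \<phi> x \<bullet> X x)
          + (\<phi> x)\<^sup>2 * (real DIM('a) * (2 * c * h s) + 4 * c * s * h' s)"
        unfolding sum1 sum2 s_def \<sigma>_def by (simp add: power2_eq_square)
      \<comment> \<open>Here the differential equation enters, divided by G, with \<nu> + 1 = d / 2;
        the square in h' supplies exactly the term - |X|^2.\<close>
      also have "real DIM('a) * (2 * c * h s) + 4 * c * s * h' s = - 4 * c - X x \<bullet> X x"
      proof -
        have XX: "X x \<bullet> X x = 4 * c * s * (h s)\<^sup>2"
          by (simp add: X_def s_def \<sigma>_def power2_eq_square)
        have "s * G2 s + real DIM('a) / 2 * G1 s + G s = 0"
          using G(4)[of s] by (simp add: \<nu>_def field_simps)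
        then have "s * (G2 s / G s) + real DIM('a) / 2 * h s = - 1"
          using Gs by (simp add: h_def field_simps)
        then have "4 * c * (s * (G2 s / G s) + real DIM('a) / 2 * h s) = - 4 * c" by simp
        then show ?thesis unfolding XX h'_def by (simp add: algebra_simps)
      qed
      finally have div: "(\<Sum>b\<in>Basis. f' b x) = 2 * \<phi> x * (grad \<phi> x \<bullet> X x) + (\<phi> x)\<^sup>2 * (- 4 * c - X x \<bullet> X x)" .
      have "(norm (grad \<phi> x - \<phi> x *\<^sub>R X x))\<^sup>2 = (norm (grad \<phi> x))\<^sup>2 - 2 * \<phi> x * (grad \<phi> x \<bullet> X x) + (\<phi> x)\<^sup>2 * (X x \<bullet> X x)"
        unfolding power2_norm_eq_inner
        by (simp add: inner_diff_left inner_diff_right inner_commute power2_eq_square)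
      then have "(norm (grad \<phi> x))\<^sup>2 - (4 * c * (\<phi> x)\<^sup>2 + (\<Sum>b\<in>Basis. f' b x)) =
          (norm (grad \<phi> x - \<phi> x *\<^sub>R X x))\<^sup>2"
        unfolding div by (simp add: algebra_simps)
      then show ?thesis using zero_le_power2[of "norm (grad \<phi> x - \<phi> x *\<^sub>R X x)"] by linarith
    qed
  qed (use N in auto)
  finally show ?thesis .
qed

section \<open>The first positive zero of the Bessel function\<close>

lemma exists_test_function:
  fixes a :: "'a::euclidean_space"
  assumes "open \<Omega>" "a \<in> \<Omega>"
  shows "\<exists>\<phi>. \<phi> \<in> test_functions \<Omega> \<and> \<phi> a \<noteq> 0"
proof -
  obtain r where r: "r > 0" "cball a r \<subseteq> \<Omega>"
    using assms open_contains_cball_eq by blast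
  \<comment> \<open>A radial bump, nonzero exactly on the open ball of radius r about a; the
    difference x - a is written in the form required by the rule for affine substitutions.\<close>
  let ?\<phi> = "\<lambda>x. flat 0 (r\<^sup>2 - (norm (- a + 1 *\<^sub>R x))\<^sup>2)"
  have "?\<phi> \<in> test_functions \<Omega>"
  proof (rule test_functionsI[of _ "cball a r"])
    show "smooth ?\<phi>"
      by (intro smooth_compose[OF smooth_flat] smooth_diff smooth_const smooth_affine[OF smooth_norm_squared])
    show "?\<phi> x = 0" if "x \<notin> cball a r" for x
      using that r by (auto simp: flat_def dist_norm norm_minus_commute)
  qed (use r in auto)
  moreover have "?\<phi> a \<noteq> 0" using r by (simp add: flat_def)
  ultimately show ?thesis by blast
qed

text \<open>\<open>LEAST\<close> on the reals is meaningful only if the positive zeros have a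
  minimum. Their set Z is closed and avoids 0, as G 0 > 0; it is nonempty because a positive G would
  make \<open>ball_poincare\<close> valid with every constant. The second claim is the intermediate
  value theorem: a nonpositive value of G forces an earlier zero.\<close>

lemma Bessel_J_zero_properties:
  fixes d :: nat
  assumes d: "d = DIM('a::euclidean_space)"
  defines "j \<equiv> Bessel_J_zero ((real d - 2) / 2)"
  shows "j > 0" and "\<And>s. 0 \<le> s \<Longrightarrow> s < j\<^sup>2 / 4 \<Longrightarrow> 0 < bessel_entire ((real d - 2) / 2) s"
proof -
  define \<nu> where "\<nu> = (real d - 2) / 2"
  have \<nu>: "\<nu> > -1" using d by (simp add: \<nu>_def)
  define G where "G = bessel_entire \<nu>"
  have cont: "continuous_on A G" for A
    using bessel_ode[OF \<nu>] unfolding G_def by (metis DERIV_continuous_on has_field_derivative_at_within)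
  have G0: "G 0 > 0"
  proof -
    have "G 0 = bessel_coeff \<nu> 0" unfolding G_def bessel_entire_def by (rule powser_zero)
    then show ?thesis using \<nu> by (simp add: bessel_coeff_def rGamma_inverse_Gamma Gamma_real_pos)
  qed
  define Z where "Z = {x. 0 \<le> x \<and> G (x\<^sup>2 / 4) = 0}"
  have Z: "0 < x \<and> Bessel_J \<nu> x = 0 \<longleftrightarrow> x \<in> Z" for x
    using G0 Bessel_J_eq[OF \<nu>, of x] by (cases "x > 0") (auto simp: Z_def G_def order_le_less)
  have ex: "\<exists>x\<in>Z. x\<^sup>2 / 4 \<le> s" if s: "s \<ge> 0" "G s \<le> 0" for s
  proof -
    obtain t where t: "0 \<le> t" "t \<le> s" "G t = 0"
      using IVT2'[of G s 0 0] s G0 cont by auto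
    then have "2 * sqrt t \<in> Z" "(2 * sqrt t)\<^sup>2 / 4 \<le> s" by (auto simp: Z_def power_mult_distrib)
    then show ?thesis by blast
  qed
  have "\<exists>s\<ge>0. G s \<le> 0"
  proof (rule ccontr)
    assume "\<not> ?thesis"
    then have p: "G s > 0" if "s \<ge> 0" for s using that not_le by blast
    obtain \<phi> :: "'a \<Rightarrow> real" where \<phi>: "\<phi> \<in> test_functions (ball 0 1)" "\<phi> 0 \<noteq> 0"
      using exists_test_function[of "ball 0 1" "0::'a"] by auto
    define N where "N = (\<integral>x. (\<phi> x)\<^sup>2 \<partial>lborel)"
    define D where "D = (\<integral>x. (norm (grad \<phi> x))\<^sup>2 \<partial>lborel)"
    have N: "N > 0" unfolding N_def using test_integral_square_pos \<phi> by blast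
    have D: "D \<ge> 0" by (simp add: D_def)
    \<comment> \<open>With c = (D + 1) / N the left side is 4 (D + 1), which exceeds D.\<close>
    have "4 * ((D + 1) / N) * N \<le> D"
      using ball_poincare[OF \<phi>(1), of "(D + 1) / N"] N D p d
      by (simp add: G_def \<nu>_def N_def[symmetric] D_def[symmetric])
    then show False using N D by simp
  qed
  then have ne: "Z \<noteq> {}" using ex by blast
  have cl: "closed Z"
  proof -
    have "Z = {0..} \<inter> {x. G (x\<^sup>2 / 4) = 0}" by (auto simp: Z_def)
    moreover have "closed {x. G (x\<^sup>2 / 4) = 0}"
      by (intro closed_Collect_eq continuous_intros continuous_on_compose2[OF cont]) auto
    ultimately show ?thesis by (simp add: closed_Int)
  qed
  have bd: "bdd_below Z" by (auto simp: Z_def)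
  have InfZ: "Inf Z \<in> Z" using closed_contains_Inf[OF ne bd cl] .
  have jInf: "j = Inf Z"
    unfolding j_def Bessel_J_zero_def \<nu>_def[symmetric] Z
    by (rule Least_equality) (use InfZ cInf_lower[OF _ bd] in auto)
  then have jZ: "j \<in> Z" using InfZ by simp
  then show "j > 0" using Z by blast
  show "0 < bessel_entire ((real d - 2) / 2) s" if "0 \<le> s" "s < j\<^sup>2 / 4" for s
  proof (rule ccontr)
    assume "\<not> ?thesis"
    then have "G s \<le> 0" by (simp add: G_def \<nu>_def)
    then obtain x where x: "x \<in> Z" "x\<^sup>2 / 4 \<le> s" using ex \<open>0 \<le> s\<close> by blast
    then have "j \<le> x" using cInf_lower[OF _ bd] jInf by simp
    then have "j\<^sup>2 \<le> x\<^sup>2" using \<open>j > 0\<close> by (intro power_mono) auto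
    then show False using x that by simp
  qed
qed

lemma ball_eigenvalue_bound:
  fixes \<phi> :: "'a::euclidean_space \<Rightarrow> real"
  assumes "\<phi> \<in> test_functions (ball 0 1)"
  shows "(Bessel_J_zero ((real DIM('a) - 2) / 2))\<^sup>2 * (\<integral>x. (\<phi> x)\<^sup>2 \<partial>lborel) \<le> (\<integral>x. (norm (grad \<phi> x))\<^sup>2 \<partial>lborel)"
proof -
  let ?j = "Bessel_J_zero ((real DIM('a) - 2) / 2)"
  have "?j > 0" using Bessel_J_zero_properties(1)[where 'a='a] by simp
  then show ?thesis
    using ball_poincare[OF assms, of "?j\<^sup>2 / 4"] Bessel_J_zero_properties(2)[where 'a='a] by simp
qed

section \<open>Torsion of the ball\<close>

text \<open>The second expression is the derivative of \<open>y * flat 0 y\<close>, a smooth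
  substitute for the positive part of y. The limits give convergence of the rescaled substitute and
  of its derivative.\<close>

lemma tendsto_flat_at_top:
  "((\<lambda>y. flat 0 y) \<longlongrightarrow> 1) at_top" "((\<lambda>y. flat 0 y + y * flat 2 y) \<longlongrightarrow> 1) at_top"
proof -
  have e: "((\<lambda>y::real. exp (- (1 / y))) \<longlongrightarrow> exp (- 0)) at_top"
    by (intro tendsto_exp tendsto_minus tendsto_divide_0[OF tendsto_const] filterlim_at_top_imp_at_infinity filterlim_ident)
  have i: "((\<lambda>y::real. 1 / y) \<longlongrightarrow> 0) at_top"
    by (intro tendsto_divide_0[OF tendsto_const] filterlim_at_top_imp_at_infinity filterlim_ident)
  have "((\<lambda>y::real. exp (- (1 / y))) \<longlongrightarrow> 1) at_top" using e by simp
  then show "((\<lambda>y. flat 0 y) \<longlongrightarrow> 1) at_top"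
    by (rule Lim_transform_eventually)
       (auto simp: flat_def intro: eventually_mono[OF eventually_gt_at_top[of 0]])
  have "((\<lambda>y::real. exp (- (1 / y)) * (1 + 1 / y)) \<longlongrightarrow> exp (- 0) * (1 + 0)) at_top"
    by (intro tendsto_intros e i)
  then have "((\<lambda>y::real. exp (- (1 / y)) * (1 + 1 / y)) \<longlongrightarrow> 1) at_top" by simp
  then show "((\<lambda>y. flat 0 y + y * flat 2 y) \<longlongrightarrow> 1) at_top"
    by (rule Lim_transform_eventually)
       (auto simp: flat_def field_simps power2_eq_square intro!: eventually_mono[OF eventually_gt_at_top[of 0]])
qed

text \<open>For y > 0 the last expression is (1 + 1/y) exp (- 1/y), which is at most 1 by 1 + z
  \<le> exp z. These uniform bounds provide the dominating function in the approximation of the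
  torsion function.\<close>

lemma flat_bounds: "0 \<le> flat n y" "flat 0 y \<le> 1" "\<bar>flat 0 y + y * flat 2 y\<bar> \<le> 1"
proof -
  show "0 \<le> flat n y" "flat 0 y \<le> 1" by (auto simp: flat_def)
  show "\<bar>flat 0 y + y * flat 2 y\<bar> \<le> 1"
  proof (cases "y > 0")
    case True
    have "1 + 1 / y \<le> exp (1 / y)" by (rule exp_ge_add_one_self)
    then have "exp (- (1 / y)) * (1 + 1 / y) \<le> exp (- (1 / y)) * exp (1 / y)"
      by (intro mult_left_mono) auto
    also have "\<dots> = 1" by (simp flip: exp_add)
    finally have "exp (- (1 / y)) * (1 + 1 / y) \<le> 1" .
    moreover have "flat 0 y + y * flat 2 y = exp (- (1 / y)) * (1 + 1 / y)"
      using True by (simp add: flat_def field_simps power2_eq_square)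
    moreover have "0 \<le> exp (- (1 / y)) * (1 + 1 / y)" using True by simp
    ultimately show ?thesis by simp
  qed (simp add: flat_def)
qed

text \<open>Smooth approximations of the torsion function \<open>(1 - |x|\<^sup>2) / (2d)\<close> of the unit ball.\<close>

lemma torsion_ball_approx:
  fixes e :: real
  assumes "e > 0"
  defines "d \<equiv> real DIM('a::euclidean_space)"
  shows "\<exists>\<phi>\<in>test_functions (ball (0::'a) 1).
    unit_ball_vol d / (d * (d + 2)) - e < 2 * (\<integral>x. \<phi> x \<partial>lborel) - (\<integral>x. (norm (grad \<phi> x))\<^sup>2 \<partial>lborel)"
proof -
  have d: "d \<ge> 1" using DIM_positive[where 'a='a] unfolding d_def by linarith
  \<comment> \<open>The shift by 1 makes \<open>\<eta> n\<close> vanish for t \<le> 1 / (n + 1),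
    which keeps the support of \<open>\<phi> n\<close> in a smaller closed ball; the factor n + 1
    lets \<open>\<eta> n\<close> tend to the positive part of t.\<close>
  define y where "y n t = real (Suc n) * t - 1" for n t
  define \<eta> where "\<eta> n t = y n t / real (Suc n) * flat 0 (y n t)" for n t
  define \<eta>' where "\<eta>' n t = flat 0 (y n t) + y n t * flat 2 (y n t)" for n t
  define \<phi> where "\<phi> n x = \<eta> n (1 - (norm x)\<^sup>2) / (2 * d)" for n and x :: 'a
  have \<eta>_deriv: "(\<eta> n has_real_derivative \<eta>' n t) (at t)" for n t
  proof -
    have y: "(y n has_real_derivative real (Suc n)) (at t)"
      unfolding y_def[abs_def] by (auto intro!: derivative_eq_intros)
    have "((\<lambda>t. flat 0 (y n t)) has_real_derivative flat 2 (y n t) * real (Suc n)) (at t)"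
      using DERIV_chain2[OF flat_has_derivative[of 0 "y n t"] y] by (simp add: numeral_2_eq_2)
    from DERIV_mult[OF DERIV_cdivide[OF y, of "real (Suc n)"] this] show ?thesis
      unfolding \<eta>_def[abs_def] \<eta>'_def by (simp add: field_simps del: of_nat_Suc)
  qed
  have sm: "smooth (\<phi> n)" for n
  proof -
    have sy: "smooth (y n)" unfolding y_def[abs_def] by (intro smooth_diff smooth_mult smooth_const smooth_id)
    have "smooth (\<lambda>t. y n t * (1 / real (Suc n)) * flat 0 (y n t))"
      by (rule smooth_mult[OF smooth_mult[OF sy smooth_const] smooth_compose[OF smooth_flat sy]])
    then have "smooth (\<eta> n)" unfolding \<eta>_def[abs_def] by simp
    then have "smooth (\<lambda>x::'a. (1 / (2 * d)) * \<eta> n (1 - (norm x)\<^sup>2))"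
      by (rule smooth_mult[OF smooth_const smooth_compose[OF _ smooth_diff[OF smooth_const smooth_norm_squared]]])
    then show ?thesis unfolding \<phi>_def[abs_def] by simp
  qed
  have y_neg: "y n (1 - (norm x)\<^sup>2) \<le> 0" if "x \<notin> cball 0 (sqrt (1 - 1 / real (Suc n)))" for n and x :: 'a
  proof -
    have "sqrt (1 - 1 / real (Suc n)) < norm x" using that by simp
    then have "1 - 1 / real (Suc n) \<le> (norm x)\<^sup>2"
      using sqrt_le_D by (meson less_imp_le)
    then have "1 - (norm x)\<^sup>2 \<le> 1 / real (Suc n)" by simp
    then show ?thesis by (simp add: y_def field_simps)
  qed
  have test: "\<phi> n \<in> test_functions (ball 0 1)" for n
  proof (rule test_functionsI[of _ "cball 0 (sqrt (1 - 1 / real (Suc n)))"])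
    show "\<phi> n x = 0" if "x \<notin> cball 0 (sqrt (1 - 1 / real (Suc n)))" for x
      using y_neg[OF that] by (simp add: \<phi>_def \<eta>_def flat_def)
    have "sqrt (1 - 1 / real (Suc n)) < sqrt 1" by (intro real_sqrt_less_mono) simp
    then have lt: "sqrt (1 - 1 / real (Suc n)) < 1" by simp
    show "cball 0 (sqrt (1 - 1 / real (Suc n))) \<subseteq> ball (0::'a) 1"
    proof
      fix x :: 'a assume "x \<in> cball 0 (sqrt (1 - 1 / real (Suc n)))"
      then have "norm x \<le> sqrt (1 - 1 / real (Suc n))" by simp
      with lt have "norm x < 1" by (rule le_less_trans[rotated])
      then show "x \<in> ball 0 1" by simp
    qed
  qed (use sm in auto)
  have grad: "grad (\<phi> n) x = - (\<eta>' n (1 - (norm x)\<^sup>2) / d) *\<^sub>R x" for n x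
  proof (rule grad_eqI)
    have 1: "GDERIV (\<lambda>x. 1 - (norm x)\<^sup>2) x :> (- 2) *\<^sub>R x"
      unfolding gderiv_def power2_norm_eq_inner
      by (auto intro!: derivative_eq_intros simp: inner_commute)
    have 2: "DERIV (\<lambda>t. \<eta> n t / (2 * d)) (1 - (norm x)\<^sup>2) :> \<eta>' n (1 - (norm x)\<^sup>2) / (2 * d)"
      by (rule DERIV_cdivide[OF \<eta>_deriv])
    show "GDERIV (\<phi> n) x :> - (\<eta>' n (1 - (norm x)\<^sup>2) / d) *\<^sub>R x"
      using GDERIV_DERIV_compose[OF 1 2] d unfolding \<phi>_def[abs_def] by simp
  qed
  let ?B = "ball (0::'a) 1"
  have [measurable]: "?B \<in> sets borel" by simp
  have Bint: "integrable lborel (\<lambda>x. indicator ?B x :: real)"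
    by (intro integrable_real_indicator) (simp_all add: emeasure_bounded_finite less_top[symmetric] flip: infinity_ennreal_def)
  define \<omega> where "\<omega> = unit_ball_vol d"
  have Bvol: "(\<integral>x. indicator ?B x \<partial>lborel) = \<omega>"
    by (simp add: \<omega>_def d_def content_ball)
  have Jint: "integrable lborel (\<lambda>x. indicator ?B x * (norm x)\<^sup>2)"
  proof (rule Bochner_Integration.integrable_bound[OF Bint])
    show "AE x in lborel. norm (indicator ?B x * (norm x)\<^sup>2) \<le> norm (indicator ?B x :: real)"
      by (rule AE_I2) (auto simp: indicator_def power_le_one)
  qed measurable
  \<comment> \<open>The second moment of the ball, kept symbolic; the divergence identity below
    determines it without polar coordinates.\<close>
  define J where "J = (\<integral>x. indicator ?B x * (norm x)\<^sup>2 \<partial>lborel)"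
  have lims: "(\<lambda>n. \<eta> n (1 - (norm x)\<^sup>2)) \<longlonglongrightarrow> indicator ?B x * (1 - (norm x)\<^sup>2)"
    "(\<lambda>n. \<eta>' n (1 - (norm x)\<^sup>2)) \<longlonglongrightarrow> indicator ?B x" for x
  proof -
    define t where "t = 1 - (norm x)\<^sup>2"
    have t: "t > 0 \<longleftrightarrow> x \<in> ?B"
      using power2_less_imp_less[of "norm x" 1] power_strict_mono[of "norm x" 1 2] by (auto simp: t_def)
    have "(\<lambda>n. \<eta> n t) \<longlonglongrightarrow> indicator ?B x * t \<and> (\<lambda>n. \<eta>' n t) \<longlonglongrightarrow> indicator ?B x"
    proof (cases "t > 0")
      case True
      have "filterlim (\<lambda>n. real (Suc n)) at_top sequentially"
        by (rule filterlim_compose[OF filterlim_real_sequentially filterlim_Suc])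
      then have "filterlim (\<lambda>n. t * real (Suc n)) at_top sequentially"
        by (rule filterlim_tendsto_pos_mult_at_top[OF tendsto_const True])
      then have y: "filterlim (\<lambda>n. y n t) at_top sequentially"
        using filterlim_tendsto_add_at_top[OF tendsto_const[of "- 1"]] by (simp add: y_def mult.commute)
      have "(\<lambda>n. t - 1 / real (Suc n)) \<longlonglongrightarrow> t - 0"
        by (intro tendsto_intros lim_const_over_n[THEN LIMSEQ_Suc])
      moreover have "t - 1 / real (Suc n) = y n t / real (Suc n)" for n
        by (simp add: y_def diff_divide_distrib)
      ultimately have "(\<lambda>n. y n t / real (Suc n)) \<longlonglongrightarrow> t" by simp
      then have "(\<lambda>n. \<eta> n t) \<longlonglongrightarrow> t * 1"
        unfolding \<eta>_def by (intro tendsto_mult filterlim_compose[OF tendsto_flat_at_top(1) y])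
      moreover have "(\<lambda>n. \<eta>' n t) \<longlonglongrightarrow> 1"
        unfolding \<eta>'_def by (rule filterlim_compose[OF tendsto_flat_at_top(2) y])
      ultimately show ?thesis using True t by simp
    next
      case False
      then have "y n t \<le> 0" for n
        using mult_nonneg_nonpos[of "real (Suc n)" t] unfolding y_def by linarith
      then have "\<eta> n t = 0" "\<eta>' n t = 0" for n by (auto simp: \<eta>_def \<eta>'_def flat_def)
      then show ?thesis using False t by simp
    qed
    then show "(\<lambda>n. \<eta> n (1 - (norm x)\<^sup>2)) \<longlonglongrightarrow> indicator ?B x * (1 - (norm x)\<^sup>2)"
      "(\<lambda>n. \<eta>' n (1 - (norm x)\<^sup>2)) \<longlonglongrightarrow> indicator ?B x" by (auto simp: t_def)
  qed
  have out: "\<phi> n x = 0" "grad (\<phi> n) x = 0" if "x \<notin> ?B" for n x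
    using test[of n] that by (auto elim!: test_functionsE)
  have bd1: "norm (\<phi> n x) \<le> indicator ?B x" for n x
  proof (cases "x \<in> ?B")
    case True
    define t where "t = 1 - (norm x)\<^sup>2"
    have t: "t \<le> 1" by (simp add: t_def)
    have "\<bar>\<eta> n t\<bar> \<le> 1"
    proof (cases "y n t > 0")
      case True
      have "y n t \<le> real (Suc n)" unfolding y_def diff_le_eq
        by (rule order_trans[OF mult_left_mono[OF t of_nat_0_le_iff]]) simp
      then have "\<bar>y n t / real (Suc n)\<bar> * \<bar>flat 0 (y n t)\<bar> \<le> 1 * 1"
        using True flat_bounds by (intro mult_mono) (auto simp: divide_le_eq_1)
      then show ?thesis by (simp add: \<eta>_def abs_mult)
    qed (simp add: \<eta>_def flat_def)
    then have "\<bar>\<eta> n t\<bar> / (2 * d) \<le> 1 / 1" using d by (intro frac_le) auto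
    then show ?thesis using True d by (simp add: \<phi>_def t_def)
  qed (simp add: out)
  have bd2: "norm (grad (\<phi> n) x) \<le> indicator ?B x" for n x
  proof (cases "x \<in> ?B")
    case True
    have "\<bar>\<eta>' n (1 - (norm x)\<^sup>2)\<bar> / d \<le> 1 / 1"
      using d flat_bounds(3) by (intro frac_le) (auto simp: \<eta>'_def)
    then have "\<bar>\<eta>' n (1 - (norm x)\<^sup>2)\<bar> / d * norm x \<le> 1 * 1"
      using True by (intro mult_mono) auto
    then show ?thesis using True d by (simp add: grad)
  qed (simp add: out)
  note [measurable] = smooth_measurable[OF sm]
  have L1: "(\<lambda>n. \<integral>x. \<phi> n x \<partial>lborel) \<longlonglongrightarrow> (\<integral>x. indicator ?B x * (1 - (norm x)\<^sup>2) / (2 * d) \<partial>lborel)"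
  proof (rule integral_dominated_convergence[OF _ _ Bint])
    show "AE x in lborel. (\<lambda>n. \<phi> n x) \<longlonglongrightarrow> indicator ?B x * (1 - (norm x)\<^sup>2) / (2 * d)"
      unfolding \<phi>_def using d by (intro AE_I2 tendsto_divide lims tendsto_const) auto
  qed (use bd1 in auto)
  have I1: "(\<integral>x. indicator ?B x * (1 - (norm x)\<^sup>2) / (2 * d) \<partial>lborel) = (\<omega> - J) / (2 * d)"
    using Bint Jint Bvol by (simp add: J_def right_diff_distrib)
  have L2: "(\<lambda>n. \<integral>x. (norm (grad (\<phi> n) x))\<^sup>2 \<partial>lborel) \<longlonglongrightarrow> (\<integral>x. (indicator ?B x / d)\<^sup>2 * (norm x)\<^sup>2 \<partial>lborel)"
  proof (rule integral_dominated_convergence[OF _ _ Bint])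
    show "AE x in lborel. (\<lambda>n. (norm (grad (\<phi> n) x))\<^sup>2) \<longlonglongrightarrow> (indicator ?B x / d)\<^sup>2 * (norm x)\<^sup>2"
    proof (rule AE_I2)
      fix x
      have "(\<lambda>n. (\<eta>' n (1 - (norm x)\<^sup>2) / d)\<^sup>2 * (norm x)\<^sup>2) \<longlonglongrightarrow> (indicator ?B x / d)\<^sup>2 * (norm x)\<^sup>2"
        using d by (intro tendsto_intros lims) auto
      then show "(\<lambda>n. (norm (grad (\<phi> n) x))\<^sup>2) \<longlonglongrightarrow> (indicator ?B x / d)\<^sup>2 * (norm x)\<^sup>2"
        by (simp add: grad power_mult_distrib power_divide)
    qed
    show "AE x in lborel. norm ((norm (grad (\<phi> n) x))\<^sup>2) \<le> indicator ?B x" for n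
    proof (rule AE_I2)
      fix x
      show "norm ((norm (grad (\<phi> n) x))\<^sup>2) \<le> indicator ?B x"
        using bd2[of n x] by (auto simp: indicator_def power_le_one split: if_splits)
    qed
  qed auto
  have I2: "(\<integral>x. (indicator ?B x / d)\<^sup>2 * (norm x)\<^sup>2 \<partial>lborel) = J / d\<^sup>2"
  proof -
    have "(indicator ?B x / d)\<^sup>2 * (norm x)\<^sup>2 = indicator ?B x * (norm x)\<^sup>2 / d\<^sup>2" for x
      by (simp add: indicator_def power_divide)
    then show ?thesis by (simp add: J_def)
  qed
  have L3: "(\<lambda>n. \<integral>x. x \<bullet> grad (\<phi> n) x \<partial>lborel) \<longlonglongrightarrow> (\<integral>x. - (indicator ?B x / d * (norm x)\<^sup>2) \<partial>lborel)"
  proof (rule integral_dominated_convergence[OF _ _ Bint])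
    show "AE x in lborel. (\<lambda>n. x \<bullet> grad (\<phi> n) x) \<longlonglongrightarrow> - (indicator ?B x / d * (norm x)\<^sup>2)"
    proof (rule AE_I2)
      fix x
      have "(\<lambda>n. - (\<eta>' n (1 - (norm x)\<^sup>2) / d * (norm x)\<^sup>2)) \<longlonglongrightarrow> - (indicator ?B x / d * (norm x)\<^sup>2)"
        using d by (intro tendsto_intros lims) auto
      then show "(\<lambda>n. x \<bullet> grad (\<phi> n) x) \<longlonglongrightarrow> - (indicator ?B x / d * (norm x)\<^sup>2)"
        by (simp add: grad power2_norm_eq_inner)
    qed
    show "AE x in lborel. norm (x \<bullet> grad (\<phi> n) x) \<le> indicator ?B x" for n
    proof (rule AE_I2)
      fix x
      show "norm (x \<bullet> grad (\<phi> n) x) \<le> indicator ?B x"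
      proof (cases "x \<in> ?B")
        case True
        have "\<bar>x \<bullet> grad (\<phi> n) x\<bar> \<le> norm x * norm (grad (\<phi> n) x)" by (rule Cauchy_Schwarz_ineq2)
        also have "\<dots> \<le> 1 * 1" using True bd2[of n x] by (intro mult_mono) auto
        finally show ?thesis using True by simp
      qed (simp add: out)
    qed
  qed auto
  have I3: "(\<integral>x. - (indicator ?B x / d * (norm x)\<^sup>2) \<partial>lborel) = - (J / d)"
    by (simp add: J_def)
  \<comment> \<open>The divergence of the field x -> \<open>\<phi> n x *\<^sub>R x\<close>, written
    out coordinatewise, has integral 0. In the limit this yields J = \<omega> d / (d + 2).\<close>
  have identity: "d * (\<integral>x. \<phi> n x \<partial>lborel) + (\<integral>x. x \<bullet> grad (\<phi> n) x \<partial>lborel) = 0" for n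
  proof -
    define \<psi> where "\<psi> b x = (x \<bullet> b) * \<phi> n x" for b x
    have \<psi>: "\<psi> b \<in> test_functions ?B" for b
      unfolding \<psi>_def by (rule test_mult_smooth[OF test smooth_inner])
    have gr: "GDERIV (\<lambda>x. x \<bullet> b) x :> b" for b x :: 'a
      unfolding gderiv_def by (auto intro!: derivative_eq_intros)
    have g: "grad (\<psi> b) x \<bullet> b = (x \<bullet> b) * (grad (\<phi> n) x \<bullet> b) + \<phi> n x" if "b \<in> Basis" for b x
      unfolding \<psi>_def using that
      by (subst grad_mult[OF smooth_inner sm]) (simp add: grad_eqI[OF gr] inner_add_left)
    have int\<phi>: "integrable lborel (\<phi> n)" using test_integrable[OF test] by blast
    have intx: "integrable lborel (\<lambda>x. (x \<bullet> b) * (grad (\<phi> n) x \<bullet> b))" if b: "b \<in> Basis" for b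
    proof (rule Bochner_Integration.integrable_bound[OF Bint])
      show "AE x in lborel. norm ((x \<bullet> b) * (grad (\<phi> n) x \<bullet> b)) \<le> norm (indicator ?B x :: real)"
      proof (rule AE_I2)
        fix x
        show "norm ((x \<bullet> b) * (grad (\<phi> n) x \<bullet> b)) \<le> norm (indicator ?B x :: real)"
        proof (cases "x \<in> ?B")
          case True
          have "\<bar>x \<bullet> b\<bar> * \<bar>grad (\<phi> n) x \<bullet> b\<bar> \<le> 1 * 1"
            using True bd2[of n x] Basis_le_norm[OF b, of x] Basis_le_norm[OF b, of "grad (\<phi> n) x"]
            by (intro mult_mono) auto
          then show ?thesis using True by (simp add: abs_mult)
        qed (simp add: out)
      qed
    qed auto
    have "0 = (\<Sum>b\<in>(Basis::'a set). \<integral>x. grad (\<psi> b) x \<bullet> b \<partial>lborel)"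
      using test_integral_directional_zero[OF \<psi>] by simp
    also have "\<dots> = (\<Sum>b\<in>(Basis::'a set). (\<integral>x. (x \<bullet> b) * (grad (\<phi> n) x \<bullet> b) \<partial>lborel) + (\<integral>x. \<phi> n x \<partial>lborel))"
      using int\<phi> intx by (intro sum.cong refl) (simp add: g)
    also have "\<dots> = (\<integral>x. (\<Sum>b\<in>(Basis::'a set). (x \<bullet> b) * (grad (\<phi> n) x \<bullet> b)) \<partial>lborel) + d * (\<integral>x. \<phi> n x \<partial>lborel)"
      using intx by (simp add: sum.distrib d_def)
    also have "(\<lambda>x. \<Sum>b\<in>(Basis::'a set). (x \<bullet> b) * (grad (\<phi> n) x \<bullet> b)) = (\<lambda>x. x \<bullet> grad (\<phi> n) x)"
      by (rule ext) (rule euclidean_inner[symmetric])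
    finally show ?thesis by simp
  qed
  have "(\<lambda>n. d * (\<integral>x. \<phi> n x \<partial>lborel) + (\<integral>x. x \<bullet> grad (\<phi> n) x \<partial>lborel))
      \<longlonglongrightarrow> d * ((\<omega> - J) / (2 * d)) + - (J / d)"
    by (intro tendsto_add tendsto_mult tendsto_const L1[unfolded I1] L3[unfolded I3])
  then have "d * ((\<omega> - J) / (2 * d)) + - (J / d) = 0"
    unfolding identity using LIMSEQ_unique tendsto_const by blast
  then have "(\<omega> - J) / 2 = J / d" using d by simp
  then have "d * (\<omega> - J) = 2 * J" using d by (simp add: field_simps)
  then have "J * (d + 2) = \<omega> * d" by (simp add: algebra_simps)
  then have J: "J = \<omega> * d / (d + 2)" using d by (simp add: eq_divide_eq)
  have "(\<lambda>n. 2 * (\<integral>x. \<phi> n x \<partial>lborel) - (\<integral>x. (norm (grad (\<phi> n) x))\<^sup>2 \<partial>lborel))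
      \<longlonglongrightarrow> 2 * ((\<omega> - J) / (2 * d)) - J / d\<^sup>2"
    by (intro tendsto_diff tendsto_mult tendsto_const L1[unfolded I1] L2[unfolded I2])
  moreover have "2 * ((\<omega> - J) / (2 * d)) - J / d\<^sup>2 = \<omega> / (d * (d + 2))"
  proof -
    have "\<omega> - J = 2 * \<omega> / (d + 2)" using d by (simp add: J field_simps)
    then have "2 * ((\<omega> - J) / (2 * d)) - J / d\<^sup>2 = 2 * \<omega> / (d + 2) / d - \<omega> / (d + 2) / d"
      using d by (simp add: J power2_eq_square)
    also have "\<dots> = \<omega> / (d * (d + 2))" using d by (simp add: field_simps)
    finally show ?thesis .
  qed
  ultimately have "(\<lambda>n. 2 * (\<integral>x. \<phi> n x \<partial>lborel) - (\<integral>x. (norm (grad (\<phi> n) x))\<^sup>2 \<partial>lborel))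
      \<longlonglongrightarrow> \<omega> / (d * (d + 2))" by simp
  from order_tendstoD(1)[OF this, of "\<omega> / (d * (d + 2)) - e"] assms(1)
  have "\<forall>\<^sub>F n in sequentially. \<omega> / (d * (d + 2)) - e < 2 * (\<integral>x. \<phi> n x \<partial>lborel) - (\<integral>x. (norm (grad (\<phi> n) x))\<^sup>2 \<partial>lborel)"
    by simp
  then obtain n where "\<omega> / (d * (d + 2)) - e < 2 * (\<integral>x. \<phi> n x \<partial>lborel) - (\<integral>x. (norm (grad (\<phi> n) x))\<^sup>2 \<partial>lborel)"
    using eventually_happens trivial_limit_sequentially by blast
  then show ?thesis using test[of n] unfolding \<omega>_def by blast
qed

section \<open>Square integrable functions on a finite measure space\<close>

definition L2 :: "'a measure \<Rightarrow> ('a \<Rightarrow> 'b::euclidean_space) set" where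
  "L2 M = {f \<in> borel_measurable M. integrable M (\<lambda>x. (norm (f x))\<^sup>2)}"

lemma L2_measurable: "f \<in> L2 M \<Longrightarrow> f \<in> borel_measurable M"
  and L2_integrable: "f \<in> L2 M \<Longrightarrow> integrable M (\<lambda>x. (norm (f x))\<^sup>2)"
  by (auto simp: L2_def)

lemma L2_scaleR:
  assumes "f \<in> L2 M"
  shows "(\<lambda>x. c *\<^sub>R f x) \<in> L2 M"
  using assms by (auto simp: L2_def power_mult_distrib)

lemma L2_add:
  assumes "f \<in> L2 M" "g \<in> L2 M"
  shows "(\<lambda>x. f x + g x) \<in> L2 M"
proof -
  note [measurable] = L2_measurable[OF assms(1)] L2_measurable[OF assms(2)]
  have "integrable M (\<lambda>x. (norm (f x + g x))\<^sup>2)"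
  proof (rule Bochner_Integration.integrable_bound)
    show "integrable M (\<lambda>x. 2 * (norm (f x))\<^sup>2 + 2 * (norm (g x))\<^sup>2)"
      using L2_integrable[OF assms(1)] L2_integrable[OF assms(2)] by simp
    show "AE x in M. norm ((norm (f x + g x))\<^sup>2) \<le> norm (2 * (norm (f x))\<^sup>2 + 2 * (norm (g x))\<^sup>2)"
    proof (rule AE_I2)
      fix x
      have "(norm (f x + g x))\<^sup>2 \<le> (norm (f x) + norm (g x))\<^sup>2"
        by (intro power_mono norm_triangle_ineq) auto
      also have "\<dots> \<le> 2 * (norm (f x))\<^sup>2 + 2 * (norm (g x))\<^sup>2"
        using zero_le_power2[of "norm (f x) - norm (g x)"] by (simp add: power2_sum power2_diff)
      finally show "norm ((norm (f x + g x))\<^sup>2) \<le> norm (2 * (norm (f x))\<^sup>2 + 2 * (norm (g x))\<^sup>2)"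
        by simp
    qed
  qed measurable
  then show ?thesis by (simp add: L2_def)
qed

lemma L2_diff:
  assumes "f \<in> L2 M" "g \<in> L2 M"
  shows "(\<lambda>x. f x - g x) \<in> L2 M"
  using L2_add[OF assms(1) L2_scaleR[OF assms(2), of "-1"]] by simp

lemma L2_inner_integrable:
  assumes "f \<in> L2 M" "g \<in> L2 M"
  shows "integrable M (\<lambda>x. f x \<bullet> g x)"
proof (rule Bochner_Integration.integrable_bound)
  note [measurable] = L2_measurable[OF assms(1)] L2_measurable[OF assms(2)]
  show "integrable M (\<lambda>x. (norm (f x))\<^sup>2 + (norm (g x))\<^sup>2)"
    using L2_integrable[OF assms(1)] L2_integrable[OF assms(2)] by simp
  show "(\<lambda>x. f x \<bullet> g x) \<in> borel_measurable M" by measurable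
  show "AE x in M. norm (f x \<bullet> g x) \<le> norm ((norm (f x))\<^sup>2 + (norm (g x))\<^sup>2)"
  proof (rule AE_I2)
    fix x
    have "\<bar>f x \<bullet> g x\<bar> \<le> norm (f x) * norm (g x)" by (rule Cauchy_Schwarz_ineq2)
    also have "2 * (norm (f x) * norm (g x)) \<le> (norm (f x))\<^sup>2 + (norm (g x))\<^sup>2"
      using zero_le_power2[of "norm (f x) - norm (g x)"] by (simp add: power2_diff)
    then have "norm (f x) * norm (g x) \<le> (norm (f x))\<^sup>2 + (norm (g x))\<^sup>2"
      by (smt (verit) mult_nonneg_nonneg norm_ge_zero)
    finally show "norm (f x \<bullet> g x) \<le> norm ((norm (f x))\<^sup>2 + (norm (g x))\<^sup>2)" by simp
  qed
qed

lemma L2_norm_diff_expand: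
  assumes "f \<in> L2 M" "g \<in> L2 M"
  shows "(\<integral>x. (norm (f x - t *\<^sub>R g x))\<^sup>2 \<partial>M) =
    (\<integral>x. (norm (f x))\<^sup>2 \<partial>M) - 2 * t * (\<integral>x. f x \<bullet> g x \<partial>M) + t\<^sup>2 * (\<integral>x. (norm (g x))\<^sup>2 \<partial>M)"
proof -
  have "(\<integral>x. (norm (f x - t *\<^sub>R g x))\<^sup>2 \<partial>M) =
    (\<integral>x. (norm (f x))\<^sup>2 - (2 * t) * (f x \<bullet> g x) + t\<^sup>2 * (norm (g x))\<^sup>2 \<partial>M)"
    unfolding power2_norm_eq_inner
    by (intro Bochner_Integration.integral_cong refl)
       (simp add: inner_diff_left inner_diff_right inner_commute power2_eq_square)
  also have "\<dots> = (\<integral>x. (norm (f x))\<^sup>2 \<partial>M) - (2 * t) * (\<integral>x. f x \<bullet> g x \<partial>M) + t\<^sup>2 * (\<integral>x. (norm (g x))\<^sup>2 \<partial>M)"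
    using L2_integrable[OF assms(1)] L2_integrable[OF assms(2)] L2_inner_integrable[OF assms] by simp
  finally show ?thesis .
qed

text \<open>The polynomial t -> \<integral>|f - t g|^2 is nonnegative; it is evaluated at its
  minimum. If its leading coefficient is 0 it is affine, so its slope must vanish.\<close>

lemma L2_Cauchy_Schwarz:
  assumes "f \<in> L2 M" "g \<in> L2 M"
  shows "(\<integral>x. f x \<bullet> g x \<partial>M)\<^sup>2 \<le> (\<integral>x. (norm (f x))\<^sup>2 \<partial>M) * (\<integral>x. (norm (g x))\<^sup>2 \<partial>M)"
proof -
  define A where "A = (\<integral>x. (norm (f x))\<^sup>2 \<partial>M)"
  define B where "B = (\<integral>x. f x \<bullet> g x \<partial>M)"
  define C where "C = (\<integral>x. (norm (g x))\<^sup>2 \<partial>M)"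
  have ge: "0 \<le> A - 2 * t * B + t\<^sup>2 * C" for t
    unfolding A_def B_def C_def L2_norm_diff_expand[OF assms, symmetric] by simp
  have AC: "A \<ge> 0" "C \<ge> 0" by (auto simp: A_def C_def)
  have "B\<^sup>2 \<le> A * C"
  proof (cases "C = 0")
    case True
    have "B = 0"
    proof (rule ccontr)
      assume "B \<noteq> 0"
      \<comment> \<open>This choice of t gives the affine polynomial the value - 1.\<close>
      then show False using ge[of "(A + 1) / (2 * B)"] True AC by (simp add: field_simps)
    qed
    then show ?thesis using True by simp
  next
    case False
    then have "C > 0" using AC by simp
    have "0 \<le> (A - 2 * (B / C) * B + (B / C)\<^sup>2 * C) * C"
      using ge[of "B / C"] AC by (intro mult_nonneg_nonneg) auto
    also have "\<dots> = A * C - B\<^sup>2" using \<open>C > 0\<close> by (simp add: field_simps power2_eq_square)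
    finally show ?thesis by simp
  qed
  then show ?thesis by (simp add: A_def B_def C_def)
qed

lemma L2_inner_tendsto:
  assumes "\<And>n. f n \<in> L2 M" "g \<in> L2 M" "k \<in> L2 M"
    and lim: "(\<lambda>n. \<integral>x. (norm (f n x - g x))\<^sup>2 \<partial>M) \<longlonglongrightarrow> 0"
  shows "(\<lambda>n. \<integral>x. f n x \<bullet> k x \<partial>M) \<longlonglongrightarrow> (\<integral>x. g x \<bullet> k x \<partial>M)"
proof (rule LIM_zero_cancel, rule tendsto_rabs_zero_cancel, rule tendsto_sandwich[OF _ _ tendsto_const])
  have "(\<lambda>n. sqrt ((\<integral>x. (norm (f n x - g x))\<^sup>2 \<partial>M) * (\<integral>x. (norm (k x))\<^sup>2 \<partial>M))) \<longlonglongrightarrow> sqrt (0 * (\<integral>x. (norm (k x))\<^sup>2 \<partial>M))"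
    by (intro tendsto_intros lim)
  then show "(\<lambda>n. sqrt ((\<integral>x. (norm (f n x - g x))\<^sup>2 \<partial>M) * (\<integral>x. (norm (k x))\<^sup>2 \<partial>M))) \<longlonglongrightarrow> 0" by simp
  show "\<forall>\<^sub>F n in sequentially. \<bar>(\<integral>x. f n x \<bullet> k x \<partial>M) - (\<integral>x. g x \<bullet> k x \<partial>M)\<bar>
      \<le> sqrt ((\<integral>x. (norm (f n x - g x))\<^sup>2 \<partial>M) * (\<integral>x. (norm (k x))\<^sup>2 \<partial>M))"
  proof (rule always_eventually, rule allI)
    fix n
    have "(\<integral>x. f n x \<bullet> k x \<partial>M) - (\<integral>x. g x \<bullet> k x \<partial>M) = (\<integral>x. (f n x - g x) \<bullet> k x \<partial>M)"
      using L2_inner_integrable[OF assms(1)[of n] assms(3)] L2_inner_integrable[OF assms(2,3)]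
      by (simp add: inner_diff_left)
    then show "\<bar>(\<integral>x. f n x \<bullet> k x \<partial>M) - (\<integral>x. g x \<bullet> k x \<partial>M)\<bar>
      \<le> sqrt ((\<integral>x. (norm (f n x - g x))\<^sup>2 \<partial>M) * (\<integral>x. (norm (k x))\<^sup>2 \<partial>M))"
      using L2_Cauchy_Schwarz[OF L2_diff[OF assms(1)[of n] assms(2)] assms(3)]
      by (simp add: real_le_rsqrt abs_le_square_iff)
  qed
qed simp

lemma L2_norm_tendsto:
  assumes "\<And>n. f n \<in> L2 M" "g \<in> L2 M"
    and lim: "(\<lambda>n. \<integral>x. (norm (f n x - g x))\<^sup>2 \<partial>M) \<longlonglongrightarrow> 0"
  shows "(\<lambda>n. \<integral>x. (norm (f n x))\<^sup>2 \<partial>M) \<longlonglongrightarrow> (\<integral>x. (norm (g x))\<^sup>2 \<partial>M)"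
proof -
  have eq: "(\<integral>x. (norm (f n x))\<^sup>2 \<partial>M) = (\<integral>x. (norm (f n x - g x))\<^sup>2 \<partial>M)
      + 2 * (\<integral>x. f n x \<bullet> g x \<partial>M) - (\<integral>x. (norm (g x))\<^sup>2 \<partial>M)" for n
    using L2_norm_diff_expand[OF assms(1)[of n] assms(2), of 1] by simp
  have gg: "(\<integral>x. g x \<bullet> g x \<partial>M) = (\<integral>x. (norm (g x))\<^sup>2 \<partial>M)"
    by (simp add: power2_norm_eq_inner)
  have "(\<lambda>n. \<integral>x. (norm (f n x))\<^sup>2 \<partial>M) \<longlonglongrightarrow> 0 + 2 * (\<integral>x. g x \<bullet> g x \<partial>M) - (\<integral>x. (norm (g x))\<^sup>2 \<partial>M)"
    unfolding eq by (intro tendsto_intros lim L2_inner_tendsto[OF assms(1,2,2)])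
  then show ?thesis by (simp add: gg)
qed

text \<open>Riesz--Fischer: a subsequence with summable increments converges almost everywhere, and
  Fatou's lemma turns the Cauchy bounds into bounds on the distance of the whole sequence to this
  limit. Finiteness of the measure lets the L2 norms of the increments control their L1
  norms.\<close>

lemma L2_complete:
  fixes f :: "nat \<Rightarrow> 'a \<Rightarrow> 'b::euclidean_space"
  assumes fin: "finite_measure M" and f: "\<And>n. f n \<in> L2 M"
    and Cauchy: "\<And>e. e > 0 \<Longrightarrow> \<exists>N. \<forall>m\<ge>N. \<forall>n\<ge>N. (\<integral>x. (norm (f m x - f n x))\<^sup>2 \<partial>M) < e"
  obtains g where "g \<in> L2 M" "(\<lambda>n. \<integral>x. (norm (f n x - g x))\<^sup>2 \<partial>M) \<longlonglongrightarrow> 0"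
proof -
  interpret finite_measure M by fact
  note [measurable] = L2_measurable[OF f]
  have "\<exists>N. \<forall>m\<ge>N. \<forall>n\<ge>N. (\<integral>x. (norm (f m x - f n x))\<^sup>2 \<partial>M) < (1 / 4) ^ k" for k :: nat
    by (rule Cauchy) simp
  then obtain N where N: "\<And>k m n. m \<ge> N k \<Longrightarrow> n \<ge> N k \<Longrightarrow> (\<integral>x. (norm (f m x - f n x))\<^sup>2 \<partial>M) < (1 / 4) ^ k"
    by metis
  \<comment> \<open>Monotone and at least N k, so the squared distance of consecutive terms is below
    (1/4)^k; the summand k ensures r k \<ge> k, so the subsequence passes every index.\<close>
  define r where "r k = (\<Sum>i\<le>k. N i) + k" for k
  have r_mono: "r k \<le> r (Suc k)" "N k \<le> r k" "k \<le> r k" for k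
    by (auto simp: r_def intro: member_le_sum[of k "{..k}" N] trans_le_add1)
  define G where "G k x = norm (f (r (Suc k)) x - f (r k) x)" for k x
  have [measurable]: "G k \<in> borel_measurable M" for k unfolding G_def by measurable
  have Gsq: "integrable M (\<lambda>x. (G k x)\<^sup>2)" "(\<integral>x. (G k x)\<^sup>2 \<partial>M) \<le> (1 / 4) ^ k" for k
  proof -
    show "integrable M (\<lambda>x. (G k x)\<^sup>2)"
      unfolding G_def by (rule L2_integrable[OF L2_diff[OF f f]])
    have "(\<integral>x. (norm (f (r (Suc k)) x - f (r k) x))\<^sup>2 \<partial>M) < (1 / 4) ^ k"
      using r_mono(1,2)[of k] by (intro N) auto
    then show "(\<integral>x. (G k x)\<^sup>2 \<partial>M) \<le> (1 / 4) ^ k" by (simp add: G_def)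
  qed
  define \<mu> where "\<mu> = measure M (space M)"
  have Gint: "(\<integral>\<^sup>+x. G k x \<partial>M) \<le> ennreal ((1 + \<mu>) * (1 / 2) ^ k)" for k
  proof -
    \<comment> \<open>If G exceeds (1/2)^k then 2^k G \<ge> 1 and the first term dominates;
      otherwise the second does. Since \<integral>G^2 \<le> (1/4)^k, both terms integrate to at most
      multiples of (1/2)^k.\<close>
    have pt: "G k x \<le> 2 ^ k * (G k x)\<^sup>2 + (1 / 2) ^ k" for x
    proof (cases "G k x \<le> (1 / 2) ^ k")
      case True
      then show ?thesis by (simp add: add_increasing)
    next
      case False
      have "1 * G k x \<le> (2 ^ k * G k x) * G k x"
      proof (rule mult_right_mono)
        have "2 ^ k * (1 / 2) ^ k \<le> 2 ^ k * G k x" using False by (intro mult_left_mono) auto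
        then show "1 \<le> 2 ^ k * G k x" by (simp add: power_one_over)
      qed (simp add: G_def)
      then have "G k x \<le> 2 ^ k * (G k x)\<^sup>2" by (simp add: power2_eq_square mult_ac)
      also have "\<dots> \<le> 2 ^ k * (G k x)\<^sup>2 + (1 / 2) ^ k" by simp
      finally show ?thesis .
    qed
    have int: "integrable M (\<lambda>x. 2 ^ k * (G k x)\<^sup>2 + (1 / 2) ^ k)"
      using Gsq(1) by simp
    have "(\<integral>\<^sup>+x. G k x \<partial>M) \<le> (\<integral>\<^sup>+x. ennreal (2 ^ k * (G k x)\<^sup>2 + (1 / 2) ^ k) \<partial>M)"
      by (intro nn_integral_mono ennreal_leI pt)
    also have "\<dots> = ennreal (\<integral>x. 2 ^ k * (G k x)\<^sup>2 + (1 / 2) ^ k \<partial>M)"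
      by (intro nn_integral_eq_integral int) (auto intro!: AE_I2 add_nonneg_nonneg)
    also have "(\<integral>x. 2 ^ k * (G k x)\<^sup>2 + (1 / 2) ^ k \<partial>M) = 2 ^ k * (\<integral>x. (G k x)\<^sup>2 \<partial>M) + \<mu> * (1 / 2) ^ k"
      using Gsq(1) by (simp add: \<mu>_def)
    also have "\<dots> \<le> 2 ^ k * (1 / 4) ^ k + \<mu> * (1 / 2) ^ k"
      using Gsq(2)[of k] by simp
    also have "(2::real) ^ k * (1 / 4) ^ k = (1 / 2) ^ k"
      by (simp flip: power_mult_distrib)
    finally show ?thesis by (simp add: algebra_simps ennreal_leI)
  qed
  have AE_fin: "AE x in M. (\<Sum>k. ennreal (G k x)) \<noteq> \<infinity>"
  proof (rule nn_integral_noteq_infinite)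
    have \<mu>: "\<mu> \<ge> 0" by (simp add: \<mu>_def)
    have "(\<integral>\<^sup>+x. (\<Sum>k. ennreal (G k x)) \<partial>M) = (\<Sum>k. \<integral>\<^sup>+x. ennreal (G k x) \<partial>M)"
      by (rule nn_integral_suminf) measurable
    also have "\<dots> \<le> (\<Sum>k. ennreal ((1 + \<mu>) * (1 / 2) ^ k))"
      by (intro suminf_le Gint) auto
    also have "\<dots> = ennreal (\<Sum>k. (1 + \<mu>) * (1 / 2) ^ k)"
      using \<mu> by (intro suminf_ennreal2 summable_mult) auto
    also have "\<dots> < \<infinity>" by simp
    finally show "(\<integral>\<^sup>+x. (\<Sum>k. ennreal (G k x)) \<partial>M) \<noteq> \<infinity>" by simp
  qed measurable
  define g where "g x = lim (\<lambda>k. f (r k) x)" for x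
  have AE_lim: "AE x in M. (\<lambda>k. f (r k) x) \<longlonglongrightarrow> g x"
    using AE_fin
  proof eventually_elim
    case (elim x)
    then have "summable (\<lambda>k. G k x)"
      by (intro summable_suminf_not_top) (auto simp: G_def)
    then have "summable (\<lambda>k. f (r (Suc k)) x - f (r k) x)"
      unfolding G_def by (rule summable_norm_cancel)
    then have "convergent (\<lambda>n. \<Sum>k<n. f (r (Suc k)) x - f (r k) x)"
      by (simp add: summable_iff_convergent)
    then have "convergent (\<lambda>n. f (r n) x - f (r 0) x)"
      by (simp add: sum_lessThan_telescope[of "\<lambda>k. f (r k) x"])
    then have "convergent (\<lambda>n. (f (r n) x - f (r 0) x) + f (r 0) x)"
      by (intro convergent_add convergent_const)
    then show ?case unfolding g_def by (simp add: convergent_LIMSEQ_iff)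
  qed
  have [measurable]: "g \<in> borel_measurable M"
    unfolding g_def by measurable
  have Fatou: "(\<integral>\<^sup>+x. ennreal ((norm (f n x - g x))\<^sup>2) \<partial>M) \<le> ennreal e"
    if "\<And>m. m \<ge> n0 \<Longrightarrow> (\<integral>x. (norm (f n x - f m x))\<^sup>2 \<partial>M) \<le> e" for n n0 e
  proof -
    have "(\<integral>\<^sup>+x. ennreal ((norm (f n x - g x))\<^sup>2) \<partial>M)
        = (\<integral>\<^sup>+x. liminf (\<lambda>k. ennreal ((norm (f n x - f (r k) x))\<^sup>2)) \<partial>M)"
    proof (rule nn_integral_cong_AE)
      show "AE x in M. ennreal ((norm (f n x - g x))\<^sup>2) = liminf (\<lambda>k. ennreal ((norm (f n x - f (r k) x))\<^sup>2))"
        using AE_lim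
      proof eventually_elim
        case (elim x)
        then have "(\<lambda>k. ennreal ((norm (f n x - f (r k) x))\<^sup>2)) \<longlonglongrightarrow> ennreal ((norm (f n x - g x))\<^sup>2)"
          by (intro tendsto_ennrealI tendsto_intros)
        then show ?case by (intro lim_imp_Liminf[symmetric]) auto
      qed
    qed
    also have "\<dots> \<le> liminf (\<lambda>k. \<integral>\<^sup>+x. ennreal ((norm (f n x - f (r k) x))\<^sup>2) \<partial>M)"
      by (rule nn_integral_liminf) measurable
    also have "\<dots> \<le> limsup (\<lambda>k. \<integral>\<^sup>+x. ennreal ((norm (f n x - f (r k) x))\<^sup>2) \<partial>M)"
      by (rule Liminf_le_Limsup) simp
    also have "\<dots> \<le> ennreal e"
    proof (rule Limsup_bounded, rule eventually_sequentiallyI[of n0])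
      fix k assume "n0 \<le> k"
      then have "n0 \<le> r k" using r_mono(3)[of k] by simp
      then show "(\<integral>\<^sup>+x. ennreal ((norm (f n x - f (r k) x))\<^sup>2) \<partial>M) \<le> ennreal e"
        using that L2_integrable[OF L2_diff[OF f f]]
        by (subst nn_integral_eq_integral) (auto intro!: ennreal_leI)
    qed
    finally show ?thesis .
  qed
  have diff_int: "(\<lambda>x. f n x - g x) \<in> L2 M" if "\<And>m. m \<ge> n0 \<Longrightarrow> (\<integral>x. (norm (f n x - f m x))\<^sup>2 \<partial>M) \<le> e" for n n0 e
  proof -
    have "(\<integral>\<^sup>+x. ennreal ((norm (f n x - g x))\<^sup>2) \<partial>M) \<le> ennreal e"
      by (rule Fatou) (rule that)
    then have "(\<integral>\<^sup>+x. ennreal ((norm (f n x - g x))\<^sup>2) \<partial>M) < \<infinity>"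
      by (simp add: order_le_less_trans)
    then show ?thesis by (auto simp: L2_def intro!: integrableI_bounded)
  qed
  obtain n1 where n1: "\<And>m n. m \<ge> n1 \<Longrightarrow> n \<ge> n1 \<Longrightarrow> (\<integral>x. (norm (f m x - f n x))\<^sup>2 \<partial>M) < 1"
    using Cauchy[of 1] by auto
  have "(\<lambda>x. f n1 x - g x) \<in> L2 M"
    by (rule diff_int[of n1 n1 1]) (use n1 in \<open>auto intro: less_imp_le\<close>)
  from L2_diff[OF f[of n1] this] have gL2: "g \<in> L2 M" by simp
  have "(\<lambda>n. \<integral>x. (norm (f n x - g x))\<^sup>2 \<partial>M) \<longlonglongrightarrow> 0"
  proof (rule LIMSEQ_I)
    fix e :: real assume e: "e > 0"
    obtain n0 where n0: "\<And>m n. m \<ge> n0 \<Longrightarrow> n \<ge> n0 \<Longrightarrow> (\<integral>x. (norm (f m x - f n x))\<^sup>2 \<partial>M) < e / 2"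
      using Cauchy[of "e / 2"] e by auto
    have "norm ((\<integral>x. (norm (f n x - g x))\<^sup>2 \<partial>M) - 0) < e" if "n \<ge> n0" for n
    proof -
      have "(\<integral>\<^sup>+x. ennreal ((norm (f n x - g x))\<^sup>2) \<partial>M) \<le> ennreal (e / 2)"
        by (rule Fatou[of n0]) (use n0 that in \<open>auto intro: less_imp_le\<close>)
      then have "ennreal (\<integral>x. (norm (f n x - g x))\<^sup>2 \<partial>M) \<le> ennreal (e / 2)"
        using L2_integrable[OF L2_diff[OF f gL2]] by (subst (asm) nn_integral_eq_integral) auto
      then show ?thesis using e by (simp add: ennreal_le_iff)
    qed
    then show "\<exists>no. \<forall>n\<ge>no. norm ((\<integral>x. (norm (f n x - g x))\<^sup>2 \<partial>M) - 0) < e" by blast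
  qed
  with gL2 show ?thesis by (rule that)
qed

section \<open>The fundamental lemma of the calculus of variations\<close>

text \<open>Open boxes form an intersection-stable generator of the Borel sets, so the integrals
  vanish on all Borel sets by Dynkin's argument; closure under complements uses that the total
  integral is the one over \<open>box c d\<close>. Lebesgue sets differ from Borel sets by null
  sets.\<close>

lemma AE_zero_of_box_integrals:
  fixes u :: "'a::euclidean_space \<Rightarrow> 'b::euclidean_space"
  assumes u: "integrable lebesgue u" and supp: "\<And>x. x \<notin> box c d \<Longrightarrow> u x = 0"
    and box: "\<And>a b. (LINT x:box a b|lebesgue. u x) = 0"
  shows "AE x in lebesgue. u x = 0"
proof -
  have total: "(\<integral>x. u x \<partial>lebesgue) = 0"
  proof -
    have "indicator (box c d) x *\<^sub>R u x = u x" for x using supp[of x] by (auto simp: indicator_def)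
    then show ?thesis using box[of c d] by (simp add: set_lebesgue_integral_def)
  qed
  have int: "integrable lebesgue (\<lambda>x. indicator A x *\<^sub>R u x)" if "A \<in> sets lebesgue" for A
    using integrable_mult_indicator[OF that u] .
  have borel0: "(LINT x:A|lebesgue. u x) = 0" if "A \<in> sets borel" for A
  proof -
    let ?G = "range (\<lambda>(a, b). box a b :: 'a set)"
    have S: "sets borel = sigma_sets UNIV ?G"
      by (subst borel_eq_box) (simp add: sets_measure_of)
    have st: "Int_stable ?G"
      by (auto simp: Int_stable_def box_Int_box)
    have G: "?G \<subseteq> Pow UNIV" by simp
    from that[unfolded S] show ?thesis
    proof (induction rule: sigma_sets_induct_disjoint[OF st G, consumes 1, case_names basic empty compl union])
      case (basic A) then show ?case using box by auto
    next
      case empty then show ?case by (simp add: set_lebesgue_integral_def)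
    next
      case (compl A)
      have A: "A \<in> sets lebesgue" using compl(1) by (simp add: S[symmetric])
      have "(LINT x:(UNIV - A)|lebesgue. u x) = (\<integral>x. u x - indicator A x *\<^sub>R u x \<partial>lebesgue)"
        unfolding set_lebesgue_integral_def
        by (intro Bochner_Integration.integral_cong) (auto simp: indicator_def)
      then show ?case using compl u int[OF A] total by (simp add: set_lebesgue_integral_def)
    next
      case (union A)
      have A: "A i \<in> sets lebesgue" for i using union(2) by (auto simp: S[symmetric])
      have "(LINT x:(\<Union>i. A i)|lebesgue. u x) = (\<Sum>i. (LINT x:(A i)|lebesgue. u x))"
      proof (rule lebesgue_integral_countable_add[OF A])
        show "A i \<inter> A j = {}" if "i \<noteq> j" for i j
          using union(1) that by (auto simp: disjoint_family_on_def)
        show "set_integrable lebesgue (\<Union>i. A i) u"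
          unfolding set_integrable_def using A by (intro int sets.countable_UN) auto
      qed
      then show ?case using union by simp
    qed
  qed
  have leb0: "(LINT x:A|lebesgue. u x) = 0" if A: "A \<in> sets lebesgue" for A
  proof -
    obtain S N N' where S: "A = S \<union> N" "N \<subseteq> N'" "N' \<in> null_sets lborel" "S \<in> sets lborel"
      using A by (rule sets_completionE)
    have "AE x in lebesgue. x \<notin> N'"
      using S(3) by (intro AE_completion AE_not_in)
    then have "AE x in lebesgue. indicator A x *\<^sub>R u x = indicator S x *\<^sub>R u x"
      by eventually_elim (use S in \<open>auto simp: indicator_def\<close>)
    then have "(LINT x:A|lebesgue. u x) = (LINT x:S|lebesgue. u x)"
      unfolding set_lebesgue_integral_def
      by (intro integral_cong_AE borel_measurable_integrable int) (use S A in auto)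
    then show ?thesis using borel0 S by simp
  qed
  interpret sigma_finite_measure "lebesgue :: 'a measure"
  proof
    have "(\<Union>n. cball (0::'a) (real n)) = UNIV"
    proof (intro set_eqI iffI UNIV_I)
      fix x :: 'a
      obtain n where "norm x \<le> real n" using real_arch_simple by blast
      then show "x \<in> (\<Union>n. cball (0::'a) (real n))" by auto
    qed
    moreover have "emeasure lebesgue (cball (0::'a) (real n)) \<noteq> \<infinity>" for n
      by (simp add: emeasure_cball)
    ultimately show "\<exists>A::'a set set. countable A \<and> A \<subseteq> sets lebesgue \<and> \<Union>A = space lebesgue \<and> (\<forall>a\<in>A. emeasure lebesgue a \<noteq> \<infinity>)"
      by (intro exI[of _ "range (\<lambda>n. cball (0::'a) (real n))"]) auto
  qed
  show ?thesis
    by (rule density_zero[OF u leb0])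
qed

text \<open>Products of one-dimensional cutoffs: \<open>flat 0 (real (Suc n) * t)\<close> tends to 1
  for t > 0 and is 0 for t \<le> 0.\<close>

lemma test_box_approx:
  fixes a b :: "'a::euclidean_space"
  assumes "cbox a b \<subseteq> \<Omega>"
  obtains \<phi> where "\<And>n. \<phi> n \<in> test_functions \<Omega>" "\<And>n x. \<bar>\<phi> n x\<bar> \<le> 1"
    "\<And>x. (\<lambda>n. \<phi> n x) \<longlonglongrightarrow> indicator (box a b) x"
proof
  define s where "s n t = flat 0 (real (Suc n) * t)" for n t
  define \<phi> where "\<phi> n x = (\<Prod>i\<in>Basis. s n (x \<bullet> i - a \<bullet> i) * s n (b \<bullet> i - x \<bullet> i))" for n and x :: 'a
  have s01: "0 \<le> s n t" "s n t \<le> 1" for n t using flat_bounds by (auto simp: s_def)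
  have s0: "s n t = 0" if "t \<le> 0" for n t
    using that by (simp add: s_def flat_def mult_nonneg_nonpos)
  have sm_s: "smooth (s n)" for n
    unfolding s_def[abs_def] by (rule smooth_compose[OF smooth_flat smooth_mult[OF smooth_const smooth_id]])
  have sm: "smooth (\<phi> n)" for n
    unfolding \<phi>_def[abs_def]
    by (intro smooth_prod smooth_mult smooth_compose[OF sm_s] smooth_diff smooth_inner smooth_const) auto
  show "\<phi> n \<in> test_functions \<Omega>" for n
  proof (rule test_functionsI[OF sm compact_cbox assms])
    fix x assume "x \<notin> cbox a b"
    then obtain i where i: "i \<in> Basis" "x \<bullet> i < a \<bullet> i \<or> b \<bullet> i < x \<bullet> i" by (auto simp: mem_box not_le)
    then have "s n (x \<bullet> i - a \<bullet> i) * s n (b \<bullet> i - x \<bullet> i) = 0" using s0 by auto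
    then show "\<phi> n x = 0" unfolding \<phi>_def using i(1) by (intro prod_zero) auto
  qed
  show "\<bar>\<phi> n x\<bar> \<le> 1" for n x
  proof -
    have "0 \<le> \<phi> n x" unfolding \<phi>_def by (intro prod_nonneg) (simp add: s01)
    moreover have "\<phi> n x \<le> 1" unfolding \<phi>_def by (intro prod_le_1) (auto simp: s01 mult_le_one)
    ultimately show ?thesis by simp
  qed
  have s_lim: "(\<lambda>n. s n t) \<longlonglongrightarrow> (if t > 0 then 1 else 0)" for t
  proof (cases "t > 0")
    case True
    have "filterlim (\<lambda>n. real (Suc n)) at_top sequentially"
      by (rule filterlim_compose[OF filterlim_real_sequentially filterlim_Suc])
    then have "filterlim (\<lambda>n. t * real (Suc n)) at_top sequentially"
      by (rule filterlim_tendsto_pos_mult_at_top[OF tendsto_const True])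
    then have "(\<lambda>n. flat 0 (t * real (Suc n))) \<longlonglongrightarrow> 1"
      by (rule filterlim_compose[OF tendsto_flat_at_top(1)])
    then show ?thesis using True by (simp add: s_def mult.commute)
  qed (simp add: s0)
  show "(\<lambda>n. \<phi> n x) \<longlonglongrightarrow> indicator (box a b) x" for x
  proof -
    have "(\<lambda>n. \<phi> n x) \<longlonglongrightarrow> (\<Prod>i\<in>Basis. (if x \<bullet> i - a \<bullet> i > 0 then 1 else 0) * (if b \<bullet> i - x \<bullet> i > 0 then 1 else 0))"
      unfolding \<phi>_def by (intro tendsto_prod tendsto_mult s_lim)
    also have "(\<Prod>i\<in>Basis. (if x \<bullet> i - a \<bullet> i > 0 then 1 else 0) * (if b \<bullet> i - x \<bullet> i > 0 then 1 else 0)) = (indicator (box a b) x :: real)"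
    proof (cases "x \<in> box a b")
      case True
      then show ?thesis by (simp add: mem_box)
    next
      case False
      then obtain i where "i \<in> Basis" "\<not> (a \<bullet> i < x \<bullet> i \<and> x \<bullet> i < b \<bullet> i)" by (auto simp: mem_box)
      then show ?thesis using False by (auto intro!: prod_zero)
    qed
    finally show ?thesis .
  qed
qed

text \<open>Test functions approximating indicators give vanishing integrals of h over boxes whose
  closed version lies in \<Omega>. The preceding criterion wants all boxes, so it is applied to the
  restriction of h to one such box at a time; countably many of them cover \<Omega>.\<close>

lemma fundamental_lemma:
  fixes h :: "'a::euclidean_space \<Rightarrow> 'b::euclidean_space"
  assumes \<Omega>: "open \<Omega>" and h: "integrable (lebesgue_on \<Omega>) h"
    and zero: "\<And>\<phi>. \<phi> \<in> test_functions \<Omega> \<Longrightarrow> (\<integral>x. \<phi> x *\<^sub>R h x \<partial>lebesgue_on \<Omega>) = 0"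
  shows "AE x in lebesgue_on \<Omega>. h x = 0"
proof -
  have \<Omega>l: "\<Omega> \<in> sets lebesgue" "\<Omega> \<inter> space lebesgue \<in> sets lebesgue" using \<Omega> by auto
  define u where "u x = indicator \<Omega> x *\<^sub>R h x" for x
  have u: "integrable lebesgue u"
    unfolding u_def using h \<Omega>l by (subst (asm) integrable_restrict_space) auto
  have box_zero: "(LINT x:box a b|lebesgue. u x) = 0" if ab: "cbox a b \<subseteq> \<Omega>" for a b
  proof -
    obtain \<phi> where \<phi>: "\<And>n. \<phi> n \<in> test_functions \<Omega>" "\<And>n x. \<bar>\<phi> n x\<bar> \<le> 1"
      "\<And>x. (\<lambda>n. \<phi> n x) \<longlonglongrightarrow> indicator (box a b) x"
      using test_box_approx[OF ab] by metis
    have m1: "\<phi> n \<in> borel_measurable lebesgue" for n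
      using smooth_continuous[OF test_smooth[OF \<phi>(1)], of UNIV]
      by (intro measurable_completion) (auto intro: borel_measurable_continuous_onI)
    have m2: "u \<in> borel_measurable lebesgue" using u by auto
    have "(\<lambda>n. \<integral>x. \<phi> n x *\<^sub>R u x \<partial>lebesgue) \<longlonglongrightarrow> (\<integral>x. indicator (box a b) x *\<^sub>R u x \<partial>lebesgue)"
    proof (rule integral_dominated_convergence)
      show "integrable lebesgue (\<lambda>x. norm (u x))" using u by simp
      show "AE x in lebesgue. (\<lambda>n. \<phi> n x *\<^sub>R u x) \<longlonglongrightarrow> indicator (box a b) x *\<^sub>R u x"
        by (intro AE_I2 tendsto_scaleR \<phi>(3) tendsto_const)
      show "AE x in lebesgue. norm (\<phi> n x *\<^sub>R u x) \<le> norm (u x)" for n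
        using \<phi>(2) by (intro AE_I2) (simp add: mult_left_le_one_le)
    qed (intro borel_measurable_scaleR m1 m2 borel_measurable_indicator; simp)+
    moreover have "(\<integral>x. \<phi> n x *\<^sub>R u x \<partial>lebesgue) = 0" for n
    proof -
      have "(\<integral>x. \<phi> n x *\<^sub>R u x \<partial>lebesgue) = (\<integral>x. indicator \<Omega> x *\<^sub>R (\<phi> n x *\<^sub>R h x) \<partial>lebesgue)"
        by (simp add: u_def mult.commute)
      also have "\<dots> = (\<integral>x. \<phi> n x *\<^sub>R h x \<partial>lebesgue_on \<Omega>)"
        using \<Omega>l by (intro integral_restrict_space[symmetric]) auto
      finally show ?thesis using zero[OF \<phi>(1)] by simp
    qed
    ultimately show ?thesis by (simp add: set_lebesgue_integral_def LIMSEQ_const_iff)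
  qed
  have local: "AE x in lebesgue. x \<in> cbox c d \<longrightarrow> u x = 0" if cd: "cbox c d \<subseteq> \<Omega>" for c d
  proof -
    have "AE x in lebesgue. indicator (box c d) x *\<^sub>R u x = 0"
    proof (rule AE_zero_of_box_integrals[of _ c d])
      show "integrable lebesgue (\<lambda>x. indicator (box c d) x *\<^sub>R u x)"
        by (rule integrable_mult_indicator[OF _ u]) simp
      fix a b
      \<comment> \<open>The corners of the intersection of the two boxes; the closed box between
        them lies in \<open>cbox c d\<close>, hence in \<Omega>.\<close>
      define a' where "a' = (\<Sum>i\<in>Basis. max (a \<bullet> i) (c \<bullet> i) *\<^sub>R i)"
      define b' where "b' = (\<Sum>i\<in>Basis. min (b \<bullet> i) (d \<bullet> i) *\<^sub>R i)"
      have "cbox a' b' \<subseteq> \<Omega>" using cd by (auto simp: a'_def b'_def mem_box)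
      from box_zero[OF this] have "(LINT x:box a' b'|lebesgue. u x) = 0" .
      moreover have "box a b \<inter> box c d = box a' b'" by (simp add: box_Int_box a'_def b'_def)
      ultimately show "(LINT x:box a b|lebesgue. indicator (box c d) x *\<^sub>R u x) = 0"
        by (simp add: set_lebesgue_integral_def indicator_inter_arith[symmetric])
    qed (auto simp: indicator_def)
    \<comment> \<open>The boundary of the box is null, so the statement for open boxes extends to
      the closed boxes that cover \<Omega>.\<close>
    moreover have "AE x in lebesgue. x \<notin> cbox c d - box c d"
      using negligible_frontier_interval[of c d] by (intro AE_not_in) (simp add: negligible_iff_null_sets)
    ultimately show ?thesis by eventually_elim (auto simp: indicator_def split: if_splits)
  qed
  obtain D where D: "countable D" "D \<subseteq> Pow \<Omega>" "\<And>X. X \<in> D \<Longrightarrow> \<exists>a b. X = cbox a b" "\<Union>D = \<Omega>"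
    by (rule open_countable_Union_open_cbox[OF \<Omega>]) blast
  have "AE x in lebesgue. \<forall>X\<in>D. x \<in> X \<longrightarrow> u x = 0"
  proof (subst AE_ball_countable[OF D(1)], rule ballI)
    fix X assume X: "X \<in> D"
    then obtain a b where "X = cbox a b" using D(3) by blast
    then show "AE x in lebesgue. x \<in> X \<longrightarrow> u x = 0" using local[of a b] X D(2) by blast
  qed
  then have "AE x in lebesgue. x \<in> \<Omega> \<longrightarrow> h x = 0"
  proof eventually_elim
    case (elim x)
    show ?case
    proof
      assume x: "x \<in> \<Omega>"
      then have "u x = 0" using elim D(4) by blast
      then show "h x = 0" using x by (simp add: u_def)
    qed
  qed
  then show ?thesis using \<Omega>l by (simp add: AE_restrict_space_iff)
qed

section \<open>Reduction of the eigenvalue and the torsion to test functions\<close>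

lemma L2_scaleR_integrable:
  fixes u :: "'a \<Rightarrow> real"
  assumes "u \<in> L2 M" "g \<in> L2 M"
  shows "integrable M (\<lambda>x. u x *\<^sub>R g x)"
proof (rule Bochner_Integration.integrable_bound)
  note [measurable] = L2_measurable[OF assms(1)] L2_measurable[OF assms(2)]
  show "integrable M (\<lambda>x. (norm (u x))\<^sup>2 + (norm (g x))\<^sup>2)"
    using L2_integrable[OF assms(1)] L2_integrable[OF assms(2)] by simp
  show "(\<lambda>x. u x *\<^sub>R g x) \<in> borel_measurable M" by measurable
  show "AE x in M. norm (u x *\<^sub>R g x) \<le> norm ((norm (u x))\<^sup>2 + (norm (g x))\<^sup>2)"
  proof (rule AE_I2)
    fix x
    have "2 * (norm (u x) * norm (g x)) \<le> (norm (u x))\<^sup>2 + (norm (g x))\<^sup>2"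
      using zero_le_power2[of "norm (u x) - norm (g x)"] by (simp add: power2_diff)
    moreover have "0 \<le> norm (u x) * norm (g x)" by simp
    ultimately have "norm (u x) * norm (g x) \<le> (norm (u x))\<^sup>2 + (norm (g x))\<^sup>2" by linarith
    then show "norm (u x *\<^sub>R g x) \<le> norm ((norm (u x))\<^sup>2 + (norm (g x))\<^sup>2)" by simp
  qed
qed

lemma (in finite_measure) L2_imp_integrable:
  assumes "f \<in> L2 M"
  shows "integrable M f"
proof (rule Bochner_Integration.integrable_bound)
  show "integrable M (\<lambda>x. (norm (f x))\<^sup>2 + 1)" using L2_integrable[OF assms] by simp
  show "f \<in> borel_measurable M" using L2_measurable[OF assms] .
  show "AE x in M. norm (f x) \<le> norm ((norm (f x))\<^sup>2 + 1)"
  proof (rule AE_I2)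
    fix x
    have "2 * norm (f x) \<le> (norm (f x))\<^sup>2 + 1"
      using zero_le_power2[of "norm (f x) - 1"] by (simp add: power2_diff)
    moreover have "0 \<le> norm (f x)" by simp
    ultimately have "norm (f x) \<le> (norm (f x))\<^sup>2 + 1" by linarith
    then show "norm (f x) \<le> norm ((norm (f x))\<^sup>2 + 1)" by simp
  qed
qed

definition dirichlet_energy :: "('a::euclidean_space \<Rightarrow> real) \<Rightarrow> real" where
  "dirichlet_energy \<phi> = 2 * (\<integral>x. \<phi> x \<partial>lborel) - (\<integral>x. (norm (grad \<phi> x))\<^sup>2 \<partial>lborel)"

locale bounded_open_set =
  fixes \<Omega> :: "'a::euclidean_space set"
  assumes open_set: "open \<Omega>" and bounded_set: "bounded \<Omega>"
begin

abbreviation "M \<equiv> lebesgue_on \<Omega>"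

lemma set_in_lebesgue: "\<Omega> \<in> sets lebesgue"
  using open_set by auto

lemma set_lmeasurable: "\<Omega> \<in> lmeasurable"
  using open_set bounded_set by (simp add: lmeasurable_open)

lemma finite_measure_lebesgue_on_set: "finite_measure M"
  using set_lmeasurable by (rule finite_measure_lebesgue_on)

text \<open>The Sobolev definitions integrate with \<open>lebesgue_on \<Omega>\<close>, the
  estimates with \<open>lborel\<close>; this is the bridge between them.\<close>

lemma lebesgue_on_borel_integral:
  fixes f :: "'a \<Rightarrow> 'b::euclidean_space"
  assumes "f \<in> borel_measurable borel" "\<And>x. x \<notin> \<Omega> \<Longrightarrow> f x = 0"
  shows "(\<integral>x. f x \<partial>M) = (\<integral>x. f x \<partial>lborel)" "integrable M f \<longleftrightarrow> integrable lborel f"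
    "f \<in> borel_measurable M"
proof -
  have ind: "indicator \<Omega> x *\<^sub>R f x = f x" for x using assms(2) by (auto simp: indicator_def)
  have \<Omega>: "\<Omega> \<inter> space lebesgue \<in> sets lebesgue" using set_in_lebesgue by simp
  have m: "f \<in> borel_measurable lborel" using assms(1) by simp
  show "(\<integral>x. f x \<partial>M) = (\<integral>x. f x \<partial>lborel)"
    using integral_restrict_space[OF \<Omega>, of f] integral_completion[OF m] by (simp add: ind)
  show "integrable M f \<longleftrightarrow> integrable lborel f"
    using integrable_restrict_space[OF \<Omega>, of f] integrable_completion[OF m] by (simp add: ind)
  show "f \<in> borel_measurable M"
    using measurable_completion[OF m] by (intro measurable_restrict_space1) simp
qed

lemma test_function_lebesgue_on:
  assumes "\<phi> \<in> test_functions \<Omega>"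
  shows "\<phi> \<in> L2 M" "grad \<phi> \<in> L2 M"
    "(\<integral>x. \<phi> x \<partial>M) = (\<integral>x. \<phi> x \<partial>lborel)"
    "(\<integral>x. (\<phi> x)\<^sup>2 \<partial>M) = (\<integral>x. (\<phi> x)\<^sup>2 \<partial>lborel)"
    "(\<integral>x. (norm (grad \<phi> x))\<^sup>2 \<partial>M) = (\<integral>x. (norm (grad \<phi> x))\<^sup>2 \<partial>lborel)"
    "(\<integral>x. grad \<phi> x \<bullet> h \<partial>M) = 0"
proof -
  have sm: "smooth \<phi>" using test_smooth[OF assms] .
  note [measurable] = smooth_measurable[OF sm]
  have z: "\<phi> x = 0" "grad \<phi> x = 0" if "x \<notin> \<Omega>" for x
    using assms that by (auto elim!: test_functionsE)
  show "\<phi> \<in> L2 M" "grad \<phi> \<in> L2 M"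
    using test_integrable[OF assms] z
    by (auto simp: L2_def lebesgue_on_borel_integral(2) intro!: lebesgue_on_borel_integral(3))
  show "(\<integral>x. \<phi> x \<partial>M) = (\<integral>x. \<phi> x \<partial>lborel)"
    by (rule lebesgue_on_borel_integral(1)) (use z in simp_all)
  show "(\<integral>x. (\<phi> x)\<^sup>2 \<partial>M) = (\<integral>x. (\<phi> x)\<^sup>2 \<partial>lborel)"
    by (rule lebesgue_on_borel_integral(1)) (use z in simp_all)
  show "(\<integral>x. (norm (grad \<phi> x))\<^sup>2 \<partial>M) = (\<integral>x. (norm (grad \<phi> x))\<^sup>2 \<partial>lborel)"
    by (rule lebesgue_on_borel_integral(1)) (use z in simp_all)
  have "(\<integral>x. grad \<phi> x \<bullet> h \<partial>M) = (\<integral>x. grad \<phi> x \<bullet> h \<partial>lborel)"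
    by (rule lebesgue_on_borel_integral(1)) (use z in simp_all)
  then show "(\<integral>x. grad \<phi> x \<bullet> h \<partial>M) = 0" using test_integral_directional_zero[OF assms] by simp
qed

section \<open>Weak gradients and the closure of the test functions\<close>

lemma square_integrable_iff: "square_integrable \<Omega> f \<longleftrightarrow> f \<in> L2 M"
  by (simp add: square_integrable_def L2_def)

lemma is_weak_grad_L2: "is_weak_grad \<Omega> u g \<Longrightarrow> g \<in> L2 M"
  by (simp add: is_weak_grad_def square_integrable_iff)

text \<open>Pairing with a fixed vector h turns both sides into L2 inner products, which pass to
  limits in L2.\<close>

lemma is_weak_grad_iff:
  assumes u: "u \<in> L2 M" and g: "g \<in> L2 M"
  shows "is_weak_grad \<Omega> u g \<longleftrightarrow>
    (\<forall>\<phi>\<in>test_functions \<Omega>. \<forall>h. (\<integral>x. u x \<bullet> (grad \<phi> x \<bullet> h) \<partial>M) = - (\<integral>x. g x \<bullet> (\<phi> x *\<^sub>R h) \<partial>M))"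
proof -
  have "(\<integral>x. u x *\<^sub>R grad \<phi> x \<partial>M) = - (\<integral>x. \<phi> x *\<^sub>R g x \<partial>M) \<longleftrightarrow>
    (\<forall>h. (\<integral>x. u x \<bullet> (grad \<phi> x \<bullet> h) \<partial>M) = - (\<integral>x. g x \<bullet> (\<phi> x *\<^sub>R h) \<partial>M))"
    if \<phi>: "\<phi> \<in> test_functions \<Omega>" for \<phi>
  proof -
    have 1: "integrable M (\<lambda>x. u x *\<^sub>R grad \<phi> x)" "integrable M (\<lambda>x. \<phi> x *\<^sub>R g x)"
      using u g test_function_lebesgue_on[OF \<phi>] by (auto intro: L2_scaleR_integrable)
    have "(\<integral>x. u x *\<^sub>R grad \<phi> x \<partial>M) \<bullet> h = (\<integral>x. u x \<bullet> (grad \<phi> x \<bullet> h) \<partial>M)"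
      "(\<integral>x. \<phi> x *\<^sub>R g x \<partial>M) \<bullet> h = (\<integral>x. g x \<bullet> (\<phi> x *\<^sub>R h) \<partial>M)" for h
      using integral_inner_left[of h, OF 1(1)] integral_inner_left[of h, OF 1(2)] by simp_all
    then show ?thesis
      using vector_eq_rdot[of "\<integral>x. u x *\<^sub>R grad \<phi> x \<partial>M" "- (\<integral>x. \<phi> x *\<^sub>R g x \<partial>M)"] by simp
  qed
  then show ?thesis using g by (simp add: is_weak_grad_def square_integrable_iff)
qed

text \<open>The difference of two weak gradients is orthogonal to all test functions, so the
  fundamental lemma applies. Hence the choice in \<open>weak_grad\<close> does not affect
  integrals.\<close>

lemma weak_grad_unique:
  assumes "is_weak_grad \<Omega> u g" "is_weak_grad \<Omega> u g'"
  shows "AE x in M. g x = g' x"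
proof -
  interpret finite_measure M by (rule finite_measure_lebesgue_on_set)
  have g: "g \<in> L2 M" "g' \<in> L2 M" using assms is_weak_grad_L2 by auto
  have "AE x in M. g x - g' x = 0"
  proof (rule fundamental_lemma[OF open_set])
    show "integrable M (\<lambda>x. g x - g' x)" using g by (intro L2_imp_integrable L2_diff)
    fix \<phi> assume \<phi>: "\<phi> \<in> test_functions \<Omega>"
    have "integrable M (\<lambda>x. \<phi> x *\<^sub>R g x)" "integrable M (\<lambda>x. \<phi> x *\<^sub>R g' x)"
      using g test_function_lebesgue_on[OF \<phi>] by (auto intro: L2_scaleR_integrable)
    moreover have "(\<integral>x. \<phi> x *\<^sub>R g x \<partial>M) = (\<integral>x. \<phi> x *\<^sub>R g' x \<partial>M)"
      using assms \<phi> by (simp add: is_weak_grad_def)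
    ultimately show "(\<integral>x. \<phi> x *\<^sub>R (g x - g' x) \<partial>M) = 0"
      by (simp add: scaleR_diff_right)
  qed
  then show ?thesis by eventually_elim simp
qed

text \<open>Integration by parts: the gradient of the product \<phi> \<psi> has integral 0 in every
  direction.\<close>

lemma test_is_weak_grad:
  assumes \<phi>: "\<phi> \<in> test_functions \<Omega>"
  shows "is_weak_grad \<Omega> \<phi> (grad \<phi>)"
proof (subst is_weak_grad_iff, intro test_function_lebesgue_on \<phi>, intro test_function_lebesgue_on \<phi>, intro ballI allI)
  fix \<psi> h assume \<psi>: "\<psi> \<in> test_functions \<Omega>"
  have 1: "integrable M (\<lambda>x. \<phi> x *\<^sub>R grad \<psi> x)" "integrable M (\<lambda>x. \<psi> x *\<^sub>R grad \<phi> x)"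
    using test_function_lebesgue_on[OF \<phi>] test_function_lebesgue_on[OF \<psi>] by (auto intro: L2_scaleR_integrable)
  have i: "integrable M (\<lambda>x. \<phi> x * (grad \<psi> x \<bullet> h))" "integrable M (\<lambda>x. \<psi> x * (grad \<phi> x \<bullet> h))"
    using integrable_inner_left[of h, OF 1(1)] integrable_inner_left[of h, OF 1(2)] by simp_all
  have "(\<integral>x. grad (\<lambda>x. \<phi> x * \<psi> x) x \<bullet> h \<partial>M) = 0"
    by (rule test_function_lebesgue_on(6)[OF test_mult_smooth[OF \<psi> test_smooth[OF \<phi>]]])
  then have "(\<integral>x. \<phi> x * (grad \<psi> x \<bullet> h) + \<psi> x * (grad \<phi> x \<bullet> h) \<partial>M) = 0"
    by (simp add: grad_mult test_smooth[OF \<phi>] test_smooth[OF \<psi>] inner_add_left)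
  then show "(\<integral>x. \<phi> x \<bullet> (grad \<psi> x \<bullet> h) \<partial>M) = - (\<integral>x. grad \<phi> x \<bullet> (\<psi> x *\<^sub>R h) \<partial>M)"
    using i by simp
qed

lemma H1_D:
  assumes "u \<in> H1 \<Omega>"
  shows "u \<in> L2 M" "is_weak_grad \<Omega> u (weak_grad \<Omega> u)" "weak_grad \<Omega> u \<in> L2 M"
proof -
  show "u \<in> L2 M" using assms by (simp add: H1_def square_integrable_iff)
  show "is_weak_grad \<Omega> u (weak_grad \<Omega> u)"
  proof -
    obtain g where "is_weak_grad \<Omega> u g" using assms by (auto simp: H1_def)
    then show ?thesis unfolding weak_grad_def by (rule someI[where P="is_weak_grad \<Omega> u"])
  qed
  then show "weak_grad \<Omega> u \<in> L2 M" by (rule is_weak_grad_L2)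
qed

lemma H1_I: "u \<in> L2 M \<Longrightarrow> is_weak_grad \<Omega> u g \<Longrightarrow> u \<in> H1 \<Omega>"
  by (auto simp: H1_def square_integrable_iff)

lemma weak_grad_AE:
  assumes "is_weak_grad \<Omega> u g"
  shows "AE x in M. weak_grad \<Omega> u x = g x"
  unfolding weak_grad_def by (rule weak_grad_unique[OF someI[where P="is_weak_grad \<Omega> u", OF assms] assms])

lemma is_weak_grad_diff:
  assumes u: "u \<in> L2 M" "is_weak_grad \<Omega> u g" and v: "v \<in> L2 M" "is_weak_grad \<Omega> v k"
  shows "is_weak_grad \<Omega> (\<lambda>x. u x - v x) (\<lambda>x. g x - k x)"
proof -
  have gk: "g \<in> L2 M" "k \<in> L2 M" using u v is_weak_grad_L2 by auto
  have "(\<integral>x. (u x - v x) *\<^sub>R grad \<phi> x \<partial>M) = - (\<integral>x. \<phi> x *\<^sub>R (g x - k x) \<partial>M)"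
    if \<phi>: "\<phi> \<in> test_functions \<Omega>" for \<phi>
  proof -
    have 1: "integrable M (\<lambda>x. u x *\<^sub>R grad \<phi> x)" "integrable M (\<lambda>x. v x *\<^sub>R grad \<phi> x)"
      "integrable M (\<lambda>x. \<phi> x *\<^sub>R g x)" "integrable M (\<lambda>x. \<phi> x *\<^sub>R k x)"
      using u v gk test_function_lebesgue_on[OF \<phi>] by (auto intro: L2_scaleR_integrable)
    have "(\<integral>x. u x *\<^sub>R grad \<phi> x \<partial>M) = - (\<integral>x. \<phi> x *\<^sub>R g x \<partial>M)"
      "(\<integral>x. v x *\<^sub>R grad \<phi> x \<partial>M) = - (\<integral>x. \<phi> x *\<^sub>R k x \<partial>M)"
      using u v \<phi> by (auto simp: is_weak_grad_def)
    with 1 show ?thesis by (simp add: scaleR_diff_left scaleR_diff_right)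
  qed
  then show ?thesis using L2_diff[OF gk] by (simp add: is_weak_grad_def square_integrable_iff)
qed

text \<open>\<open>H1_norm\<close> takes an arbitrarily chosen weak gradient of the difference; by
  uniqueness it may be replaced by the explicit one. Convergence in \<open>H10\<close> thus becomes
  convergence of two L2 distances.\<close>

lemma H1_norm_diff_test:
  assumes u: "u \<in> L2 M" "is_weak_grad \<Omega> u g" and \<phi>: "\<phi> \<in> test_functions \<Omega>"
  shows "H1_norm \<Omega> (\<lambda>x. u x - \<phi> x) =
    sqrt ((\<integral>x. (norm (\<phi> x - u x))\<^sup>2 \<partial>M) + (\<integral>x. (norm (grad \<phi> x - g x))\<^sup>2 \<partial>M))"
proof -
  have w: "is_weak_grad \<Omega> (\<lambda>x. u x - \<phi> x) (\<lambda>x. g x - grad \<phi> x)"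
    by (intro is_weak_grad_diff u test_is_weak_grad test_function_lebesgue_on \<phi>)
  then have "u \<in> L2 M \<and> weak_grad \<Omega> (\<lambda>x. u x - \<phi> x) \<in> L2 M"
    using u(1) H1_D(3)[OF H1_I[OF L2_diff[OF u(1) test_function_lebesgue_on(1)[OF \<phi>]]]] by blast
  then have m: "weak_grad \<Omega> (\<lambda>x. u x - \<phi> x) \<in> borel_measurable M" "(\<lambda>x. g x - grad \<phi> x) \<in> borel_measurable M"
    using L2_measurable is_weak_grad_L2[OF w] by auto
  have "(\<integral>x. (norm (weak_grad \<Omega> (\<lambda>x. u x - \<phi> x) x))\<^sup>2 \<partial>M) = (\<integral>x. (norm (grad \<phi> x - g x))\<^sup>2 \<partial>M)"
  proof (rule integral_cong_AE)
    show "AE x in M. (norm (weak_grad \<Omega> (\<lambda>x. u x - \<phi> x) x))\<^sup>2 = (norm (grad \<phi> x - g x))\<^sup>2"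
      using weak_grad_AE[OF w] by eventually_elim (simp add: norm_minus_commute)
    note [measurable] = m
    have "(\<lambda>x. (norm (g x - grad \<phi> x))\<^sup>2) \<in> borel_measurable M" by measurable
    then show "(\<lambda>x. (norm (grad \<phi> x - g x))\<^sup>2) \<in> borel_measurable M" by (simp add: norm_minus_commute)
    show "(\<lambda>x. (norm (weak_grad \<Omega> (\<lambda>x. u x - \<phi> x) x))\<^sup>2) \<in> borel_measurable M" by measurable
  qed
  then show ?thesis by (simp add: H1_norm_def power2_commute)
qed

lemma H10_approx:
  assumes u: "u \<in> H10 \<Omega>"
  obtains \<phi> where "\<And>n. \<phi> n \<in> test_functions \<Omega>"
    "(\<lambda>n. \<integral>x. (norm (\<phi> n x - u x))\<^sup>2 \<partial>M) \<longlonglongrightarrow> 0"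
    "(\<lambda>n. \<integral>x. (norm (grad (\<phi> n) x - weak_grad \<Omega> u x))\<^sup>2 \<partial>M) \<longlonglongrightarrow> 0"
proof -
  have uH: "u \<in> H1 \<Omega>" using u by (simp add: H10_def)
  obtain \<phi> where \<phi>: "\<And>n. \<phi> n \<in> test_functions \<Omega>" "(\<lambda>n. H1_norm \<Omega> (\<lambda>x. u x - \<phi> n x)) \<longlonglongrightarrow> 0"
    using u by (auto simp: H10_def)
  define A where "A n = (\<integral>x. (norm (\<phi> n x - u x))\<^sup>2 \<partial>M)" for n
  define B where "B n = (\<integral>x. (norm (grad (\<phi> n) x - weak_grad \<Omega> u x))\<^sup>2 \<partial>M)" for n
  have AB: "A n \<ge> 0" "B n \<ge> 0" for n by (auto simp: A_def B_def)
  have "(\<lambda>n. sqrt (A n + B n)) \<longlonglongrightarrow> 0"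
    using \<phi>(2) unfolding H1_norm_diff_test[OF H1_D(1,2)[OF uH] \<phi>(1)] A_def B_def .
  then have "(\<lambda>n. (sqrt (A n + B n))\<^sup>2) \<longlonglongrightarrow> 0\<^sup>2" by (rule tendsto_power)
  then have lim: "(\<lambda>n. A n + B n) \<longlonglongrightarrow> 0" using AB by (simp add: add_nonneg_nonneg)
  have "A \<longlonglongrightarrow> 0"
    by (rule tendsto_sandwich[OF _ _ tendsto_const lim]) (use AB in \<open>auto intro!: always_eventually\<close>)
  moreover have "B \<longlonglongrightarrow> 0"
    by (rule tendsto_sandwich[OF _ _ tendsto_const lim]) (use AB in \<open>auto intro!: always_eventually\<close>)
  ultimately show ?thesis using \<phi>(1) unfolding A_def B_def by (intro that)
qed

text \<open>The weak gradient relation is closed under L2 convergence, as both of its sides are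
  continuous there. This is how limits of test functions enter \<open>H10\<close>.\<close>

lemma H10_limit:
  assumes u: "u \<in> L2 M" and g: "g \<in> L2 M" and \<phi>: "\<And>n. \<phi> n \<in> test_functions \<Omega>"
    and lim: "(\<lambda>n. \<integral>x. (norm (\<phi> n x - u x))\<^sup>2 \<partial>M) \<longlonglongrightarrow> 0"
      "(\<lambda>n. \<integral>x. (norm (grad (\<phi> n) x - g x))\<^sup>2 \<partial>M) \<longlonglongrightarrow> 0"
  shows "is_weak_grad \<Omega> u g" "u \<in> H10 \<Omega>"
proof -
  show w: "is_weak_grad \<Omega> u g"
  proof (subst is_weak_grad_iff[OF u g], intro ballI allI)
    fix \<psi> h assume \<psi>: "\<psi> \<in> test_functions \<Omega>"
    have "(\<lambda>x. grad \<psi> x \<bullet> h) \<in> L2 M"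
    proof -
      note [measurable] = L2_measurable[OF test_function_lebesgue_on(2)[OF \<psi>]]
      have "integrable M (\<lambda>x. (grad \<psi> x \<bullet> h)\<^sup>2)"
      proof (rule Bochner_Integration.integrable_bound)
        show "integrable M (\<lambda>x. (norm (grad \<psi> x))\<^sup>2 * (norm h)\<^sup>2)"
          using L2_integrable[OF test_function_lebesgue_on(2)[OF \<psi>]] by simp
        show "AE x in M. norm ((grad \<psi> x \<bullet> h)\<^sup>2) \<le> norm ((norm (grad \<psi> x))\<^sup>2 * (norm h)\<^sup>2)"
          using Cauchy_Schwarz_ineq[of _ h] by (intro AE_I2) (simp add: power2_norm_eq_inner)
      qed measurable
      then show ?thesis by (simp add: L2_def)
    qed
    from L2_inner_tendsto[OF test_function_lebesgue_on(1)[OF \<phi>] u this lim(1)]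
    have 1: "(\<lambda>n. \<integral>x. \<phi> n x \<bullet> (grad \<psi> x \<bullet> h) \<partial>M) \<longlonglongrightarrow> (\<integral>x. u x \<bullet> (grad \<psi> x \<bullet> h) \<partial>M)" .
    have "(\<lambda>x. \<psi> x *\<^sub>R h) \<in> L2 M"
      using test_function_lebesgue_on(1)[OF \<psi>] by (auto simp: L2_def power_mult_distrib intro: borel_measurable_scaleR)
    from L2_inner_tendsto[OF test_function_lebesgue_on(2)[OF \<phi>] g this lim(2)]
    have 2: "(\<lambda>n. - (\<integral>x. grad (\<phi> n) x \<bullet> (\<psi> x *\<^sub>R h) \<partial>M)) \<longlonglongrightarrow> - (\<integral>x. g x \<bullet> (\<psi> x *\<^sub>R h) \<partial>M)"
      by (rule tendsto_minus)
    have "(\<integral>x. \<phi> n x \<bullet> (grad \<psi> x \<bullet> h) \<partial>M) = - (\<integral>x. grad (\<phi> n) x \<bullet> (\<psi> x *\<^sub>R h) \<partial>M)" for n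
      using test_is_weak_grad[OF \<phi>] is_weak_grad_iff[OF test_function_lebesgue_on(1,2)[OF \<phi>]] \<psi> by blast
    then show "(\<integral>x. u x \<bullet> (grad \<psi> x \<bullet> h) \<partial>M) = - (\<integral>x. g x \<bullet> (\<psi> x *\<^sub>R h) \<partial>M)"
      using LIMSEQ_unique 1 2 by simp
  qed
  have "(\<lambda>n. sqrt ((\<integral>x. (norm (\<phi> n x - u x))\<^sup>2 \<partial>M) + (\<integral>x. (norm (grad (\<phi> n) x - g x))\<^sup>2 \<partial>M))) \<longlonglongrightarrow> sqrt (0 + 0)"
    by (intro tendsto_intros lim)
  then have "(\<lambda>n. H1_norm \<Omega> (\<lambda>x. u x - \<phi> n x)) \<longlonglongrightarrow> 0"
    unfolding H1_norm_diff_test[OF u w \<phi>] by simp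
  then show "u \<in> H10 \<Omega>" using H1_I[OF u w] \<phi> by (auto simp: H10_def)
qed

lemma test_H10: "\<phi> \<in> test_functions \<Omega> \<Longrightarrow> \<phi> \<in> H10 \<Omega>"
  by (rule H10_limit(2)[of _ "grad \<phi>" "\<lambda>_. \<phi>"]) (auto intro: test_function_lebesgue_on)

lemma H10_L2:
  assumes "u \<in> H10 \<Omega>"
  shows "u \<in> L2 M" "weak_grad \<Omega> u \<in> L2 M" "is_weak_grad \<Omega> u (weak_grad \<Omega> u)"
  using assms H1_D by (auto simp: H10_def)

lemma weak_grad_norm_test:
  assumes "\<phi> \<in> test_functions \<Omega>"
  shows "(\<integral>x. (norm (weak_grad \<Omega> \<phi> x))\<^sup>2 \<partial>M) = (\<integral>x. (norm (grad \<phi> x))\<^sup>2 \<partial>lborel)"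
proof -
  have "(\<integral>x. (norm (weak_grad \<Omega> \<phi> x))\<^sup>2 \<partial>M) = (\<integral>x. (norm (grad \<phi> x))\<^sup>2 \<partial>M)"
  proof (rule integral_cong_AE)
    show "AE x in M. (norm (weak_grad \<Omega> \<phi> x))\<^sup>2 = (norm (grad \<phi> x))\<^sup>2"
      using weak_grad_AE[OF test_is_weak_grad[OF assms]] by eventually_elim simp
    note [measurable] = L2_measurable[OF H10_L2(2)[OF test_H10[OF assms]]] L2_measurable[OF test_function_lebesgue_on(2)[OF assms]]
    show "(\<lambda>x. (norm (weak_grad \<Omega> \<phi> x))\<^sup>2) \<in> borel_measurable M"
      "(\<lambda>x. (norm (grad \<phi> x))\<^sup>2) \<in> borel_measurable M" by measurable
  qed
  then show ?thesis using test_function_lebesgue_on(5)[OF assms] by simp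
qed

section \<open>The first eigenvalue as an infimum over test functions\<close>

lemma first_eigenvalue_le:
  assumes \<phi>: "\<phi> \<in> test_functions \<Omega>"
  shows "first_eigenvalue \<Omega> * (\<integral>x. (\<phi> x)\<^sup>2 \<partial>lborel) \<le> (\<integral>x. (norm (grad \<phi> x))\<^sup>2 \<partial>lborel)"
proof (cases "(\<integral>x. (\<phi> x)\<^sup>2 \<partial>lborel) = 0")
  case False
  moreover have "0 \<le> (\<integral>x. (\<phi> x)\<^sup>2 \<partial>lborel)" by simp
  ultimately have pos: "0 < (\<integral>x. (\<phi> x)\<^sup>2 \<partial>lborel)" by linarith
  have "\<not> (AE x in M. \<phi> x = 0)"
  proof
    assume "AE x in M. \<phi> x = 0"
    then have "(\<integral>x. (\<phi> x)\<^sup>2 \<partial>M) = 0"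
      by (intro integral_eq_zero_AE) (auto elim: eventually_mono)
    then show False using False test_function_lebesgue_on(4)[OF \<phi>] by simp
  qed
  then have "first_eigenvalue \<Omega> \<le> (\<integral>x. (norm (weak_grad \<Omega> \<phi> x))\<^sup>2 \<partial>M) / (\<integral>x. (\<phi> x)\<^sup>2 \<partial>M)"
    unfolding first_eigenvalue_def using test_H10[OF \<phi>]
    by (intro cInf_lower bdd_belowI[of _ 0]) auto
  then show ?thesis using pos
    by (simp add: weak_grad_norm_test[OF \<phi>] test_function_lebesgue_on(4)[OF \<phi>] pos_le_divide_eq)
qed simp

text \<open>By L2 convergence of functions and gradients, the inequality extends from test functions
  to all of \<open>H10\<close>. Nonemptiness of \<Omega> provides an admissible quotient; otherwise
  \<open>Inf\<close> would be taken over the empty set.\<close>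

lemma first_eigenvalue_ge:
  assumes ne: "\<Omega> \<noteq> {}"
    and \<mu>: "\<And>\<phi>. \<phi> \<in> test_functions \<Omega> \<Longrightarrow> \<mu> * (\<integral>x. (\<phi> x)\<^sup>2 \<partial>lborel) \<le> (\<integral>x. (norm (grad \<phi> x))\<^sup>2 \<partial>lborel)"
  shows "\<mu> \<le> first_eigenvalue \<Omega>"
  unfolding first_eigenvalue_def
proof (rule cInf_greatest)
  obtain a where a: "a \<in> \<Omega>" using ne by blast
  then obtain \<phi> where \<phi>: "\<phi> \<in> test_functions \<Omega>" "\<phi> a \<noteq> 0"
    using exists_test_function[OF open_set] by blast
  have "\<not> (AE x in M. \<phi> x = 0)"
  proof
    assume "AE x in M. \<phi> x = 0"
    then have "(\<integral>x. (\<phi> x)\<^sup>2 \<partial>M) = 0"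
      by (intro integral_eq_zero_AE) (auto elim: eventually_mono)
    then show False using test_integral_square_pos[OF \<phi>] test_function_lebesgue_on(4)[OF \<phi>(1)] by simp
  qed
  then show "{(\<integral>x. (norm (weak_grad \<Omega> u x))\<^sup>2 \<partial>M) / (\<integral>x. (u x)\<^sup>2 \<partial>M) | u. u \<in> H10 \<Omega> \<and> \<not> (AE x in M. u x = 0)} \<noteq> {}"
    using test_H10[OF \<phi>(1)] by blast
next
  fix q assume "q \<in> {(\<integral>x. (norm (weak_grad \<Omega> u x))\<^sup>2 \<partial>M) / (\<integral>x. (u x)\<^sup>2 \<partial>M) | u. u \<in> H10 \<Omega> \<and> \<not> (AE x in M. u x = 0)}"
  then obtain u where u: "u \<in> H10 \<Omega>" "\<not> (AE x in M. u x = 0)"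
    and q: "q = (\<integral>x. (norm (weak_grad \<Omega> u x))\<^sup>2 \<partial>M) / (\<integral>x. (u x)\<^sup>2 \<partial>M)" by blast
  obtain \<phi> where \<phi>: "\<And>n. \<phi> n \<in> test_functions \<Omega>"
    "(\<lambda>n. \<integral>x. (norm (\<phi> n x - u x))\<^sup>2 \<partial>M) \<longlonglongrightarrow> 0"
    "(\<lambda>n. \<integral>x. (norm (grad (\<phi> n) x - weak_grad \<Omega> u x))\<^sup>2 \<partial>M) \<longlonglongrightarrow> 0"
    using H10_approx[OF u(1)] by blast
  have 1: "(\<lambda>n. \<mu> * (\<integral>x. (\<phi> n x)\<^sup>2 \<partial>lborel)) \<longlonglongrightarrow> \<mu> * (\<integral>x. (u x)\<^sup>2 \<partial>M)"
    using L2_norm_tendsto[OF test_function_lebesgue_on(1)[OF \<phi>(1)] H10_L2(1)[OF u(1)] \<phi>(2)]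
    by (intro tendsto_mult tendsto_const) (simp add: test_function_lebesgue_on(4)[OF \<phi>(1)])
  have 2: "(\<lambda>n. \<integral>x. (norm (grad (\<phi> n) x))\<^sup>2 \<partial>lborel) \<longlonglongrightarrow> (\<integral>x. (norm (weak_grad \<Omega> u x))\<^sup>2 \<partial>M)"
    using L2_norm_tendsto[OF test_function_lebesgue_on(2)[OF \<phi>(1)] H10_L2(2)[OF u(1)] \<phi>(3)]
    by (simp add: test_function_lebesgue_on(5)[OF \<phi>(1)])
  have le: "\<mu> * (\<integral>x. (u x)\<^sup>2 \<partial>M) \<le> (\<integral>x. (norm (weak_grad \<Omega> u x))\<^sup>2 \<partial>M)"
    by (rule LIMSEQ_le[OF 1 2]) (use \<mu> \<phi>(1) in auto)
  have "(\<integral>x. (u x)\<^sup>2 \<partial>M) \<noteq> 0"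
  proof
    assume "(\<integral>x. (u x)\<^sup>2 \<partial>M) = 0"
    then have "AE x in M. (u x)\<^sup>2 = 0"
      using L2_integrable[OF H10_L2(1)[OF u(1)]] by (subst (asm) integral_nonneg_eq_0_iff_AE) auto
    then show False using u(2) by (auto elim: eventually_mono)
  qed
  moreover have "0 \<le> (\<integral>x. (u x)\<^sup>2 \<partial>M)" by simp
  ultimately have "0 < (\<integral>x. (u x)\<^sup>2 \<partial>M)" by linarith
  then show "\<mu> \<le> q" using le by (simp add: q pos_le_divide_eq)
qed

section \<open>The torsion as a supremum over test functions\<close>

lemma dirichlet_energy_M:
  assumes "\<phi> \<in> test_functions \<Omega>"
  shows "dirichlet_energy \<phi> = 2 * (\<integral>x. \<phi> x \<partial>M) - (\<integral>x. (norm (grad \<phi> x))\<^sup>2 \<partial>M)"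
  using test_function_lebesgue_on[OF assms] by (simp add: dirichlet_energy_def)

text \<open>Integrate the pointwise bound 2 \<phi> \<le> \<mu> \<phi>^2 + 1 / \<mu> over \<Omega>.
  For \<mu> the first eigenvalue this becomes Polya's inequality.\<close>

lemma dirichlet_energy_bound:
  assumes \<phi>: "\<phi> \<in> test_functions \<Omega>" and \<mu>: "\<mu> > 0"
    and le: "\<mu> * (\<integral>x. (\<phi> x)\<^sup>2 \<partial>lborel) \<le> (\<integral>x. (norm (grad \<phi> x))\<^sup>2 \<partial>lborel)"
  shows "dirichlet_energy \<phi> \<le> measure lebesgue \<Omega> / \<mu>"
proof -
  interpret finite_measure M by (rule finite_measure_lebesgue_on_set)
  have i: "integrable M \<phi>" "integrable M (\<lambda>x. (\<phi> x)\<^sup>2)"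
    using L2_imp_integrable[OF test_function_lebesgue_on(1)[OF \<phi>]] L2_integrable[OF test_function_lebesgue_on(1)[OF \<phi>]] by auto
  have "2 * (\<integral>x. \<phi> x \<partial>M) = (\<integral>x. 2 * \<phi> x \<partial>M)" by simp
  also have "\<dots> \<le> (\<integral>x. \<mu> * (\<phi> x)\<^sup>2 + 1 / \<mu> \<partial>M)"
  proof (rule integral_mono)
    fix x
    have "0 \<le> \<mu> * (\<phi> x - 1 / \<mu>)\<^sup>2" using \<mu> by simp
    also have "\<dots> = \<mu> * (\<phi> x)\<^sup>2 - 2 * \<phi> x + 1 / \<mu>"
      using \<mu> by (simp add: power2_diff field_simps power2_eq_square)
    finally show "2 * \<phi> x \<le> \<mu> * (\<phi> x)\<^sup>2 + 1 / \<mu>" by simp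
  qed (use i in auto)
  also have "\<dots> = \<mu> * (\<integral>x. (\<phi> x)\<^sup>2 \<partial>M) + measure M \<Omega> / \<mu>"
    using i by simp
  also have "measure M \<Omega> = measure lebesgue \<Omega>"
    using set_in_lebesgue by (simp add: measure_restrict_space)
  finally show ?thesis using le test_function_lebesgue_on[OF \<phi>] by (simp add: dirichlet_energy_def)
qed

text \<open>Direct method: strict concavity of the energy makes the gradients of a maximising
  sequence Cauchy, and the Poincare inequality does the same for the functions. The equation is the
  first variation at the limit.\<close>

lemma torsion_function_exists:
  assumes \<mu>: "\<mu> > 0"
    and poincare: "\<And>\<phi>. \<phi> \<in> test_functions \<Omega> \<Longrightarrow> \<mu> * (\<integral>x. (\<phi> x)\<^sup>2 \<partial>lborel) \<le> (\<integral>x. (norm (grad \<phi> x))\<^sup>2 \<partial>lborel)"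
  shows "\<exists>w. is_torsion_function \<Omega> w"
proof -
  let ?E = dirichlet_energy
  define m where "m = Sup (?E ` test_functions \<Omega>)"
  have bdd: "bdd_above (?E ` test_functions \<Omega>)"
    using dirichlet_energy_bound[OF _ \<mu> poincare] by (auto intro!: bdd_aboveI)
  have E_le: "?E \<phi> \<le> m" if "\<phi> \<in> test_functions \<Omega>" for \<phi>
    unfolding m_def using that bdd by (intro cSup_upper) auto
  have "\<exists>\<phi>\<in>test_functions \<Omega>. m - 1 / real (Suc n) < ?E \<phi>" for n
  proof -
    have "?E ` test_functions \<Omega> \<noteq> {}" using test_zero[of \<Omega>] by blast
    moreover have "m - 1 / real (Suc n) < Sup (?E ` test_functions \<Omega>)" by (simp add: m_def)
    ultimately have "\<exists>y\<in>?E ` test_functions \<Omega>. m - 1 / real (Suc n) < y"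
      by (rule less_cSupD)
    then show ?thesis by blast
  qed
  then obtain \<phi> where \<phi>: "\<And>n. \<phi> n \<in> test_functions \<Omega>" "\<And>n. m - 1 / real (Suc n) < ?E (\<phi> n)"
    by metis
  have E_lim: "(\<lambda>n. ?E (\<phi> n)) \<longlonglongrightarrow> m"
  proof (rule tendsto_sandwich[OF _ _ _ tendsto_const])
    have "(\<lambda>n. m - 1 / real (Suc n)) \<longlonglongrightarrow> m - 0"
      by (intro tendsto_intros lim_const_over_n[THEN LIMSEQ_Suc])
    then show "(\<lambda>n. m - 1 / real (Suc n)) \<longlonglongrightarrow> m" by simp
  qed (use \<phi> E_le in \<open>auto intro!: always_eventually less_imp_le\<close>)
  have sm: "smooth (\<phi> n)" for n using test_smooth[OF \<phi>(1)] .
  have L2: "\<phi> n \<in> L2 M" "grad (\<phi> n) \<in> L2 M" for n using test_function_lebesgue_on[OF \<phi>(1)] by auto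
  interpret finite_measure M by (rule finite_measure_lebesgue_on_set)
  define G where "G i j = (\<integral>x. (norm (grad (\<phi> i) x - grad (\<phi> j) x))\<^sup>2 \<partial>M)" for i j
  have G_le: "G i j \<le> 2 / real (Suc i) + 2 / real (Suc j)" for i j
  proof -
    \<comment> \<open>By the parallelogram identity the energy of the midpoint exceeds the mean of
      the two energies by \<open>G i j / 4\<close>, and it cannot exceed m.\<close>
    define \<theta> where "\<theta> x = 1 / 2 * (\<phi> i x + \<phi> j x)" for x
    have \<theta>: "\<theta> \<in> test_functions \<Omega>"
      unfolding \<theta>_def by (intro test_cmult test_add \<phi>)
    have grad\<theta>: "grad \<theta> x = (1 / 2) *\<^sub>R (grad (\<phi> i) x + grad (\<phi> j) x)" for x
      unfolding \<theta>_def by (simp only: grad_cmult[OF smooth_add[OF sm sm]] grad_add[OF sm sm])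
    have pt: "(norm (grad \<theta> x))\<^sup>2 = (norm (grad (\<phi> i) x))\<^sup>2 / 2 + (norm (grad (\<phi> j) x))\<^sup>2 / 2
        - (norm (grad (\<phi> i) x - grad (\<phi> j) x))\<^sup>2 / 4" for x
      unfolding grad\<theta> power2_norm_eq_inner
      by (simp add: inner_add_left inner_add_right inner_diff_left inner_diff_right inner_commute field_simps)
    have "(\<integral>x. (norm (grad \<theta> x))\<^sup>2 \<partial>M) = (\<integral>x. (norm (grad (\<phi> i) x))\<^sup>2 \<partial>M) / 2
        + (\<integral>x. (norm (grad (\<phi> j) x))\<^sup>2 \<partial>M) / 2 - G i j / 4"
      unfolding pt G_def using L2_integrable[OF L2(2)] L2_integrable[OF L2_diff[OF L2(2) L2(2)]] by simp
    moreover have "(\<integral>x. \<theta> x \<partial>M) = (\<integral>x. \<phi> i x \<partial>M) / 2 + (\<integral>x. \<phi> j x \<partial>M) / 2"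
      unfolding \<theta>_def using L2_imp_integrable[OF L2(1)] by simp
    ultimately have "?E \<theta> = ?E (\<phi> i) / 2 + ?E (\<phi> j) / 2 + G i j / 4"
      using dirichlet_energy_M[OF \<theta>] dirichlet_energy_M[OF \<phi>(1)[of i]] dirichlet_energy_M[OF \<phi>(1)[of j]]
      by linarith
    then have "G i j / 4 \<le> m - ?E (\<phi> i) / 2 - ?E (\<phi> j) / 2" using E_le[OF \<theta>] by simp
    moreover have "?E (\<phi> i) > m - 1 / real (Suc i)" "?E (\<phi> j) > m - 1 / real (Suc j)" using \<phi>(2) by auto
    moreover have "2 / real (Suc i) = 2 * (1 / real (Suc i))" "2 / real (Suc j) = 2 * (1 / real (Suc j))" by auto
    ultimately show ?thesis by linarith
  qed
  have G_Cauchy: "\<exists>N. \<forall>i\<ge>N. \<forall>j\<ge>N. G i j < e" if e: "e > 0" for e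
  proof -
    obtain N :: nat where N: "4 / e < real (Suc N)" using reals_Archimedean2[of "4 / e"] by (meson less_SucI of_nat_less_iff order_less_trans lessI)
    have "G i j < e" if "N \<le> i" "N \<le> j" for i j
    proof -
      have "2 / real (Suc i) \<le> 2 / real (Suc N)" "2 / real (Suc j) \<le> 2 / real (Suc N)"
        using that by (auto intro!: divide_left_mono)
      moreover have "4 / real (Suc N) < e"
        using N e by (simp add: divide_less_eq mult.commute del: of_nat_Suc)
      moreover have "2 / real (Suc N) + 2 / real (Suc N) = 4 / real (Suc N)" by simp
      ultimately show ?thesis using G_le[of i j] by linarith
    qed
    then show ?thesis by blast
  qed
  obtain g where g: "g \<in> L2 M" "(\<lambda>n. \<integral>x. (norm (grad (\<phi> n) x - g x))\<^sup>2 \<partial>M) \<longlonglongrightarrow> 0"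
    by (rule L2_complete[OF finite_measure_lebesgue_on_set L2(2) G_Cauchy[unfolded G_def]]) blast
  have \<phi>_Cauchy: "\<exists>N. \<forall>i\<ge>N. \<forall>j\<ge>N. (\<integral>x. (norm (\<phi> i x - \<phi> j x))\<^sup>2 \<partial>M) < e" if e: "e > 0" for e
  proof -
    obtain N where N: "\<And>i j. i \<ge> N \<Longrightarrow> j \<ge> N \<Longrightarrow> G i j < \<mu> * e"
      using G_Cauchy[of "\<mu> * e"] e \<mu> by auto
    have "(\<integral>x. (norm (\<phi> i x - \<phi> j x))\<^sup>2 \<partial>M) < e" if "i \<ge> N" "j \<ge> N" for i j
    proof -
      let ?\<psi> = "\<lambda>x. \<phi> i x - \<phi> j x"
      have \<psi>: "?\<psi> \<in> test_functions \<Omega>" by (intro test_diff \<phi>)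
      have "\<mu> * (\<integral>x. (?\<psi> x)\<^sup>2 \<partial>M) \<le> G i j"
        using poincare[OF \<psi>] test_function_lebesgue_on(4,5)[OF \<psi>] by (simp add: G_def grad_diff[OF sm sm])
      also have "\<dots> < \<mu> * e" using N that by blast
      finally show ?thesis using \<mu> by simp
    qed
    then show ?thesis by blast
  qed
  obtain w where w: "w \<in> L2 M" "(\<lambda>n. \<integral>x. (norm (\<phi> n x - w x))\<^sup>2 \<partial>M) \<longlonglongrightarrow> 0"
    by (rule L2_complete[OF finite_measure_lebesgue_on_set L2(1) \<phi>_Cauchy]) blast
  have wg: "is_weak_grad \<Omega> w g" and wH: "w \<in> H10 \<Omega>"
    using H10_limit[OF w(1) g(1) \<phi>(1) w(2) g(2)] by auto
  have "(\<integral>x. weak_grad \<Omega> w x \<bullet> grad \<psi> x \<partial>M) = (\<integral>x. \<psi> x \<partial>M)" if \<psi>: "\<psi> \<in> test_functions \<Omega>" for \<psi>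
  proof -
    define D where "D = (\<integral>x. (norm (grad \<psi> x))\<^sup>2 \<partial>M)"
    define X where "X = (\<integral>x. \<psi> x \<partial>M) - (\<integral>x. g x \<bullet> grad \<psi> x \<partial>M)"
    have s\<psi>: "smooth \<psi>" using test_smooth[OF \<psi>] .
    \<comment> \<open>The variation is carried out on the sequence, where everything is a test
      function, and only then passed to the limit; the energy of w is never formed.\<close>
    have var: "?E (\<phi> n) + 2 * t * ((\<integral>x. \<psi> x \<partial>M) - (\<integral>x. grad (\<phi> n) x \<bullet> grad \<psi> x \<partial>M)) - t\<^sup>2 * D \<le> m" for t n
    proof -
      define \<theta> where "\<theta> x = \<phi> n x - (- t) * \<psi> x" for x
      have \<theta>: "\<theta> \<in> test_functions \<Omega>" unfolding \<theta>_def by (intro test_diff test_cmult \<phi> \<psi>)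
      have "grad \<theta> x = grad (\<phi> n) x - (- t) *\<^sub>R grad \<psi> x" for x
        unfolding \<theta>_def using grad_diff[OF sm smooth_mult[OF smooth_const s\<psi>]] grad_cmult[OF s\<psi>] by metis
      then have "(\<integral>x. (norm (grad \<theta> x))\<^sup>2 \<partial>M) = (\<integral>x. (norm (grad (\<phi> n) x))\<^sup>2 \<partial>M)
          + 2 * t * (\<integral>x. grad (\<phi> n) x \<bullet> grad \<psi> x \<partial>M) + t\<^sup>2 * D"
        using L2_norm_diff_expand[OF L2(2)[of n] test_function_lebesgue_on(2)[OF \<psi>], of "- t"] by (simp add: D_def)
      moreover have "(\<integral>x. \<theta> x \<partial>M) = (\<integral>x. \<phi> n x \<partial>M) + t * (\<integral>x. \<psi> x \<partial>M)"
        unfolding \<theta>_def using L2_imp_integrable[OF L2(1)] L2_imp_integrable[OF test_function_lebesgue_on(1)[OF \<psi>]] by simp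
      ultimately have "?E \<theta> = ?E (\<phi> n) + 2 * t * ((\<integral>x. \<psi> x \<partial>M) - (\<integral>x. grad (\<phi> n) x \<bullet> grad \<psi> x \<partial>M)) - t\<^sup>2 * D"
        using dirichlet_energy_M[OF \<theta>] dirichlet_energy_M[OF \<phi>(1)[of n]] by (simp add: algebra_simps)
      then show ?thesis using E_le[OF \<theta>] by simp
    qed
    have varX: "2 * t * X \<le> t\<^sup>2 * D" for t
    proof -
      have "(\<lambda>n. ?E (\<phi> n) + 2 * t * ((\<integral>x. \<psi> x \<partial>M) - (\<integral>x. grad (\<phi> n) x \<bullet> grad \<psi> x \<partial>M)) - t\<^sup>2 * D)
          \<longlonglongrightarrow> m + 2 * t * X - t\<^sup>2 * D"
        unfolding X_def
        by (intro tendsto_intros E_lim L2_inner_tendsto[OF L2(2) g(1) test_function_lebesgue_on(2)[OF \<psi>] g(2)])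
      then have "m + 2 * t * X - t\<^sup>2 * D \<le> m"
        by (rule LIMSEQ_le_const2) (use var in blast)
      then show ?thesis by simp
    qed
    have D: "D \<ge> 0" by (simp add: D_def)
    have "X = 0"
    proof (rule ccontr)
      assume "X \<noteq> 0"
      then have X2: "X\<^sup>2 > 0" by simp
      \<comment> \<open>With t = X c the quadratic term is at most X^2 c, half of the linear one;
        the summand 1 covers D = 0.\<close>
      define c where "c = 1 / (D + 1)"
      have c: "c > 0" "c * D \<le> 1" using D by (auto simp: c_def)
      have "2 * (X\<^sup>2 * c) = 2 * (X * c) * X" by (simp add: power2_eq_square)
      also have "\<dots> \<le> (X * c)\<^sup>2 * D" by (rule varX)
      also have "\<dots> = X\<^sup>2 * c * (c * D)" by (simp add: power2_eq_square)
      also have "\<dots> \<le> X\<^sup>2 * c * 1" using c by (intro mult_left_mono) auto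
      finally have "X\<^sup>2 * c \<le> 0" by (simp add: mult.commute)
      then show False using mult_pos_pos[OF X2 c(1)] by simp
    qed
    have "(\<integral>x. weak_grad \<Omega> w x \<bullet> grad \<psi> x \<partial>M) = (\<integral>x. g x \<bullet> grad \<psi> x \<partial>M)"
    proof (rule integral_cong_AE)
      show "AE x in M. weak_grad \<Omega> w x \<bullet> grad \<psi> x = g x \<bullet> grad \<psi> x"
        using weak_grad_AE[OF wg] by eventually_elim simp
    qed (intro borel_measurable_inner L2_measurable H10_L2 wH g test_function_lebesgue_on \<psi>)+
    then show ?thesis using \<open>X = 0\<close> by (simp add: X_def)
  qed
  then show ?thesis using wH by (auto simp: is_torsion_function_def)
qed

text \<open>Testing the equation with approximations of w gives \<integral>|grad w|^2 =
  \<integral>w, so the energy of w is \<integral>w; for a test function \<psi> the deficit is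
  \<integral>|grad w - grad \<psi>|^2.\<close>

lemma torsion_function_integral:
  assumes w: "is_torsion_function \<Omega> w"
  shows "\<And>\<phi>. \<phi> \<in> test_functions \<Omega> \<Longrightarrow> dirichlet_energy \<phi> \<le> (\<integral>x. w x \<partial>M)"
    and "\<And>t. t < (\<integral>x. w x \<partial>M) \<Longrightarrow> \<exists>\<phi>\<in>test_functions \<Omega>. t < dirichlet_energy \<phi>"
proof -
  interpret finite_measure M by (rule finite_measure_lebesgue_on_set)
  let ?g = "weak_grad \<Omega> w"
  have wH: "w \<in> H10 \<Omega>" using w by (simp add: is_torsion_function_def)
  have weq: "(\<integral>x. ?g x \<bullet> grad \<phi> x \<partial>M) = (\<integral>x. \<phi> x \<partial>M)" if "\<phi> \<in> test_functions \<Omega>" for \<phi>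
    using w that by (simp add: is_torsion_function_def)
  obtain \<phi> where \<phi>: "\<And>n. \<phi> n \<in> test_functions \<Omega>"
    "(\<lambda>n. \<integral>x. (norm (\<phi> n x - w x))\<^sup>2 \<partial>M) \<longlonglongrightarrow> 0"
    "(\<lambda>n. \<integral>x. (norm (grad (\<phi> n) x - ?g x))\<^sup>2 \<partial>M) \<longlonglongrightarrow> 0"
    using H10_approx[OF wH] by blast
  note L2 = H10_L2[OF wH]
  have "(\<lambda>x. 1 :: real) \<in> L2 M" by (simp add: L2_def)
  from L2_inner_tendsto[OF test_function_lebesgue_on(1)[OF \<phi>(1)] L2(1) this \<phi>(2)]
  have lim1: "(\<lambda>n. \<integral>x. \<phi> n x \<partial>M) \<longlonglongrightarrow> (\<integral>x. w x \<partial>M)" by simp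
  have comm: "(\<integral>x. grad (\<phi> n) x \<bullet> ?g x \<partial>M) = (\<integral>x. \<phi> n x \<partial>M)" for n
    unfolding weq[OF \<phi>(1), symmetric]
    by (rule Bochner_Integration.integral_cong[OF refl]) (rule inner_commute)
  have "(\<lambda>n. \<integral>x. grad (\<phi> n) x \<bullet> ?g x \<partial>M) \<longlonglongrightarrow> (\<integral>x. ?g x \<bullet> ?g x \<partial>M)"
    by (rule L2_inner_tendsto[OF test_function_lebesgue_on(2)[OF \<phi>(1)] L2(2) L2(2) \<phi>(3)])
  then have "(\<lambda>n. \<integral>x. \<phi> n x \<partial>M) \<longlonglongrightarrow> (\<integral>x. (norm (?g x))\<^sup>2 \<partial>M)"
    by (simp add: comm power2_norm_eq_inner)
  with lim1 have T: "(\<integral>x. (norm (?g x))\<^sup>2 \<partial>M) = (\<integral>x. w x \<partial>M)"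
    using LIMSEQ_unique by blast
  have lim2: "(\<lambda>n. \<integral>x. (norm (grad (\<phi> n) x))\<^sup>2 \<partial>M) \<longlonglongrightarrow> (\<integral>x. w x \<partial>M)"
    using L2_norm_tendsto[OF test_function_lebesgue_on(2)[OF \<phi>(1)] L2(2) \<phi>(3)] T by simp
  have "(\<lambda>n. dirichlet_energy (\<phi> n)) \<longlonglongrightarrow> 2 * (\<integral>x. w x \<partial>M) - (\<integral>x. w x \<partial>M)"
    unfolding dirichlet_energy_M[OF \<phi>(1)] by (intro tendsto_intros lim1 lim2)
  then have lim: "(\<lambda>n. dirichlet_energy (\<phi> n)) \<longlonglongrightarrow> (\<integral>x. w x \<partial>M)" by simp
  show "dirichlet_energy \<psi> \<le> (\<integral>x. w x \<partial>M)" if \<psi>: "\<psi> \<in> test_functions \<Omega>" for \<psi>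
  proof -
    have "0 \<le> (\<integral>x. (norm (?g x - 1 *\<^sub>R grad \<psi> x))\<^sup>2 \<partial>M)" by simp
    also have "\<dots> = (\<integral>x. w x \<partial>M) - dirichlet_energy \<psi>"
      unfolding L2_norm_diff_expand[OF L2(2) test_function_lebesgue_on(2)[OF \<psi>]] weq[OF \<psi>] dirichlet_energy_M[OF \<psi>] T by simp
    finally show ?thesis by simp
  qed
  show "\<exists>\<phi>\<in>test_functions \<Omega>. t < dirichlet_energy \<phi>" if "t < (\<integral>x. w x \<partial>M)" for t
    using eventually_happens[OF order_tendstoD(1)[OF lim that]] \<phi>(1) by auto
qed

text \<open>Existence shows that the choice in \<open>torsional_rigidity\<close> yields a torsion
  function. The rigidity is therefore the supremum of the energies, whichever torsion function is
  chosen.\<close>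

lemma torsional_rigidity_characterisation:
  assumes \<mu>: "\<mu> > 0"
    and poincare: "\<And>\<phi>. \<phi> \<in> test_functions \<Omega> \<Longrightarrow> \<mu> * (\<integral>x. (\<phi> x)\<^sup>2 \<partial>lborel) \<le> (\<integral>x. (norm (grad \<phi> x))\<^sup>2 \<partial>lborel)"
  shows "\<And>\<phi>. \<phi> \<in> test_functions \<Omega> \<Longrightarrow> dirichlet_energy \<phi> \<le> torsional_rigidity \<Omega>"
    and "\<And>t. t < torsional_rigidity \<Omega> \<Longrightarrow> \<exists>\<phi>\<in>test_functions \<Omega>. t < dirichlet_energy \<phi>"
proof -
  have w: "is_torsion_function \<Omega> (SOME w. is_torsion_function \<Omega> w)"
    by (rule someI_ex[OF torsion_function_exists[OF \<mu> poincare]])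
  show "\<And>\<phi>. \<phi> \<in> test_functions \<Omega> \<Longrightarrow> dirichlet_energy \<phi> \<le> torsional_rigidity \<Omega>"
    unfolding torsional_rigidity_def using torsion_function_integral(1)[OF w] .
  show "\<And>t. t < torsional_rigidity \<Omega> \<Longrightarrow> \<exists>\<phi>\<in>test_functions \<Omega>. t < dirichlet_energy \<phi>"
    unfolding torsional_rigidity_def using torsion_function_integral(2)[OF w] .
qed

end

section \<open>The volume of a convex set containing a given ball\<close>

text \<open>By Vitali's covering theorem an open set is, up to a null set, a countable disjoint
  union of balls. An orthogonal map sends balls to balls of equal radius and null sets to null
  sets.\<close>

lemma emeasure_orthogonal_image_open:
  fixes f :: "'a::euclidean_space \<Rightarrow> 'a"
  assumes f: "orthogonal_transformation f" and S: "open S"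
  shows "emeasure lebesgue (f ` S) = emeasure lebesgue S"
proof -
  define K where "K = {(a, r). r > 0 \<and> ball a r \<subseteq> S}"
  have cover: "\<exists>i. i \<in> K \<and> x \<in> ball (fst i) (snd i) \<and> snd i < d" if x: "x \<in> S" and d: "0 < d" for x d
  proof -
    obtain e where e: "e > 0" "ball x e \<subseteq> S" using S x open_contains_ball by blast
    then have "(x, min e (d / 2)) \<in> K" using d by (auto simp: K_def)
    then show ?thesis using e d by (intro exI[of _ "(x, min e (d / 2))"]) auto
  qed
  obtain C where C: "countable C" "C \<subseteq> K"
     "pairwise (\<lambda>i j. disjnt (ball (fst i) (snd i)) (ball (fst j) (snd j))) C"
     "negligible (S - (\<Union>i\<in>C. ball (fst i) (snd i)))"
    using Vitali_covering_theorem_balls[of S K fst snd, OF cover] by blast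
  define B where "B i = ball (fst i) (snd i)" for i :: "'a \<times> real"
  define N where "N = S - (\<Union>i\<in>C. B i)"
  have S_eq: "S = (\<Union>i\<in>C. B i) \<union> N"
  proof -
    have "B i \<subseteq> S" if "i \<in> C" for i
      using subsetD[OF C(2) that] by (cases i) (auto simp: B_def K_def)
    then show ?thesis by (auto simp: N_def)
  qed
  have N: "N \<in> null_sets lebesgue" using C(4) by (simp add: N_def B_def negligible_iff_null_sets)
  have inj: "inj f" using orthogonal_transformation_inj[OF f] .
  have fB: "f ` B i = ball (f (fst i)) (snd i)" for i
    unfolding B_def by (rule image_orthogonal_transformation_ball[OF f])
  have disj: "disjoint_family_on B C"
    using C(3) by (auto simp: disjoint_family_on_def pairwise_def disjnt_def B_def)
  have disjf: "disjoint_family_on (\<lambda>i. f ` B i) C"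
    using disj inj by (simp add: disjoint_family_on_def image_Int[symmetric])
  have "negligible (f ` N)"
    using f N by (intro negligible_differentiable_image_negligible)
      (auto simp: negligible_iff_null_sets orthogonal_transformation_linear linear_imp_differentiable_on)
  then have fN: "f ` N \<in> null_sets lebesgue" by (simp add: negligible_iff_null_sets)
  have fS_eq: "f ` S = (\<Union>i\<in>C. f ` B i) \<union> f ` N"
    by (subst S_eq) auto
  have meas: "B i \<in> sets lebesgue" "f ` B i \<in> sets lebesgue" for i
    unfolding fB by (auto simp: B_def)
  have "emeasure lebesgue (f ` S) = emeasure lebesgue (\<Union>i\<in>C. f ` B i)"
    unfolding fS_eq using C(1) meas fN by (intro emeasure_Un_null_set sets.countable_UN') auto
  also have "\<dots> = (\<integral>\<^sup>+i. emeasure lebesgue (f ` B i) \<partial>count_space C)"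
    by (rule emeasure_UN_countable[OF meas(2) C(1) disjf])
  also have "\<dots> = (\<integral>\<^sup>+i. emeasure lebesgue (B i) \<partial>count_space C)"
  proof (intro nn_integral_cong)
    fix i assume "i \<in> space (count_space C)"
    then have "snd i \<ge> 0" using C(2) by (auto simp: K_def)
    then show "emeasure lebesgue (f ` B i) = emeasure lebesgue (B i)"
      unfolding fB by (simp add: B_def emeasure_ball)
  qed
  also have "\<dots> = emeasure lebesgue (\<Union>i\<in>C. B i)"
    by (rule emeasure_UN_countable[OF meas(1) C(1) disj, symmetric])
  also have "\<dots> = emeasure lebesgue ((\<Union>i\<in>C. B i) \<union> N)"
    using C(1) meas N by (intro emeasure_Un_null_set[symmetric] sets.countable_UN') auto
  also note S_eq[symmetric]
  finally show ?thesis .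
qed

text \<open>For a \<noteq> b, the reflection in the hyperplane orthogonal to a - b.\<close>

lemma orthogonal_transformation_exists_unit:
  fixes a b :: "'a::euclidean_space"
  assumes "norm a = 1" "norm b = 1"
  obtains f where "orthogonal_transformation f" "f a = b"
proof (cases "a = b")
  case True
  then show ?thesis using that[of "\<lambda>x. x"] by (simp add: orthogonal_transformation_id)
next
  case False
  define v where "v = a - b"
  define f where "f x = x - (2 * (x \<bullet> v) / (v \<bullet> v)) *\<^sub>R v" for x
  have v: "v \<bullet> v \<noteq> 0" using False by (simp add: v_def)
  have "linear f"
    by (rule linearI) (auto simp: f_def inner_add_left algebra_simps add_divide_distrib)
  moreover have "f x \<bullet> f y = x \<bullet> y" for x y
    using v by (simp add: f_def inner_diff_left inner_diff_right inner_commute field_simps)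
  ultimately have "orthogonal_transformation f" by (simp add: orthogonal_transformation_def)
  moreover have "f a = b"
  proof -
    have ab: "a \<bullet> a = 1" "b \<bullet> b = 1" using assms by (simp_all add: norm_eq_1)
    have "2 * (a \<bullet> v) = v \<bullet> v"
      using ab by (simp add: v_def inner_diff_left inner_diff_right inner_commute)
    then have "f a = a - v" using v by (simp add: f_def)
    then show ?thesis by (simp add: v_def)
  qed
  ultimately show ?thesis by (rule that)
qed

text \<open>Translation invariance of the product measure, checked on product sets, reduces the
  claim to the ball centred at 0. It measures the slices of an oblique cone, whose centres move; A
  is empty in dimension one.\<close>

lemma emeasure_PiM_cball:
  fixes s :: "'i \<Rightarrow> real"
  assumes A: "finite A" and r: "r > 0"
  shows "emeasure (Pi\<^sub>M A (\<lambda>_. lborel))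
             ({f. sqrt (\<Sum>i\<in>A. (f i - s i)\<^sup>2) \<le> r} \<inter> space (Pi\<^sub>M A (\<lambda>_. lborel))) =
           ennreal (unit_ball_vol (real (card A)) * r ^ card A)"
proof -
  interpret product_sigma_finite "\<lambda>_. lborel :: real measure" by standard
  let ?P = "Pi\<^sub>M A (\<lambda>_. lborel :: real measure)"
  define T where "T f = (\<lambda>i\<in>A. s i + f i)" for f :: "'i \<Rightarrow> real"
  have T [measurable]: "T \<in> ?P \<rightarrow>\<^sub>M ?P"
    unfolding T_def by measurable
  have "distr ?P ?P T = ?P"
  proof (rule PiM_eqI)
    fix B :: "'i \<Rightarrow> real set" assume B: "\<And>i. i \<in> A \<Longrightarrow> B i \<in> sets lborel"
    define B' where "B' i = (\<lambda>x. s i + x) -` B i" for i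
    have B': "B' i \<in> sets lborel" if "i \<in> A" for i
      using measurable_sets[of "\<lambda>x. s i + x" lborel lborel "B i"] B[OF that] by (simp add: B'_def)
    have em: "emeasure lborel (B' i) = emeasure lborel (B i)" if "i \<in> A" for i
    proof -
      have "emeasure lborel (B i) = emeasure (distr lborel borel (\<lambda>x. s i + x)) (B i)"
        by (simp add: lborel_distr_plus)
      also have "\<dots> = emeasure lborel (B' i)"
        using B[OF that] by (subst emeasure_distr) (auto simp: B'_def)
      finally show ?thesis ..
    qed
    have "emeasure (distr ?P ?P T) (Pi\<^sub>E A B) = emeasure ?P (T -` Pi\<^sub>E A B \<inter> space ?P)"
      using A B by (intro emeasure_distr T sets_PiM_I_finite) auto
    also have "T -` Pi\<^sub>E A B \<inter> space ?P = Pi\<^sub>E A B'"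
      by (auto simp: T_def B'_def space_PiM PiE_def Pi_def extensional_def)
    also have "emeasure ?P \<dots> = (\<Prod>i\<in>A. emeasure lborel (B' i))"
      by (rule emeasure_PiM[OF A B'])
    also have "\<dots> = (\<Prod>i\<in>A. emeasure lborel (B i))"
      by (rule prod.cong[OF refl em])
    finally show "emeasure (distr ?P ?P T) (Pi\<^sub>E A B) = (\<Prod>i\<in>A. emeasure lborel (B i))" .
  qed (use A in auto)
  then have "emeasure ?P ({f. sqrt (\<Sum>i\<in>A. (f i - s i)\<^sup>2) \<le> r} \<inter> space ?P)
      = emeasure (distr ?P ?P T) ({f. sqrt (\<Sum>i\<in>A. (f i - s i)\<^sup>2) \<le> r} \<inter> space ?P)" by simp
  also have "\<dots> = emeasure ?P (T -` ({f. sqrt (\<Sum>i\<in>A. (f i - s i)\<^sup>2) \<le> r} \<inter> space ?P) \<inter> space ?P)"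
    by (rule emeasure_distr[OF T]) measurable
  also have "T -` ({f. sqrt (\<Sum>i\<in>A. (f i - s i)\<^sup>2) \<le> r} \<inter> space ?P) \<inter> space ?P
      = {f. sqrt (\<Sum>i\<in>A. (f i)\<^sup>2) \<le> r} \<inter> space ?P"
    by (auto simp: T_def space_PiM)
  finally show ?thesis using emeasure_cball_aux[OF A r] by simp
qed

text \<open>An oblique cone with apex \<open>p\<close> over a disc of radius \<open>r\<close> orthogonal to \<open>b\<close>: its slices
  are discs whose centres move along the segment from \<open>c\<close> to \<open>p\<close>.\<close>

lemma cone_volume:
  fixes b :: "'a::euclidean_space"
  assumes b: "b \<in> Basis" and K: "open K" and r: "r > 0" and \<eta>: "(p - c) \<bullet> b \<noteq> 0"
    and cone: "\<And>t v. 0 < t \<Longrightarrow> t < 1 \<Longrightarrow> norm v \<le> r \<Longrightarrow> v \<bullet> b = 0 \<Longrightarrow> t *\<^sub>R p + (1 - t) *\<^sub>R (c + v) \<in> K"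
  shows "ennreal (unit_ball_vol (real (DIM('a) - 1)) * r ^ (DIM('a) - 1) * \<bar>(p - c) \<bullet> b\<bar> / real DIM('a)) \<le> emeasure lborel K"
proof -
  interpret product_sigma_finite "\<lambda>_. lborel :: real measure" by standard
  define A where "A = Basis - {b}"
  define n where "n = DIM('a) - 1"
  have A: "finite A" "b \<notin> A" "insert b A = Basis" "card A = n"
    using b by (auto simp: A_def n_def)
  have dn: "DIM('a) = Suc n" using DIM_positive[where 'a='a] by (simp add: n_def del: DIM_positive)
  define \<omega> where "\<omega> = unit_ball_vol (real n)"
  have \<omega>: "\<omega> \<ge> 0" by (simp add: \<omega>_def)
  define \<gamma> where "\<gamma> = c \<bullet> b"
  define h where "h = (p - c) \<bullet> b"
  have h: "h \<noteq> 0" using \<eta> by (simp add: h_def)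
  let ?PB = "Pi\<^sub>M Basis (\<lambda>_. lborel :: real measure)"
  let ?PA = "Pi\<^sub>M A (\<lambda>_. lborel :: real measure)"
  define E where "E f = (\<Sum>i\<in>Basis. f i *\<^sub>R i :: 'a)" for f :: "'a \<Rightarrow> real"
  have E [measurable]: "E \<in> ?PB \<rightarrow>\<^sub>M borel" unfolding E_def by measurable
  have [measurable]: "K \<in> sets borel" using K by simp
  \<comment> \<open>The volume of the slice at height y. The ratio (y - \<gamma>) / h runs from 0 at
    the base to 1 at the apex, also when h is negative.\<close>
  define L where "L y = ennreal (\<omega> * (r * (1 - (y - \<gamma>) / h)) ^ n) * indicator {0..1} ((y - \<gamma>) / h)" for y
  \<comment> \<open>The heights of base and apex are excluded, because \<open>cone\<close> covers
    only the open interval; they form a null set.\<close>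
  have slice: "L y \<le> (\<integral>\<^sup>+ g. indicator K (E (g(b := y))) \<partial>?PA)"
    if y: "y \<noteq> \<gamma>" "y \<noteq> \<gamma> + h" for y
  proof (cases "0 < (y - \<gamma>) / h \<and> (y - \<gamma>) / h < 1")
    case False
    then have "(y - \<gamma>) / h \<notin> {0..1}" using y h by (auto simp: field_simps)
    then show ?thesis by (simp add: L_def)
  next
    case True
    define t where "t = (y - \<gamma>) / h"
    have t: "0 < t" "t < 1" "y = \<gamma> + t * h" using True h by (auto simp: t_def)
    define s where "s = t *\<^sub>R p + (1 - t) *\<^sub>R c"
    have sb: "s \<bullet> b = y"
      by (simp add: s_def t(3) \<gamma>_def h_def inner_add_left inner_diff_left algebra_simps)
    define D where "D = {f. sqrt (\<Sum>i\<in>A. (f i - s \<bullet> i)\<^sup>2) \<le> r * (1 - t)} \<inter> space ?PA"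
    have "L y = ennreal (\<omega> * (r * (1 - t)) ^ n)" using t h by (simp add: L_def flip: t_def)
    also have "\<dots> = emeasure ?PA D"
      unfolding D_def using emeasure_PiM_cball[OF A(1), of "r * (1 - t)" "\<lambda>i. s \<bullet> i"] r t A(4) by (simp add: \<omega>_def)
    also have "\<dots> = (\<integral>\<^sup>+ g. indicator D g \<partial>?PA)"
      unfolding D_def by (intro nn_integral_indicator[symmetric]) measurable
    also have "\<dots> \<le> (\<integral>\<^sup>+ g. indicator K (E (g(b := y))) \<partial>?PA)"
    proof (intro nn_integral_mono)
      fix g
      show "indicator D g \<le> (indicator K (E (g(b := y))) :: ennreal)"
      proof (cases "g \<in> D")
        case gD: True
        define x where "x = E (g(b := y))"
        have xi: "x \<bullet> i = (if i = b then y else g i)" if "i \<in> Basis" for i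
          unfolding x_def E_def using inner_sum_left_Basis[OF that, of "g(b := y)"] by simp
        \<comment> \<open>Solves x = t p + (1 - t) (c + v); the bounds below place v in the base
          disc.\<close>
        define v where "v = (1 / (1 - t)) *\<^sub>R (x - s)"
        have vb: "v \<bullet> b = 0" using xi[OF b] sb by (simp add: v_def inner_diff_left)
        have "(norm (x - s))\<^sup>2 = (\<Sum>i\<in>Basis. ((x - s) \<bullet> i)\<^sup>2)"
          by (subst power2_norm_eq_inner, subst euclidean_inner) (simp add: power2_eq_square)
        also have "\<dots> = ((x - s) \<bullet> b)\<^sup>2 + (\<Sum>i\<in>A. ((x - s) \<bullet> i)\<^sup>2)"
          unfolding A(3)[symmetric] using A(1,2) by simp
        also have "(x - s) \<bullet> b = 0" using xi[OF b] sb by (simp add: inner_diff_left)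
        also have "(\<Sum>i\<in>A. ((x - s) \<bullet> i)\<^sup>2) = (\<Sum>i\<in>A. (g i - s \<bullet> i)\<^sup>2)"
          by (intro sum.cong) (auto simp: A_def xi inner_diff_left)
        finally have "norm (x - s) = sqrt (\<Sum>i\<in>A. (g i - s \<bullet> i)\<^sup>2)"
          by (metis norm_ge_zero power_zero_numeral add_0 real_sqrt_unique)
        then have "norm (x - s) \<le> r * (1 - t)" using gD by (simp add: D_def)
        then have vr: "norm v \<le> r" 
          unfolding v_def norm_scaleR using t by (simp add: field_simps)
        have "x = t *\<^sub>R p + (1 - t) *\<^sub>R (c + v)"
          using t by (simp add: v_def s_def scaleR_add_right)
        then have "x \<in> K" using cone[OF t(1,2) vr vb] by simp
        then show ?thesis by (simp add: x_def indicator_def)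
      qed simp
    qed
    finally show ?thesis .
  qed
  have "ennreal (\<omega> * r ^ n * \<bar>h\<bar> / real (Suc n)) = ennreal \<bar>h\<bar> * ennreal (\<omega> * r ^ n * (1 / real (Suc n)))"
    using \<omega> r by (simp flip: ennreal_mult' add: mult_ac)
  also have "ennreal (\<omega> * r ^ n * (1 / real (Suc n))) = (\<integral>\<^sup>+ t. ennreal (\<omega> * r ^ n * (1 - t) ^ n) * indicator {0..1} t \<partial>lborel)"
  proof -
    have "(\<integral>\<^sup>+ t. ennreal (\<omega> * r ^ n * (1 - t) ^ n) * indicator {0..1} t \<partial>lborel)
      = ennreal ((- (\<omega> * r ^ n * (1 - 1) ^ Suc n / real (Suc n))) - (- (\<omega> * r ^ n * (1 - 0) ^ Suc n / real (Suc n))))"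
    proof (rule nn_integral_FTC_Icc)
      show "((\<lambda>t. - (\<omega> * r ^ n * (1 - t) ^ Suc n / real (Suc n))) has_real_derivative \<omega> * r ^ n * (1 - t) ^ n) (at t)" for t
        by (auto intro!: derivative_eq_intros simp del: of_nat_Suc power_Suc)
    qed (use \<omega> r in auto)
    then show ?thesis by simp
  qed
  also have "ennreal \<bar>h\<bar> * \<dots> = ennreal \<bar>h\<bar> * (\<integral>\<^sup>+ t. L (\<gamma> + h * t) \<partial>lborel)"
    using h by (simp add: L_def power_mult_distrib mult_ac)
  also have "\<dots> = (\<integral>\<^sup>+ y. L y \<partial>lborel)"
    by (rule nn_integral_real_affine[symmetric]) (use h in \<open>auto simp: L_def\<close>)
  also have "\<dots> \<le> (\<integral>\<^sup>+ y. (\<integral>\<^sup>+ g. indicator K (E (g(b := y))) \<partial>?PA) \<partial>lborel)"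
  proof (rule nn_integral_mono_AE)
    have "AE y in lborel. y \<notin> {\<gamma>, \<gamma> + h}"
      by (intro AE_not_in countable_imp_null_set_lborel) auto
    then show "AE y in lborel. L y \<le> (\<integral>\<^sup>+ g. indicator K (E (g(b := y))) \<partial>?PA)"
      by eventually_elim (auto intro: slice)
  qed
  also have "\<dots> = (\<integral>\<^sup>+ f. indicator K (E f) \<partial>Pi\<^sub>M (insert b A) (\<lambda>_. lborel))"
    using A(1,2) by (intro product_nn_integral_insert_rev[symmetric]) (auto simp: A(3))
  also have "\<dots> = (\<integral>\<^sup>+ x. indicator K x \<partial>distr ?PB borel E)"
    unfolding A(3) by (rule nn_integral_distr[symmetric]) measurable
  also have "distr ?PB borel E = lborel"
    unfolding E_def by (rule lborel_eq[symmetric])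
  also have "(\<integral>\<^sup>+ x. indicator K x \<partial>lborel) = emeasure lborel K" by simp
  finally show ?thesis by (simp add: dn \<omega>_def h_def)
qed

text \<open>The hyperplane through c orthogonal to b separates the two endpoints of the diameter.
  Each endpoint is the apex of a cone over the disc about c, and the two heights add up to D. The
  centre c need not lie on the segment between the endpoints.\<close>

lemma convex_volume_bound_aligned:
  fixes K :: "'a::euclidean_space set"
  assumes K: "open K" "convex K" "bounded K" and b: "b \<in> Basis" and r: "r > 0" and c: "cball c r \<subseteq> K"
    and x: "x1 \<in> closure K" "x2 \<in> closure K" "x2 - x1 = D *\<^sub>R b" "D = diameter K" "D > 0"
  shows "unit_ball_vol (real (DIM('a) - 1)) * r ^ (DIM('a) - 1) * D / real DIM('a) \<le> measure lebesgue K"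
proof -
  define \<gamma> where "\<gamma> = c \<bullet> b"
  have bb: "b \<bullet> b = 1" using b by simp
  have D_le: "dist y z \<le> D" if "y \<in> closure K" "z \<in> K" for y z
    using diameter_bounded_bound[of "closure K" y z] that K(3) closure_subset
    by (auto simp: x(4) diameter_closure bounded_closure)
  \<comment> \<open>The point c + r b is at distance at most D from x1, so its height does not
    exceed that of x2; since r > 0 the centre is strictly lower.\<close>
  have up: "\<gamma> < x2 \<bullet> b"
  proof -
    have "c + r *\<^sub>R b \<in> K" using c r b by (auto simp: dist_norm)
    from D_le[OF x(1) this] have "norm (c + r *\<^sub>R b - x1) \<le> D"
      unfolding dist_norm by (subst norm_minus_commute)
    then have "(c + r *\<^sub>R b - x1) \<bullet> b \<le> D" using Basis_le_norm[OF b, of "c + r *\<^sub>R b - x1"] by linarith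
    moreover have "(x2 - x1) \<bullet> b = D" using x(3) bb by simp
    ultimately show ?thesis using r bb by (simp add: \<gamma>_def inner_diff_left inner_add_left)
  qed
  have lo: "x1 \<bullet> b < \<gamma>"
  proof -
    have "c - r *\<^sub>R b \<in> K" using c r b by (auto simp: dist_norm)
    from D_le[OF x(2) this] have "norm (c - r *\<^sub>R b - x2) \<le> D"
      unfolding dist_norm by (subst norm_minus_commute)
    then have "- ((c - r *\<^sub>R b - x2) \<bullet> b) \<le> D" using Basis_le_norm[OF b, of "c - r *\<^sub>R b - x2"] by linarith
    moreover have "(x2 - x1) \<bullet> b = D" using x(3) bb by simp
    ultimately show ?thesis using r bb by (simp add: \<gamma>_def inner_diff_left inner_add_left)
  qed
  have shrink: "t *\<^sub>R p + (1 - t) *\<^sub>R (c + v) \<in> K"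
    if "p \<in> closure K" "0 < t" "t < 1" "norm v \<le> r" for p t v
  proof -
    have "c + v \<in> interior K" using c that K(1) by (auto simp: interior_open dist_norm)
    then have "p - (1 - t) *\<^sub>R (p - (c + v)) \<in> interior K"
      using mem_interior_closure_convex_shrink[OF K(2), of "c + v" p "1 - t"] that by auto
    moreover have "p - (1 - t) *\<^sub>R (p - (c + v)) = t *\<^sub>R p + (1 - t) *\<^sub>R (c + v)"
      by (simp add: algebra_simps)
    ultimately show ?thesis using K(1) by (simp add: interior_open)
  qed
  define K1 where "K1 = K \<inter> {x. x \<bullet> b < \<gamma>}"
  define K2 where "K2 = K \<inter> {x. \<gamma> < x \<bullet> b}"
  have op: "open K1" "open K2"
    unfolding K1_def K2_def using K(1) by (auto intro!: open_Int open_Collect_less continuous_intros)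
  let ?w = "unit_ball_vol (real (DIM('a) - 1)) * r ^ (DIM('a) - 1)"
  have w: "?w \<ge> 0" using r by simp
  have "ennreal (?w * \<bar>(x1 - c) \<bullet> b\<bar> / real DIM('a)) \<le> emeasure lborel K1"
  proof (rule cone_volume[OF b op(1) r])
    show "t *\<^sub>R x1 + (1 - t) *\<^sub>R (c + v) \<in> K1" if "0 < t" "t < 1" "norm v \<le> r" "v \<bullet> b = 0" for t v
    proof -
      have "t * (x1 \<bullet> b) + (1 - t) * \<gamma> < \<gamma>"
        using mult_strict_left_mono[OF lo that(1)] by (simp add: algebra_simps)
      then show ?thesis using shrink[OF x(1) that(1-3)] that(4)
        by (simp add: K1_def inner_add_left \<gamma>_def)
    qed
  qed (use lo in \<open>simp add: \<gamma>_def inner_diff_left\<close>)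
  moreover have "ennreal (?w * \<bar>(x2 - c) \<bullet> b\<bar> / real DIM('a)) \<le> emeasure lborel K2"
  proof (rule cone_volume[OF b op(2) r])
    show "t *\<^sub>R x2 + (1 - t) *\<^sub>R (c + v) \<in> K2" if "0 < t" "t < 1" "norm v \<le> r" "v \<bullet> b = 0" for t v
    proof -
      have "\<gamma> < t * (x2 \<bullet> b) + (1 - t) * \<gamma>"
        using mult_strict_left_mono[OF up that(1)] by (simp add: algebra_simps)
      then show ?thesis using shrink[OF x(2) that(1-3)] that(4)
        by (simp add: K2_def inner_add_left \<gamma>_def)
    qed
  qed (use up in \<open>simp add: \<gamma>_def inner_diff_left\<close>)
  ultimately have "ennreal (?w * \<bar>(x1 - c) \<bullet> b\<bar> / real DIM('a)) + ennreal (?w * \<bar>(x2 - c) \<bullet> b\<bar> / real DIM('a))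
      \<le> emeasure lborel K1 + emeasure lborel K2"
    by (rule add_mono)
  also have "\<dots> = emeasure lborel (K1 \<union> K2)"
    by (rule plus_emeasure) (use op in \<open>auto simp: K1_def K2_def\<close>)
  also have "\<dots> \<le> emeasure lborel K"
    by (rule emeasure_mono) (use K(1) in \<open>auto simp: K1_def K2_def\<close>)
  also have "\<dots> = ennreal (measure lebesgue K)"
    using K emeasure_bounded_finite[OF K(3)] by (simp add: emeasure_eq_ennreal_measure)
  finally have "ennreal (?w * \<bar>(x1 - c) \<bullet> b\<bar> / real DIM('a) + ?w * \<bar>(x2 - c) \<bullet> b\<bar> / real DIM('a)) \<le> ennreal (measure lebesgue K)"
    using w by simp
  then have "?w * \<bar>(x1 - c) \<bullet> b\<bar> / real DIM('a) + ?w * \<bar>(x2 - c) \<bullet> b\<bar> / real DIM('a) \<le> measure lebesgue K"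
    by (subst (asm) ennreal_le_iff) auto
  moreover have "\<bar>(x1 - c) \<bullet> b\<bar> + \<bar>(x2 - c) \<bullet> b\<bar> = D"
  proof -
    have "(x2 - x1) \<bullet> b = D" using x(3) bb by simp
    then show ?thesis using lo up by (simp add: \<gamma>_def inner_diff_left)
  qed
  ultimately show ?thesis
    by (metis add_divide_distrib distrib_left)
qed

text \<open>The diameter is attained on the compact closure; rotating it onto a coordinate axis
  makes the slices accessible to Fubini's theorem. Diameter and volume are invariant under
  orthogonal maps.\<close>

theorem convex_volume_bound:
  fixes K :: "'a::euclidean_space set"
  assumes K: "open K" "convex K" "bounded K" and r: "r > 0" and c: "cball c r \<subseteq> K"
  shows "unit_ball_vol (real (DIM('a) - 1)) * r ^ (DIM('a) - 1) * diameter K / real DIM('a) \<le> measure lebesgue K"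
proof -
  have ne: "closure K \<noteq> {}" using c r closure_subset[of K] by fastforce
  have "compact (closure K)" using K(3) by (simp add: compact_closure)
  then obtain x1 x2 where x: "x1 \<in> closure K" "x2 \<in> closure K" "dist x1 x2 = diameter K"
    using diameter_compact_attained[OF _ ne] diameter_closure[OF K(3)] by metis
  define D where "D = diameter K"
  have D: "D > 0"
  proof -
    obtain b :: 'a where b: "b \<in> Basis" using nonempty_Basis by blast
    have "c \<in> K" "c + r *\<^sub>R b \<in> K" using c r b by (auto simp: dist_norm)
    then have "dist c (c + r *\<^sub>R b) \<le> D" unfolding D_def by (intro diameter_bounded_bound K)
    then show ?thesis using r b by (simp add: dist_norm)
  qed
  obtain b :: 'a where b: "b \<in> Basis" using nonempty_Basis by blast
  define e where "e = (1 / D) *\<^sub>R (x2 - x1)"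
  have nx: "norm (x2 - x1) = D" using x(3) by (simp add: D_def dist_norm norm_minus_commute)
  then have "norm e = 1" using D by (simp add: e_def)
  then obtain f where f: "orthogonal_transformation f" "f e = b"
    using orthogonal_transformation_exists_unit[of e b] b by auto
  have lin: "linear f" using f orthogonal_transformation_linear by blast
  have fdist: "dist (f x) (f y) = dist x y" for x y
    using f(1) by (metis orthogonal_transformation_isometry)
  have "unit_ball_vol (real (DIM('a) - 1)) * r ^ (DIM('a) - 1) * D / real DIM('a) \<le> measure lebesgue (f ` K)"
  proof (rule convex_volume_bound_aligned[OF _ _ _ b r])
    show "open (f ` K)"
      using K(1) lin f(1) by (simp add: open_surjective_linear_image orthogonal_transformation_surj)
    show "convex (f ` K)" using K(2) lin by (rule convex_linear_image[rotated])
    show "bounded (f ` K)" using K(3) lin by (simp add: bounded_linear_image linear_conv_bounded_linear)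
    show "cball (f c) r \<subseteq> f ` K"
      using image_mono[OF c, of f] image_orthogonal_transformation_cball[OF f(1), of c r] by simp
    have cl: "closure (f ` K) = f ` closure K"
      using closure_injective_linear_image[OF lin orthogonal_transformation_inj[OF f(1)]] by simp
    show "f x1 \<in> closure (f ` K)" "f x2 \<in> closure (f ` K)" using x by (auto simp: cl)
    have "x2 - x1 = D *\<^sub>R e" using D by (simp add: e_def)
    then show "f x2 - f x1 = D *\<^sub>R b"
      using f(2) lin by (metis linear_diff linear_scale)
    show "D = diameter (f ` K)"
      unfolding D_def diameter_def map_prod_image[symmetric]
      by (simp add: image_image case_prod_unfold fdist)
    show "D > 0" by (rule D)
  qed
  also have "measure lebesgue (f ` K) = measure lebesgue K"
    by (simp add: measure_def emeasure_orthogonal_image_open[OF f(1) K(1)])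
  finally show ?thesis by (simp add: D_def)
qed

section \<open>Comparison under similarities\<close>

lemma integral_affine:
  fixes f :: "'a::euclidean_space \<Rightarrow> real"
  assumes "f \<in> borel_measurable borel" "t > 0"
  shows "(\<integral>x. f x \<partial>lborel) = t ^ DIM('a) * (\<integral>x. f (a + t *\<^sub>R x) \<partial>lborel)"
proof -
  note [measurable] = assms(1)
  have "(\<integral>x. f x \<partial>lborel) = (\<integral>x. f x \<partial>density (distr lborel borel (\<lambda>x. a + t *\<^sub>R x)) (\<lambda>_. ennreal (\<bar>t\<bar> ^ DIM('a))))"
    using lborel_affine[of t a] assms(2) by simp
  also have "\<dots> = (\<integral>x. \<bar>t\<bar> ^ DIM('a) *\<^sub>R f x \<partial>distr lborel borel (\<lambda>x. a + t *\<^sub>R x))"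
    by (rule integral_density) auto
  also have "\<dots> = (\<integral>x. \<bar>t\<bar> ^ DIM('a) *\<^sub>R f (a + t *\<^sub>R x) \<partial>lborel)"
    by (rule integral_distr) measurable
  finally show ?thesis using assms(2) by simp
qed

text \<open>Take \<psi> y = \<phi> ((y - a) / t). The gradient integral scales with t^(d - 2);
  multiplying by t^2 avoids a negative exponent in dimension one.\<close>

lemma test_transport:
  fixes \<phi> :: "'a::euclidean_space \<Rightarrow> real"
  assumes \<phi>: "\<phi> \<in> test_functions \<Omega>" and t: "t > 0" and sub: "(\<lambda>x. a + t *\<^sub>R x) ` \<Omega> \<subseteq> \<Omega>'"
  obtains \<psi> where "\<psi> \<in> test_functions \<Omega>'"
    "(\<integral>x. \<psi> x \<partial>lborel) = t ^ DIM('a) * (\<integral>x. \<phi> x \<partial>lborel)"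
    "(\<integral>x. (\<psi> x)\<^sup>2 \<partial>lborel) = t ^ DIM('a) * (\<integral>x. (\<phi> x)\<^sup>2 \<partial>lborel)"
    "t\<^sup>2 * (\<integral>x. (norm (grad \<psi> x))\<^sup>2 \<partial>lborel) = t ^ DIM('a) * (\<integral>x. (norm (grad \<phi> x))\<^sup>2 \<partial>lborel)"
proof
  define \<psi> where "\<psi> y = \<phi> ((- (1 / t)) *\<^sub>R a + (1 / t) *\<^sub>R y)" for y
  have undo: "(- (1 / t)) *\<^sub>R a + (1 / t) *\<^sub>R (a + t *\<^sub>R x) = x" for x
    using t by (simp add: scaleR_add_right)
  have "(\<lambda>y. (- (1 / t)) *\<^sub>R a + (1 / t) *\<^sub>R y) ` ((\<lambda>x. a + t *\<^sub>R x) ` \<Omega>) = \<Omega>"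
    unfolding image_image undo by simp
  then have "\<psi> \<in> test_functions ((\<lambda>x. a + t *\<^sub>R x) ` \<Omega>)"
    unfolding \<psi>_def[abs_def] using \<phi> t by (intro test_affine) auto
  then show \<psi>: "\<psi> \<in> test_functions \<Omega>'" using test_functions_mono[OF sub] by blast
  have sm: "smooth \<phi>" "smooth \<psi>" using test_smooth \<phi> \<psi> by auto
  note [measurable] = smooth_measurable[OF sm(1)] smooth_measurable[OF sm(2)]
  have \<psi>x: "\<psi> (a + t *\<^sub>R x) = \<phi> x" for x unfolding \<psi>_def undo ..
  have g: "grad \<psi> (a + t *\<^sub>R x) = (1 / t) *\<^sub>R grad \<phi> x" for x
    unfolding \<psi>_def[abs_def] grad_affine[OF sm(1)] undo ..
  show "(\<integral>x. \<psi> x \<partial>lborel) = t ^ DIM('a) * (\<integral>x. \<phi> x \<partial>lborel)"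
    by (subst integral_affine[OF _ t, of _ a]) (simp_all add: \<psi>x)
  show "(\<integral>x. (\<psi> x)\<^sup>2 \<partial>lborel) = t ^ DIM('a) * (\<integral>x. (\<phi> x)\<^sup>2 \<partial>lborel)"
    by (subst integral_affine[OF _ t, of _ a]) (simp_all add: \<psi>x)
  have "(\<integral>x. (norm (grad \<psi> x))\<^sup>2 \<partial>lborel) = t ^ DIM('a) * (\<integral>x. (1 / t)\<^sup>2 * (norm (grad \<phi> x))\<^sup>2 \<partial>lborel)"
    by (subst integral_affine[OF _ t, of _ a]) (simp_all add: g power_divide)
  then show "t\<^sup>2 * (\<integral>x. (norm (grad \<psi> x))\<^sup>2 \<partial>lborel) = t ^ DIM('a) * (\<integral>x. (norm (grad \<phi> x))\<^sup>2 \<partial>lborel)"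
    using t by (simp add: power_divide)
qed

section \<open>Inequalities for a single convex body\<close>

locale convex_body = bounded_open_set \<Omega> for \<Omega> :: "'a::euclidean_space set" +
  assumes convex_set: "convex \<Omega>" and nonempty_set: "\<Omega> \<noteq> {}"

lemma convex_body_iff: "convex_body \<Omega> \<longleftrightarrow> \<Omega> \<noteq> {} \<and> open \<Omega> \<and> bounded \<Omega> \<and> convex \<Omega>"
  by (auto simp: convex_body_def bounded_open_set_def convex_body_axioms_def)

lemma convex_body_ball: "r > 0 \<Longrightarrow> convex_body (ball a r)"
  by (simp add: convex_body_iff)

context convex_body
begin

lemma inradius_positive: "0 < inradius \<Omega>"
  using inradius_pos open_set bounded_set nonempty_set by blast

lemma eigenvalue_inradius: "(pi / (2 * inradius \<Omega>))\<^sup>2 \<le> first_eigenvalue \<Omega>"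
  using hersch_protter[OF open_set bounded_set convex_set nonempty_set]
  by (intro first_eigenvalue_ge nonempty_set)

lemma eigenvalue_pos: "0 < first_eigenvalue \<Omega>"
  using eigenvalue_inradius inradius_positive by (auto intro: less_le_trans[rotated])

lemma energy_le_torsion: "\<phi> \<in> test_functions \<Omega> \<Longrightarrow> dirichlet_energy \<phi> \<le> torsional_rigidity \<Omega>"
  using torsional_rigidity_characterisation(1)[OF eigenvalue_pos first_eigenvalue_le] by blast

lemma torsion_le:
  assumes "\<And>\<phi>. \<phi> \<in> test_functions \<Omega> \<Longrightarrow> dirichlet_energy \<phi> \<le> C"
  shows "torsional_rigidity \<Omega> \<le> C"
proof (rule ccontr)
  assume "\<not> ?thesis"
  then obtain \<phi> where "\<phi> \<in> test_functions \<Omega>" "C < dirichlet_energy \<phi>"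
    using torsional_rigidity_characterisation(2)[OF eigenvalue_pos first_eigenvalue_le, of C] by auto
  then show False using assms by fastforce
qed

lemma torsion_nonneg: "0 \<le> torsional_rigidity \<Omega>"
proof -
  have "grad (\<lambda>x::'a. 0 :: real) x = 0" for x
    by (rule grad_zero_open[of UNIV]) auto
  then have "dirichlet_energy (\<lambda>x::'a. 0) = 0" by (simp add: dirichlet_energy_def)
  then show ?thesis using energy_le_torsion[OF test_zero] by simp
qed

lemma polya_inequality: "first_eigenvalue \<Omega> * torsional_rigidity \<Omega> \<le> measure lebesgue \<Omega>"
proof -
  have "torsional_rigidity \<Omega> \<le> measure lebesgue \<Omega> / first_eigenvalue \<Omega>"
    by (intro torsion_le dirichlet_energy_bound eigenvalue_pos first_eigenvalue_le)
  then show ?thesis using eigenvalue_pos by (simp add: pos_le_divide_eq mult.commute)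
qed

lemma measure_pos: "0 < measure lebesgue \<Omega>"
  using open_not_negligible[OF open_set nonempty_set] set_lmeasurable
  by (metis measure_nonneg negligible_iff_measure order_le_less)

text \<open>The strict inequality picks a centre whose distance to the frontier exceeds s; a closed
  ball about it that left \<Omega> would meet the frontier, being connected.\<close>

lemma cball_in_set:
  assumes "0 < s" "s < inradius \<Omega>"
  obtains c where "c \<in> \<Omega>" "cball c s \<subseteq> \<Omega>"
proof -
  obtain c where c: "c \<in> \<Omega>" "s < infdist c (frontier \<Omega>)"
    using less_cSupD[of "(\<lambda>x. infdist x (frontier \<Omega>)) ` \<Omega>" s] assms(2) nonempty_set
    by (auto simp: inradius_def)
  have "cball c s \<subseteq> \<Omega>"
  proof (rule ccontr)
    assume "\<not> cball c s \<subseteq> \<Omega>"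
    then have "cball c s \<inter> frontier \<Omega> \<noteq> {}"
    proof (intro connected_Int_frontier)
      show "cball c s \<inter> \<Omega> \<noteq> {}" using c(1) assms(1) by (auto intro!: exI[of _ c] simp: disjoint_iff)
    qed auto
    then obtain y where "y \<in> frontier \<Omega>" "dist c y \<le> s" by auto
    then show False using c(2) infdist_le[of y "frontier \<Omega>" c] by simp
  qed
  with c(1) show ?thesis by (rule that)
qed

lemma diameter_pos: "0 < diameter \<Omega>"
proof -
  obtain c where c: "c \<in> \<Omega>" "cball c (inradius \<Omega> / 2) \<subseteq> \<Omega>"
    using cball_in_set[of "inradius \<Omega> / 2"] inradius_positive by auto
  obtain b :: 'a where b: "b \<in> Basis" using nonempty_Basis by blast
  have "c + (inradius \<Omega> / 2) *\<^sub>R b \<in> \<Omega>" using c(2) inradius_positive b by (auto simp: dist_norm)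
  then have "dist c (c + (inradius \<Omega> / 2) *\<^sub>R b) \<le> diameter \<Omega>"
    by (intro diameter_bounded_bound bounded_set c)
  then show ?thesis using inradius_positive b by (simp add: dist_norm)
qed

text \<open>The volume bound for inscribed balls of radius s, as s tends to the inradius from the
  left.\<close>

lemma volume_diameter_inradius:
  "unit_ball_vol (real (DIM('a) - 1)) * inradius \<Omega> ^ (DIM('a) - 1) * diameter \<Omega> / real DIM('a) \<le> measure lebesgue \<Omega>"
proof -
  define n where "n = DIM('a) - 1"
  let ?w = "unit_ball_vol (real n)"
  let ?f = "\<lambda>s. ?w * s ^ n * diameter \<Omega> / real DIM('a)"
  have le: "?f s \<le> measure lebesgue \<Omega>" if s: "0 < s" "s < inradius \<Omega>" for s
  proof -
    obtain c where "cball c s \<subseteq> \<Omega>" using cball_in_set[OF s] by blast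
    then show ?thesis
      unfolding n_def using convex_volume_bound[OF open_set convex_set bounded_set s(1)] by blast
  qed
  have "(?f \<longlongrightarrow> ?f (inradius \<Omega>)) (at_left (inradius \<Omega>))"
    by (intro tendsto_intros) simp
  moreover have "\<forall>\<^sub>F s in at_left (inradius \<Omega>). ?f s \<le> measure lebesgue \<Omega>"
    using eventually_at_left_real[OF inradius_positive] by eventually_elim (use le in auto)
  ultimately have "?f (inradius \<Omega>) \<le> measure lebesgue \<Omega>"
    by (rule tendsto_upperbound) simp
  then show ?thesis by (simp add: n_def)
qed

text \<open>Serves to bound the functional uniformly over all bodies, so that its supremum is
  finite.\<close>

lemma volume_inradius: "unit_ball_vol (real DIM('a)) * inradius \<Omega> ^ DIM('a) \<le> measure lebesgue \<Omega>"
proof -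
  let ?f = "\<lambda>s. unit_ball_vol (real DIM('a)) * s ^ DIM('a)"
  have le: "?f s \<le> measure lebesgue \<Omega>" if s: "0 < s" "s < inradius \<Omega>" for s
  proof -
    obtain c where c: "cball c s \<subseteq> \<Omega>" using cball_in_set[OF s] by blast
    have "measure lebesgue (cball c s) \<le> measure lebesgue \<Omega>"
      using c set_lmeasurable by (intro measure_mono_fmeasurable) auto
    then show ?thesis using s by (simp add: content_cball)
  qed
  have "(?f \<longlongrightarrow> ?f (inradius \<Omega>)) (at_left (inradius \<Omega>))"
    by (intro tendsto_intros)
  moreover have "\<forall>\<^sub>F s in at_left (inradius \<Omega>). ?f s \<le> measure lebesgue \<Omega>"
    using eventually_at_left_real[OF inradius_positive] by eventually_elim (use le in auto)
  ultimately show ?thesis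
    by (rule tendsto_upperbound) simp
qed

lemma shape_functional_le:
  assumes q: "q > 1"
  defines "d \<equiv> real DIM('a)"
  shows "shape_functional q \<Omega> \<le>
    ((2 * inradius \<Omega> / pi) ^ DIM('a) / measure lebesgue \<Omega>) powr (2 * (q - 1) / d)"
proof -
  define A where "A = measure lebesgue \<Omega>"
  define T where "T = torsional_rigidity \<Omega>"
  define p where "p = 2 * (q - 1) / d"
  define x where "x = 2 * inradius \<Omega> / pi"
  have d: "d \<ge> 1" using DIM_positive[where 'a='a] unfolding d_def by linarith
  have A: "A > 0" using measure_pos by (simp add: A_def)
  have x: "x > 0" using inradius_positive by (simp add: x_def)
  have T0: "T \<ge> 0" using torsion_nonneg by (simp add: T_def)
  have "(pi / (2 * inradius \<Omega>))\<^sup>2 * T \<le> first_eigenvalue \<Omega> * T"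
    using eigenvalue_inradius T0 by (rule mult_right_mono)
  also have "\<dots> \<le> A" using polya_inequality by (simp add: T_def A_def)
  finally have "x\<^sup>2 * ((pi / (2 * inradius \<Omega>))\<^sup>2 * T) \<le> x\<^sup>2 * A"
    by (rule mult_left_mono) simp
  moreover have cx: "(pi / (2 * inradius \<Omega>))\<^sup>2 * x\<^sup>2 = 1"
    using inradius_positive by (simp add: x_def field_simps flip: power_mult_distrib)
  moreover have "x\<^sup>2 * ((pi / (2 * inradius \<Omega>))\<^sup>2 * T) = ((pi / (2 * inradius \<Omega>))\<^sup>2 * x\<^sup>2) * T" by simp
  ultimately have T: "T \<le> A * x\<^sup>2" by (simp only: cx mult_1 mult.commute)
  have "T powr q = T * T powr (q - 1)"
    using powr_mult_base[OF T0, of "q - 1"] by simp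
  then have "first_eigenvalue \<Omega> * T powr q = (first_eigenvalue \<Omega> * T) * T powr (q - 1)" by simp
  also have "\<dots> \<le> A * (A * x\<^sup>2) powr (q - 1)"
    using polya_inequality T T0 q A by (intro mult_mono powr_mono2) (auto simp: T_def A_def)
  also have "\<dots> = A * A powr (q - 1) * x powr (2 * (q - 1))"
    using A x by (simp add: powr_mult powr_powr flip: powr_numeral)
  finally have num: "first_eigenvalue \<Omega> * T powr q \<le> A powr q * x powr (2 * (q - 1))"
    using powr_mult_base[of A "q - 1"] A by simp
  \<comment> \<open>The exponent of the volume is q + p: the factor A^q cancels against the
    numerator, and p is the outer exponent of the bound.\<close>
  have ex: "(d * q + 2 * q - 2) / d = q + p" using d by (simp add: p_def field_simps)
  have "shape_functional q \<Omega> = first_eigenvalue \<Omega> * T powr q / A powr (q + p)"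
    by (simp add: shape_functional_def T_def A_def ex[symmetric] d_def)
  also have "\<dots> \<le> A powr q * x powr (2 * (q - 1)) / A powr (q + p)"
    using num by (rule divide_right_mono) simp
  also have "\<dots> = x powr (2 * (q - 1)) / A powr p"
    using A by (simp add: powr_add)
  also have "x powr (2 * (q - 1)) = (x ^ DIM('a)) powr p"
  proof -
    have "(x ^ DIM('a)) powr p = x powr (d * p)"
      using x by (simp add: d_def powr_powr flip: powr_realpow)
    also have "d * p = 2 * (q - 1)" using d by (simp add: p_def)
    finally show ?thesis by simp
  qed
  also have "(x ^ DIM('a)) powr p / A powr p = (x ^ DIM('a) / A) powr p"
    using A x by (simp add: powr_divide)
  finally show ?thesis by (simp add: x_def A_def p_def)
qed

end

text \<open>Placing a copy of \<Omega> in \<Omega>' bounds the new eigenvalue from above and the new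
  volume from below; placing a copy of \<Omega>' in \<Omega> bounds the new torsion from above. The
  powers of t combine to - 2 - (dq + 2q - 2) = - (d + 2) q, the same as for t'. So t t' = 1 gives
  invariance under similarities, and t t' near 1 gives semicontinuity.\<close>

lemma shape_functional_comparison:
  fixes \<Omega> \<Omega>' :: "'a::euclidean_space set"
  assumes bodies: "convex_body \<Omega>" "convex_body \<Omega>'" and q: "q > 1"
    and t: "t > 0" "(\<lambda>x. a + t *\<^sub>R x) ` \<Omega> \<subseteq> \<Omega>'"
    and t': "t' > 0" "(\<lambda>x. a' + t' *\<^sub>R x) ` \<Omega>' \<subseteq> \<Omega>"
  shows "shape_functional q \<Omega>' \<le> (t * t') powr (- (real DIM('a) + 2) * q) * shape_functional q \<Omega>"
proof -
  interpret \<Omega>: convex_body \<Omega> by fact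
  interpret \<Omega>': convex_body \<Omega>' by fact
  define d where "d = real DIM('a)"
  define l where "l = first_eigenvalue \<Omega>"
  define l' where "l' = first_eigenvalue \<Omega>'"
  define T where "T = torsional_rigidity \<Omega>"
  define T' where "T' = torsional_rigidity \<Omega>'"
  define A where "A = measure lebesgue \<Omega>"
  define A' where "A' = measure lebesgue \<Omega>'"
  have d: "d \<ge> 1" using DIM_positive[where 'a='a] unfolding d_def by linarith
  have pos: "A > 0" "A' > 0" "l > 0" "l' > 0" "T \<ge> 0" "T' \<ge> 0"
    using \<Omega>.measure_pos \<Omega>'.measure_pos \<Omega>.eigenvalue_pos \<Omega>'.eigenvalue_pos \<Omega>.torsion_nonneg \<Omega>'.torsion_nonneg
    by (auto simp: A_def A'_def l_def l'_def T_def T'_def)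
  have "t\<^sup>2 * l' \<le> l"
    unfolding l_def
  proof (rule \<Omega>.first_eigenvalue_ge[OF \<Omega>.nonempty_set])
    fix \<phi> assume "\<phi> \<in> test_functions \<Omega>"
    then obtain \<psi> where \<psi>: "\<psi> \<in> test_functions \<Omega>'"
      "(\<integral>x. (\<psi> x)\<^sup>2 \<partial>lborel) = t ^ DIM('a) * (\<integral>x. (\<phi> x)\<^sup>2 \<partial>lborel)"
      "t\<^sup>2 * (\<integral>x. (norm (grad \<psi> x))\<^sup>2 \<partial>lborel) = t ^ DIM('a) * (\<integral>x. (norm (grad \<phi> x))\<^sup>2 \<partial>lborel)"
      using test_transport t by metis
    have "t\<^sup>2 * (l' * (\<integral>x. (\<psi> x)\<^sup>2 \<partial>lborel)) \<le> t\<^sup>2 * (\<integral>x. (norm (grad \<psi> x))\<^sup>2 \<partial>lborel)"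
      using \<Omega>'.first_eigenvalue_le[OF \<psi>(1)] by (intro mult_left_mono) (auto simp: l'_def)
    then have "t ^ DIM('a) * (t\<^sup>2 * l' * (\<integral>x. (\<phi> x)\<^sup>2 \<partial>lborel)) \<le> t ^ DIM('a) * (\<integral>x. (norm (grad \<phi> x))\<^sup>2 \<partial>lborel)"
      unfolding \<psi>(2,3) by (simp add: mult_ac)
    then show "t\<^sup>2 * l' * (\<integral>x. (\<phi> x)\<^sup>2 \<partial>lborel) \<le> (\<integral>x. (norm (grad \<phi> x))\<^sup>2 \<partial>lborel)"
      using t(1) by simp
  qed
  then have l: "l' \<le> t powr (- 2) * l"
    using t(1) by (simp add: powr_minus field_simps flip: powr_numeral)
  have "T' \<le> T / t' ^ (DIM('a) + 2)"
    unfolding T'_def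
  proof (rule \<Omega>'.torsion_le)
    fix \<phi> assume "\<phi> \<in> test_functions \<Omega>'"
    then obtain \<psi> where \<psi>: "\<psi> \<in> test_functions \<Omega>"
      "(\<integral>x. \<psi> x \<partial>lborel) = t' ^ DIM('a) * (\<integral>x. \<phi> x \<partial>lborel)"
      "t'\<^sup>2 * (\<integral>x. (norm (grad \<psi> x))\<^sup>2 \<partial>lborel) = t' ^ DIM('a) * (\<integral>x. (norm (grad \<phi> x))\<^sup>2 \<partial>lborel)"
      using test_transport t' by metis
    \<comment> \<open>The energy is not homogeneous; the factor t'^2 balances its two terms so that
      both scale with the power d + 2 of t'.\<close>
    have "dirichlet_energy (\<lambda>x. t'\<^sup>2 * \<psi> x) = 2 * t'\<^sup>2 * (\<integral>x. \<psi> x \<partial>lborel) - t'\<^sup>2 * (t'\<^sup>2 * (\<integral>x. (norm (grad \<psi> x))\<^sup>2 \<partial>lborel))"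
    proof -
      have "(norm (grad (\<lambda>x. t'\<^sup>2 * \<psi> x) x))\<^sup>2 = t'\<^sup>2 * (t'\<^sup>2 * (norm (grad \<psi> x))\<^sup>2)" for x
        unfolding grad_cmult[OF test_smooth[OF \<psi>(1)]] norm_scaleR
        by (simp add: power_mult_distrib power2_eq_square mult_ac)
      then show ?thesis unfolding dirichlet_energy_def by simp
    qed
    also have "\<dots> = t' ^ (DIM('a) + 2) * dirichlet_energy \<phi>"
      unfolding \<psi>(2,3) by (simp add: dirichlet_energy_def power_add power2_eq_square algebra_simps)
    finally have "t' ^ (DIM('a) + 2) * dirichlet_energy \<phi> \<le> T"
      using \<Omega>.energy_le_torsion[OF test_cmult[OF \<psi>(1), of "t'\<^sup>2"]] by (simp add: T_def)
    then show "dirichlet_energy \<phi> \<le> T / t' ^ (DIM('a) + 2)"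
      using t'(1) by (simp add: pos_le_divide_eq mult.commute)
  qed
  also have "T / t' ^ (DIM('a) + 2) = t' powr (- (d + 2)) * T"
  proof -
    have "- (d + 2) = - real (DIM('a) + 2)" by (simp add: d_def)
    then have "t' powr (- (d + 2)) = inverse (t' ^ (DIM('a) + 2))"
      using t'(1) by (simp only: powr_minus powr_realpow)
    then show ?thesis by (simp add: divide_inverse mult.commute)
  qed
  finally have "T' powr q \<le> (t' powr (- (d + 2)) * T) powr q"
    using pos q by (intro powr_mono2) auto
  then have T: "T' powr q \<le> t' powr (- (d + 2) * q) * T powr q"
    using pos t'(1) by (simp add: powr_mult powr_powr)
  have "t ^ DIM('a) * A \<le> A'"
  proof -
    have "measure lebesgue ((\<lambda>x. a + t *\<^sub>R x) ` \<Omega>) \<le> A'"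
      unfolding A'_def
    proof (rule measure_mono_fmeasurable[OF t(2)])
      have "(\<lambda>x. a + t *\<^sub>R x) ` \<Omega> = (+) a ` ((*\<^sub>R) t ` \<Omega>)" by (simp add: image_image)
      moreover have "open ((+) a ` ((*\<^sub>R) t ` \<Omega>))"
        using t(1) \<Omega>.open_set by (intro open_translation open_scaling) auto
      ultimately show "(\<lambda>x. a + t *\<^sub>R x) ` \<Omega> \<in> sets lebesgue" by simp
    qed (rule \<Omega>'.set_lmeasurable)
    then show ?thesis
      using measure_lebesgue_affine[of t a \<Omega>] t(1) by (simp add: A_def add.commute)
  qed
  then have "t powr d * A \<le> A'" using t(1) by (simp add: d_def powr_realpow)
  moreover have "0 \<le> d * q" using d q by simp
  then have "0 \<le> d * q + 2 * q - 2" using q by linarith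
  then have "0 \<le> (d * q + 2 * q - 2) / d" using d by simp
  ultimately have "(t powr d * A) powr ((d * q + 2 * q - 2) / d) \<le> A' powr ((d * q + 2 * q - 2) / d)"
    using pos by (intro powr_mono2) auto
  moreover have "(t powr d * A) powr ((d * q + 2 * q - 2) / d) = t powr (d * q + 2 * q - 2) * A powr ((d * q + 2 * q - 2) / d)"
    using pos t(1) d by (simp add: powr_mult powr_powr)
  ultimately have A: "t powr (d * q + 2 * q - 2) * A powr ((d * q + 2 * q - 2) / d) \<le> A' powr ((d * q + 2 * q - 2) / d)"
    by simp
  have "shape_functional q \<Omega>' = l' * T' powr q / A' powr ((d * q + 2 * q - 2) / d)"
    by (simp add: shape_functional_def l'_def T'_def A'_def d_def)
  also have "\<dots> \<le> (t powr (- 2) * l) * (t' powr (- (d + 2) * q) * T powr q)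
      / (t powr (d * q + 2 * q - 2) * A powr ((d * q + 2 * q - 2) / d))"
    using l T A pos t(1) t'(1) by (intro frac_le mult_mono) auto
  also have "\<dots> = (t powr (- 2) / t powr (d * q + 2 * q - 2)) * t' powr (- (d + 2) * q)
      * (l * T powr q / A powr ((d * q + 2 * q - 2) / d))"
    by (simp add: mult_ac)
  also have "t powr (- 2) / t powr (d * q + 2 * q - 2) = t powr (- (d + 2) * q)"
    using t(1) by (simp add: powr_diff[symmetric] algebra_simps)
  also have "t powr (- (d + 2) * q) * t' powr (- (d + 2) * q) = (t * t') powr (- (d + 2) * q)"
    using t(1) t'(1) by (simp add: powr_mult)
  finally show ?thesis by (simp add: shape_functional_def l_def T_def A_def d_def)
qed

section \<open>The ball as a competitor\<close>

text \<open>The volume w of the ball contributes w^q through the torsion and the power q + p in the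
  denominator, which leaves the power - p.\<close>

lemma shape_functional_ball_ge:
  assumes q: "q > 1"
  defines "d \<equiv> real DIM('a::euclidean_space)"
  shows "(Bessel_J_zero ((d - 2) / 2))\<^sup>2 * (d * (d + 2)) powr (- q) * unit_ball_vol d powr (- (2 * (q - 1) / d))
    \<le> shape_functional q (ball (0::'a) 1)"
proof -
  interpret convex_body "ball (0::'a) 1" by (rule convex_body_ball) simp
  define w where "w = unit_ball_vol d"
  let ?B = "ball (0::'a) 1"
  have d: "d \<ge> 1" using DIM_positive[where 'a='a] unfolding d_def by linarith
  have w: "w > 0" using d by (simp add: w_def)
  have l: "(Bessel_J_zero ((d - 2) / 2))\<^sup>2 \<le> first_eigenvalue ?B"
    unfolding d_def using ball_eigenvalue_bound by (intro first_eigenvalue_ge nonempty_set)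
  have T: "w / (d * (d + 2)) \<le> torsional_rigidity ?B"
  proof (rule field_le_epsilon)
    fix e :: real assume "e > 0"
    then obtain \<phi> where \<phi>: "\<phi> \<in> test_functions ?B" "w / (d * (d + 2)) - e < dirichlet_energy \<phi>"
      using torsion_ball_approx[of e, where 'a='a] unfolding w_def d_def dirichlet_energy_def by blast
    then show "w / (d * (d + 2)) \<le> torsional_rigidity ?B + e" using energy_le_torsion[OF \<phi>(1)] by simp
  qed
  have A: "measure lebesgue ?B = w" by (simp add: content_ball w_def d_def)
  define p where "p = 2 * (q - 1) / d"
  have ex: "(d * q + 2 * q - 2) / d = q + p" using d by (simp add: p_def field_simps)
  have "(Bessel_J_zero ((d - 2) / 2))\<^sup>2 * (d * (d + 2)) powr (- q) * w powr (- p)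
    = (Bessel_J_zero ((d - 2) / 2))\<^sup>2 * (w / (d * (d + 2))) powr q / w powr ((d * q + 2 * q - 2) / d)"
    unfolding ex using w d by (simp add: powr_divide powr_minus powr_add field_simps)
  also have "\<dots> \<le> shape_functional q ?B"
    unfolding shape_functional_def A d_def[symmetric]
    using l T w d q eigenvalue_pos by (intro divide_right_mono mult_mono powr_mono2) auto
  finally show ?thesis by (simp add: w_def p_def)
qed

context convex_body
begin

text \<open>Stated for every body at least as good as the ball rather than for maximisers, because
  it must also apply along a maximising sequence.\<close>

lemma inradius_diameter_bound:
  assumes q: "q > 1" and ge: "shape_functional q (ball (0::'a) 1) \<le> shape_functional q \<Omega>"
  defines "d \<equiv> DIM('a)"
  shows "unit_ball_vol (real (d - 1)) * pi ^ d / (real d * unit_ball_vol (real d) * 2 ^ d)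
        * (real d * (real d + 2)) powr (real d * q / (2 * (1 - q)))
        * Bessel_J_zero ((real d - 2) / 2) powr (real d / (q - 1)) \<le> inradius \<Omega> / diameter \<Omega>"
proof -
  define p where "p = 2 * (q - 1) / real d"
  define j where "j = Bessel_J_zero ((real d - 2) / 2)"
  define D where "D = real d * (real d + 2)"
  define w where "w = unit_ball_vol (real d)"
  define v where "v = unit_ball_vol (real (d - 1))"
  define r where "r = inradius \<Omega>"
  define A where "A = measure lebesgue \<Omega>"
  define m where "m = diameter \<Omega>"
  have d: "real d \<ge> 1" using DIM_positive[where 'a='a] unfolding d_def by linarith
  have p: "p > 0" using q d by (simp add: p_def)
  have j: "j > 0" unfolding j_def using Bessel_J_zero_properties(1)[OF meta_eq_to_obj_eq[OF d_def]] .
  have D: "D > 0" using d by (simp add: D_def)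
  have pos: "w > 0" "v > 0" "r > 0" "A > 0" "m > 0"
    using inradius_positive measure_pos diameter_pos by (auto simp: w_def v_def r_def A_def m_def)
  \<comment> \<open>C collects the part of the constant that depends on q; dividing it by w gives
    the power 1 / p of the lower bound for the ball.\<close>
  define C where "C = D powr (real d * q / (2 * (1 - q))) * j powr (real d / (q - 1))"
  have C: "C \<ge> 0" by (simp add: C_def)
  have ball: "j\<^sup>2 * D powr (- q) * w powr (- p) \<le> ((2 * r / pi) ^ d / A) powr p"
    using order_trans[OF shape_functional_ball_ge[OF q, where 'a='a] order_trans[OF ge shape_functional_le[OF q]]]
    by (simp add: j_def D_def w_def p_def r_def A_def d_def)
  have "C / w = (j\<^sup>2 * D powr (- q) * w powr (- p)) powr (1 / p)"
  proof -
    have "(j\<^sup>2 * D powr (- q) * w powr (- p)) powr (1 / p) = j powr (2 * (1 / p)) * D powr (- q * (1 / p)) * w powr (- p * (1 / p))"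
      using j D pos by (simp add: powr_mult powr_powr flip: powr_numeral)
    also have "2 * (1 / p) = real d / (q - 1)" using q d by (simp add: p_def field_simps)
    also have "- q * (1 / p) = real d * q / (2 * (1 - q))" using q d by (simp add: p_def divide_simps) (simp add: algebra_simps)
    also have "- p * (1 / p) = - 1" using p by simp
    finally show ?thesis using pos by (simp add: C_def powr_minus divide_inverse mult_ac)
  qed
  also have "\<dots> \<le> (((2 * r / pi) ^ d / A) powr p) powr (1 / p)"
    using ball p by (intro powr_mono2) auto
  also have "\<dots> = (2 * r / pi) ^ d / A"
    using p pos by (simp add: powr_powr)
  finally have "C / w * A \<le> (2 * r / pi) ^ d" using pos by (simp add: pos_le_divide_eq)
  moreover have "v * r ^ (d - 1) * m / real d \<le> A"
    using volume_diameter_inradius by (simp add: v_def r_def m_def A_def d_def)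
  then have "C / w * (v * r ^ (d - 1) * m / real d) \<le> C / w * A"
    using C pos by (intro mult_left_mono) auto
  ultimately have "C / w * (v * r ^ (d - 1) * m / real d) \<le> (2 * r / pi) ^ d" by simp
  also have "\<dots> = r ^ (d - 1) * (r * (2 / pi) ^ d)"
  proof -
    have "r ^ d = r ^ (d - 1) * r" using d by (cases d) auto
    then show ?thesis by (simp add: power_mult_distrib power_divide)
  qed
  \<comment> \<open>Cancelling r^(d - 1) leaves a single factor r, to be compared with the
    diameter.\<close>
  finally have "r ^ (d - 1) * (C / w * (v * m / real d)) \<le> r ^ (d - 1) * (r * (2 / pi) ^ d)"
    by (simp add: mult_ac)
  then have "C / w * (v * m / real d) \<le> r * (2 / pi) ^ d"
    by (rule mult_left_le_imp_le) (use pos in simp)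
  then have "C / w * (v * m / real d) * (pi / 2) ^ d \<le> r * (2 / pi) ^ d * (pi / 2) ^ d"
    by (intro mult_right_mono) auto
  also have "\<dots> = r" by (simp add: power_divide)
  finally have "C / w * (v / real d) * (pi / 2) ^ d \<le> r / m" using pos by (simp add: pos_le_divide_eq mult_ac)
  then show ?thesis
    by (simp add: C_def D_def j_def w_def v_def r_def m_def power_divide mult_ac)
qed

end

section \<open>Compactness of convex bodies\<close>

text \<open>The bodies are encoded by their distance functions to the complement, which are
  1-Lipschitz, so that the theorem of Arzela and Ascoli replaces Blaschke's selection theorem.\<close>

lemma convex_bodies_subsequence:
  fixes K :: "nat \<Rightarrow> 'a::euclidean_space set"
  assumes body: "\<And>n. convex_body (K n)" and \<rho>: "\<rho> > 0" "\<And>n. ball 0 \<rho> \<subseteq> K n" and sub: "\<And>n. K n \<subseteq> cball 0 1"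
  obtains \<Omega> k where "convex_body \<Omega>" "strict_mono (k :: nat \<Rightarrow> nat)"
    "\<And>t. 0 < t \<Longrightarrow> t < 1 \<Longrightarrow> \<forall>\<^sub>F n in sequentially. (*\<^sub>R) t ` \<Omega> \<subseteq> K (k n) \<and> (*\<^sub>R) t ` K (k n) \<subseteq> \<Omega>"
proof -
  have op: "open (K n)" and conv: "convex (K n)" for n using body by (auto simp: convex_body_iff)
  have sub1: "K n \<subseteq> ball 0 1" for n
    using interior_maximal[OF sub op, of n] by simp
  define u where "u n x = infdist x (- K n)" for n x
  \<comment> \<open>A unit vector lies outside every \<open>K n\<close>, so the complements are
    nonempty and the distance functions are bounded by 2 on the closed unit ball.\<close>
  obtain b :: 'a where b: "b \<in> Basis" using nonempty_Basis by blast
  have out: "b \<in> - K n" for n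
    using sub1[of n] b by (auto dest: subsetD)
  have u_ball: "ball x (u n x) \<subseteq> K n" for n x
  proof
    fix y assume "y \<in> ball x (u n x)"
    then show "y \<in> K n" using infdist_le[of y "- K n" x] by (force simp: u_def)
  qed
  have u_ge: "\<alpha> \<le> u n x" if "ball x \<alpha> \<subseteq> K n" for n x \<alpha>
  proof -
    have "\<alpha> \<le> dist x y" if "y \<in> - K n" for y
      using \<open>ball x \<alpha> \<subseteq> K n\<close> that by (auto simp: subset_iff not_less[symmetric])
    then show ?thesis
      unfolding u_def using out[of n] by (auto simp: infdist_def intro!: cINF_greatest)
  qed
  have u_pos: "x \<in> K n" if "0 < u n x" for n x
    using u_ball[of x n] that by auto
  obtain g k where g: "continuous_on (cball 0 1) g" "strict_mono (k :: nat \<Rightarrow> nat)"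
    "\<And>e. 0 < e \<Longrightarrow> \<exists>N. \<forall>n x. n \<ge> N \<and> x \<in> cball 0 1 \<longrightarrow> norm (u (k n) x - g x) < e"
  proof (rule Arzela_Ascoli[of "cball (0::'a) 1" u 2])
    show "norm (u n x) \<le> 2" if "x \<in> cball 0 1" for n x
    proof -
      have "u n x \<le> dist x b" unfolding u_def by (rule infdist_le[OF out])
      also have "\<dots> \<le> norm x + norm b" by (simp add: dist_norm norm_triangle_ineq4)
      finally show ?thesis using that b by (simp add: u_def infdist_nonneg)
    qed
    show "\<exists>d>0. \<forall>n y. y \<in> cball 0 1 \<and> norm (x - y) < d \<longrightarrow> norm (u n x - u n y) < e" if "0 < e" for x e
    proof (intro exI[of _ e] conjI allI impI)
      fix n y assume "y \<in> cball 0 1 \<and> norm (x - y) < e"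
      then show "norm (u n x - u n y) < e"
        using infdist_triangle[of x "- K n" y] infdist_triangle[of y "- K n" x]
        unfolding u_def real_norm_def dist_norm norm_minus_commute[of y x] by linarith
    qed (rule that)
  qed auto
  have lim: "(\<lambda>n. u (k n) x) \<longlonglongrightarrow> g x" if x: "x \<in> cball 0 1" for x
  proof (rule LIMSEQ_I)
    fix e :: real assume "e > 0"
    then show "\<exists>no. \<forall>n\<ge>no. norm (u (k n) x - g x) < e" using g(3) x by blast
  qed
  \<comment> \<open>The limit body: points whose distance to the complements stays positive in the
    limit. The function g is controlled on the closed unit ball, and passing to the open ball makes
    \<Omega> open.\<close>
  define \<Omega> where "\<Omega> = {x \<in> ball 0 1. 0 < g x}"
  have ev_in: "\<forall>\<^sub>F n in sequentially. x \<in> K (k n)" if "x \<in> \<Omega>" for x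
  proof -
    have "\<forall>\<^sub>F n in sequentially. 0 < u (k n) x"
      using that by (intro order_tendstoD(1)[OF lim]) (auto simp: \<Omega>_def)
    then show ?thesis by eventually_elim (rule u_pos)
  qed
  have g_ge: "\<alpha> \<le> g x" if "x \<in> cball 0 1" "\<forall>\<^sub>F n in sequentially. ball x \<alpha> \<subseteq> K (k n)" for x \<alpha>
    by (rule tendsto_lowerbound[OF lim[OF that(1)]])
       (use that(2) in \<open>auto elim!: eventually_mono intro: u_ge\<close>)
  have ball_\<rho>: "ball 0 \<rho> \<subseteq> \<Omega>"
  proof
    fix x :: 'a assume x: "x \<in> ball 0 \<rho>"
    have x1: "x \<in> ball 0 1" using x \<rho>(2) sub1 by blast
    have "ball x (\<rho> - norm x) \<subseteq> K n" for n
    proof -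
      have "ball x (\<rho> - norm x) \<subseteq> ball 0 \<rho>" 
      proof
        fix y assume "y \<in> ball x (\<rho> - norm x)"
        then show "y \<in> ball 0 \<rho>" using norm_triangle_ineq[of x "y - x"] by (simp add: dist_norm norm_minus_commute)
      qed
      then show ?thesis using \<rho>(2) by blast
    qed
    then have "\<rho> - norm x \<le> g x" using x1 by (intro g_ge) auto
    then show "x \<in> \<Omega>" using x x1 by (simp add: \<Omega>_def)
  qed
  \<comment> \<open>By convexity, the image of K n under scaling by t keeps a margin (1 - t) \<rho>
    inside K n. This margin depends neither on x nor on n, so uniform convergence gives the
    inclusions for all points from one index on.\<close>
  have scale: "ball (t *\<^sub>R x) ((1 - t) * \<rho>) \<subseteq> K n" if "x \<in> K n" "0 < t" "t < 1" for x t n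
  proof
    fix y assume y: "y \<in> ball (t *\<^sub>R x) ((1 - t) * \<rho>)"
    define v where "v = (1 / (1 - t)) *\<^sub>R (y - t *\<^sub>R x)"
    have "norm (y - t *\<^sub>R x) < (1 - t) * \<rho>" using y by (simp add: dist_norm norm_minus_commute)
    then have "norm v < \<rho>"
      unfolding v_def norm_scaleR using that by (simp add: divide_less_eq mult.commute)
    then have "v \<in> K n" using subsetD[OF \<rho>(2)[of n], of v] by simp
    then have "t *\<^sub>R x + (1 - t) *\<^sub>R v \<in> K n"
      using convexD[OF conv, of x n v t "1 - t"] that by simp
    then show "y \<in> K n" using that by (simp add: v_def)
  qed
  have body\<Omega>: "convex_body \<Omega>"
  proof (unfold convex_body_iff, intro conjI)
    show "\<Omega> \<noteq> {}" using ball_\<rho> \<rho>(1) by force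
    have "\<Omega> = ball 0 1 \<inter> g -` {0<..}" by (auto simp: \<Omega>_def)
    moreover have "open (ball 0 1 \<inter> g -` {0<..})"
      by (rule continuous_open_preimage[OF continuous_on_subset[OF g(1)]]) auto
    ultimately show "open \<Omega>" by simp
    show "bounded \<Omega>" by (rule bounded_subset[OF bounded_ball[of 0 1]]) (auto simp: \<Omega>_def)
    show "convex \<Omega>"
    proof (rule convexI)
      fix x y :: 'a and s t :: real
      assume xy: "x \<in> \<Omega>" "y \<in> \<Omega>" and st: "0 \<le> s" "0 \<le> t" "s + t = 1"
      define z where "z = s *\<^sub>R x + t *\<^sub>R y"
      \<comment> \<open>Half the minimum stays strictly below both limits, hence eventually below
        the distances themselves.\<close>
      define \<alpha> where "\<alpha> = min (g x) (g y) / 2"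
      have \<alpha>: "0 < \<alpha>" "\<alpha> < g x" "\<alpha> < g y" using xy by (auto simp: \<Omega>_def \<alpha>_def)
      have z1: "z \<in> ball 0 1"
        using convexD[OF convex_ball[of "0::'a" 1], of x y s t] xy st by (auto simp: z_def \<Omega>_def)
      have x1: "x \<in> cball 0 1" "y \<in> cball 0 1" using xy by (auto simp: \<Omega>_def)
      have "\<forall>\<^sub>F n in sequentially. ball z \<alpha> \<subseteq> K (k n)"
        using order_tendstoD(1)[OF lim[OF x1(1)] \<alpha>(2)] order_tendstoD(1)[OF lim[OF x1(2)] \<alpha>(3)]
      proof eventually_elim
        case (elim n)
        show ?case
        proof
          fix w assume w: "w \<in> ball z \<alpha>"
          have "x + (w - z) \<in> ball x (u (k n) x)" "y + (w - z) \<in> ball y (u (k n) y)"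
            using w elim by (auto simp: dist_norm norm_minus_commute)
          then have "x + (w - z) \<in> K (k n)" "y + (w - z) \<in> K (k n)" using u_ball by blast+
          then have "s *\<^sub>R (x + (w - z)) + t *\<^sub>R (y + (w - z)) \<in> K (k n)"
            using convexD[OF conv] st by blast
          moreover have "s *\<^sub>R (x + (w - z)) + t *\<^sub>R (y + (w - z)) = z + (s + t) *\<^sub>R (w - z)"
            unfolding z_def scaleR_add_left scaleR_add_right by simp
          ultimately show "w \<in> K (k n)" using st by simp
        qed
      qed
      then have "\<alpha> \<le> g z" using z1 by (intro g_ge) auto
      then show "s *\<^sub>R x + t *\<^sub>R y \<in> \<Omega>" using z1 \<alpha> by (simp add: \<Omega>_def z_def)
    qed
  qed
  have "\<forall>\<^sub>F n in sequentially. (*\<^sub>R) t ` \<Omega> \<subseteq> K (k n) \<and> (*\<^sub>R) t ` K (k n) \<subseteq> \<Omega>" if t: "0 < t" "t < 1" for t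
  proof -
    have e: "0 < (1 - t) * \<rho>" using t \<rho> by simp
    have t1: "t *\<^sub>R x \<in> ball 0 1" if "x \<in> ball 0 1" for x :: 'a
    proof -
      have "t * norm x \<le> norm x" using t by (simp add: mult_left_le_one_le)
      then have "norm (t *\<^sub>R x) \<le> norm x" using t by simp
      then show ?thesis using le_less_trans[of "norm (t *\<^sub>R x)" "norm x" 1] that by simp
    qed
    have g_scaled: "(1 - t) * \<rho> \<le> g (t *\<^sub>R x)" if x: "x \<in> \<Omega>" for x
    proof (rule g_ge)
      show "t *\<^sub>R x \<in> cball 0 1" using t1[of x] x by (simp add: \<Omega>_def)
      show "\<forall>\<^sub>F n in sequentially. ball (t *\<^sub>R x) ((1 - t) * \<rho>) \<subseteq> K (k n)"
        using ev_in[OF x] by eventually_elim (rule scale[OF _ t])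
    qed
    obtain N where N: "\<And>n x. n \<ge> N \<Longrightarrow> x \<in> cball 0 1 \<Longrightarrow> norm (u (k n) x - g x) < (1 - t) * \<rho>"
      using g(3)[OF e] by blast
    show ?thesis
    proof (rule eventually_sequentiallyI[of N], intro conjI image_subsetI)
      fix n x assume n: "N \<le> n" and x: "x \<in> \<Omega>"
      have "t *\<^sub>R x \<in> cball 0 1" using t1[of x] x by (simp add: \<Omega>_def)
      from N[OF n this] g_scaled[OF x] show "t *\<^sub>R x \<in> K (k n)" by (intro u_pos) simp
    next
      fix n x assume n: "N \<le> n" and x: "x \<in> K (k n)"
      have x1: "t *\<^sub>R x \<in> ball 0 1" using t1[of x] x sub1 by blast
      then have "norm (u (k n) (t *\<^sub>R x) - g (t *\<^sub>R x)) < (1 - t) * \<rho>" by (intro N n) simp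
      moreover have "(1 - t) * \<rho> \<le> u (k n) (t *\<^sub>R x)" by (intro u_ge scale x t)
      ultimately have "0 < g (t *\<^sub>R x)" by simp
      then show "t *\<^sub>R x \<in> \<Omega>" using x1 by (simp add: \<Omega>_def)
    qed
  qed
  with body\<Omega> g(2) show ?thesis by (rule that)
qed

section \<open>Normalisation and existence of a maximiser\<close>

lemma convex_body_similar:
  fixes a :: "'a::euclidean_space"
  assumes "convex_body \<Omega>" "t > 0"
  shows "convex_body ((\<lambda>x. a + t *\<^sub>R x) ` \<Omega>)"
proof -
  have "(\<lambda>x. a + t *\<^sub>R x) ` \<Omega> = (+) a ` ((*\<^sub>R) t ` \<Omega>)" by (simp add: image_image)
  then show ?thesis
    using assms by (auto simp: convex_body_iff intro!: open_translation open_scaling bounded_translation bounded_scaling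
      convex_translation convex_scaling)
qed

text \<open>The centre of an inscribed ball is moved to 0 and the diameter scaled to one; the
  comparison with t t' = 1 shows that the functional does not decrease. The strict bound on \<rho>
  guarantees such a ball.\<close>

lemma shape_functional_normalise:
  fixes \<Omega> :: "'a::euclidean_space set"
  assumes body: "convex_body \<Omega>" and q: "q > 1" and \<rho>: "0 < \<rho>" "\<rho> < inradius \<Omega> / diameter \<Omega>"
  obtains \<Omega>' :: "'a set" where "convex_body \<Omega>'" "ball 0 \<rho> \<subseteq> \<Omega>'" "\<Omega>' \<subseteq> cball 0 1"
    "shape_functional q \<Omega> \<le> shape_functional q \<Omega>'"
proof -
  interpret convex_body \<Omega> by fact
  define m where "m = diameter \<Omega>"
  have m: "m > 0" using diameter_pos by (simp add: m_def)
  have "0 < \<rho> * m" "\<rho> * m < inradius \<Omega>" using \<rho> m by (auto simp: m_def pos_less_divide_eq)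
  then obtain c where c: "c \<in> \<Omega>" "cball c (\<rho> * m) \<subseteq> \<Omega>" using cball_in_set by blast
  define h where "h x = (- (1 / m)) *\<^sub>R c + (1 / m) *\<^sub>R x" for x
  have inv: "c + m *\<^sub>R h x = x" "h (c + m *\<^sub>R y) = y" for x y
    using m by (simp_all add: h_def scaleR_add_right scaleR_diff_right)
  have body': "convex_body (h ` \<Omega>)"
    unfolding h_def using body m by (intro convex_body_similar) auto
  have "ball 0 \<rho> \<subseteq> h ` \<Omega>"
  proof
    fix y :: 'a assume "y \<in> ball 0 \<rho>"
    then have "c + m *\<^sub>R y \<in> cball c (\<rho> * m)" using m by (simp add: dist_norm mult.commute)
    then have "c + m *\<^sub>R y \<in> \<Omega>" using c by blast
    then show "y \<in> h ` \<Omega>" using inv(2)[of y] by (metis image_eqI)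
  qed
  moreover have "h ` \<Omega> \<subseteq> cball 0 1"
  proof (rule image_subsetI)
    fix x assume "x \<in> \<Omega>"
    then have "dist c x \<le> m" unfolding m_def using c by (intro diameter_bounded_bound bounded_set)
    moreover have "h x = (1 / m) *\<^sub>R (x - c)" by (simp add: h_def scaleR_diff_right)
    ultimately show "h x \<in> cball 0 1" using m by (simp add: dist_norm norm_minus_commute)
  qed
  moreover have "shape_functional q \<Omega> \<le> (m * (1 / m)) powr (- (real DIM('a) + 2) * q) * shape_functional q (h ` \<Omega>)"
  proof (rule shape_functional_comparison[OF body' body q])
    show "(\<lambda>x. c + m *\<^sub>R x) ` h ` \<Omega> \<subseteq> \<Omega>" by (simp add: image_image inv)
    show "(\<lambda>x. (- (1 / m)) *\<^sub>R c + (1 / m) *\<^sub>R x) ` \<Omega> \<subseteq> h ` \<Omega>" by (simp add: h_def)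
  qed (use m in auto)
  then have "shape_functional q \<Omega> \<le> shape_functional q (h ` \<Omega>)" using m by simp
  ultimately show ?thesis by (rule that[OF body'])
qed

text \<open>Semicontinuity takes the quantitative form F(K) \<le> t^(- 2 (d + 2) q) F(\<Omega>)
  whenever each of K and \<Omega> contains the other shrunk by t; letting t tend to 1 shows that the
  limit body reaches the supremum.\<close>

theorem shape_functional_maximiser_exists:
  assumes q: "q > 1"
  shows "\<exists>\<Omega>::'a::euclidean_space set. convex_body \<Omega> \<and> (\<forall>\<Omega>'::'a set. convex_body \<Omega>' \<longrightarrow> shape_functional q \<Omega>' \<le> shape_functional q \<Omega>)"
proof -
  let ?F = "shape_functional q :: 'a set \<Rightarrow> real"
  define d where "d = real DIM('a)"
  let ?B = "ball (0::'a) 1"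
  define C where "C = unit_ball_vol (real (DIM('a) - 1)) * pi ^ DIM('a) / (real DIM('a) * unit_ball_vol (real DIM('a)) * 2 ^ DIM('a))
        * (real DIM('a) * (real DIM('a) + 2)) powr (real DIM('a) * q / (2 * (1 - q)))
        * Bessel_J_zero ((real DIM('a) - 2) / 2) powr (real DIM('a) / (q - 1))"
  have d: "d \<ge> 1" using DIM_positive[where 'a='a] unfolding d_def by linarith
  have C: "C > 0"
    unfolding C_def using Bessel_J_zero_properties(1)[of "DIM('a)", where 'a='a]
    by (intro mult_pos_pos divide_pos_pos) (auto simp: less_imp_neq[symmetric])
  have C2: "C / 2 > 0" using C by simp
  have B: "convex_body ?B" by (rule convex_body_ball) simp
  have bdd: "bdd_above (?F ` Collect convex_body)"
  proof (rule bdd_aboveI2)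
    fix \<Omega> :: "'a set" assume "\<Omega> \<in> Collect convex_body"
    then interpret convex_body \<Omega> by simp
    define w where "w = unit_ball_vol (real DIM('a))"
    define r where "r = inradius \<Omega>"
    have w: "w > 0" "r > 0" using inradius_positive by (auto simp: w_def r_def)
    have "?F \<Omega> \<le> ((2 * r / pi) ^ DIM('a) / measure lebesgue \<Omega>) powr (2 * (q - 1) / d)"
      unfolding d_def r_def by (rule shape_functional_le[OF q])
    also have "\<dots> \<le> ((2 * r / pi) ^ DIM('a) / (w * r ^ DIM('a))) powr (2 * (q - 1) / d)"
      using volume_inradius w measure_pos q d
      by (intro powr_mono2 divide_left_mono) (auto simp: w_def r_def)
    also have "(2 * r / pi) ^ DIM('a) / (w * r ^ DIM('a)) = (2 / pi) ^ DIM('a) / w"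
      using w by (simp add: power_mult_distrib power_divide)
    finally show "?F \<Omega> \<le> ((2 / pi) ^ DIM('a) / unit_ball_vol (real DIM('a))) powr (2 * (q - 1) / d)"
      by (simp add: w_def)
  qed
  define S where "S = Sup (?F ` Collect convex_body)"
  have S_ge: "?F \<Omega> \<le> S" if "convex_body \<Omega>" for \<Omega>
    unfolding S_def using that bdd by (intro cSup_upper) auto
  \<comment> \<open>Replacing a body by the ball where the ball is better keeps the sequence
    maximising and makes the bound on r / diam available for every term.\<close>
  have "\<exists>\<Omega>. convex_body \<Omega> \<and> ?F ?B \<le> ?F \<Omega> \<and> S - 1 / real (Suc n) < ?F \<Omega>" for n
  proof -
    have "?F ` Collect convex_body \<noteq> {}" using B by blast
    moreover have "S - 1 / real (Suc n) < Sup (?F ` Collect convex_body)" by (simp add: S_def)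
    ultimately have "\<exists>y\<in>?F ` Collect convex_body. S - 1 / real (Suc n) < y"
      by (rule less_cSupD)
    then obtain \<Omega> where \<Omega>: "convex_body \<Omega>" "S - 1 / real (Suc n) < ?F \<Omega>" by blast
    show ?thesis
    proof (cases "?F ?B \<le> ?F \<Omega>")
      case True
      then show ?thesis using \<Omega> by blast
    next
      case False
      then show ?thesis using B \<Omega>(2) by (intro exI[of _ ?B]) auto
    qed
  qed
  then obtain L where L: "\<And>n. convex_body (L n)" "\<And>n. ?F ?B \<le> ?F (L n)" "\<And>n. S - 1 / real (Suc n) < ?F (L n)"
    by metis
  have "\<exists>K. convex_body K \<and> ball 0 (C / 2) \<subseteq> K \<and> K \<subseteq> cball 0 1 \<and> ?F (L n) \<le> ?F K" for n
  proof -
    have "C \<le> inradius (L n) / diameter (L n)"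
      unfolding C_def by (rule convex_body.inradius_diameter_bound[OF L(1) q L(2)])
    \<comment> \<open>Halving C gives the strict inequality required for the inscribed ball.\<close>
    moreover have "C / 2 < C" using C by simp
    ultimately have lt: "C / 2 < inradius (L n) / diameter (L n)" by linarith
    show ?thesis
      by (rule shape_functional_normalise[OF L(1)[of n] q C2 lt]) blast
  qed
  then obtain K where K: "\<And>n. convex_body (K n)" "\<And>n. ball 0 (C / 2) \<subseteq> K n" "\<And>n. K n \<subseteq> cball 0 1"
    "\<And>n. ?F (L n) \<le> ?F (K n)" by metis
  obtain \<Omega> k where \<Omega>: "convex_body \<Omega>" and k: "strict_mono (k :: nat \<Rightarrow> nat)"
    and lim: "\<And>t. 0 < t \<Longrightarrow> t < 1 \<Longrightarrow> \<forall>\<^sub>F n in sequentially. (*\<^sub>R) t ` \<Omega> \<subseteq> K (k n) \<and> (*\<^sub>R) t ` K (k n) \<subseteq> \<Omega>"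
    by (rule convex_bodies_subsequence[of K "C / 2", OF K(1) C2 K(2,3)]) blast
  have S_le: "S \<le> (t * t) powr (- (d + 2) * q) * ?F \<Omega>" if t: "0 < t" "t < 1" for t
  proof (rule tendsto_upperbound)
    have "(\<lambda>n. S - 1 / real (Suc n)) \<longlonglongrightarrow> S - 0"
      by (intro tendsto_intros lim_const_over_n[THEN LIMSEQ_Suc])
    then show "(\<lambda>n. S - 1 / real (Suc n)) \<longlonglongrightarrow> S" by simp
    show "\<forall>\<^sub>F n in sequentially. S - 1 / real (Suc n) \<le> (t * t) powr (- (d + 2) * q) * ?F \<Omega>"
      using lim[OF t]
    proof eventually_elim
      case (elim n)
      \<comment> \<open>Along a subsequence k n \<ge> n, so the error bound at index n still
        applies.\<close>
      have "S - 1 / real (Suc n) \<le> S - 1 / real (Suc (k n))"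
        using seq_suble[OF k, of n] by (intro diff_left_mono divide_left_mono) auto
      also have "\<dots> \<le> ?F (K (k n))" using L(3)[of "k n"] K(4)[of "k n"] by linarith
      also have "\<dots> \<le> (t * t) powr (- (real DIM('a) + 2) * q) * ?F \<Omega>"
        by (rule shape_functional_comparison[OF \<Omega> K(1) q t(1) _ t(1), of 0 _ 0]) (use elim in auto)
      finally show ?case by (simp add: d_def)
    qed
  qed simp
  have "((\<lambda>t. (t * t) powr (- (d + 2) * q) * ?F \<Omega>) \<longlongrightarrow> (1 * 1) powr (- (d + 2) * q) * ?F \<Omega>) (at_left 1)"
    by (intro tendsto_intros) auto
  moreover have "\<forall>\<^sub>F t in at_left (1::real). t \<in> {0<..<1}"
    by (rule eventually_at_left_real) simp
  then have "\<forall>\<^sub>F t in at_left (1::real). S \<le> (t * t) powr (- (d + 2) * q) * ?F \<Omega>"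
    by eventually_elim (intro S_le, auto)
  ultimately have "S \<le> (1 * 1) powr (- (d + 2) * q) * ?F \<Omega>"
    by (rule tendsto_lowerbound) simp
  then have "S \<le> ?F \<Omega>" by simp
  then have "?F \<Omega>' \<le> ?F \<Omega>" if "convex_body \<Omega>'" for \<Omega>'
    using order_trans[OF S_ge[OF that]] by blast
  with \<Omega> show ?thesis by blast
qed

theorem theorem4p3:
  fixes q :: real
  assumes "q > 1"
  defines "d \<equiv> DIM('a::euclidean_space)"
  defines "is_maximiser \<equiv> is_arg_max (shape_functional q)
             (\<lambda>\<Omega>::'a set. \<Omega> \<noteq> {} \<and> open \<Omega> \<and> bounded \<Omega> \<and> convex \<Omega>)"
  shows "(\<exists>\<Omega>. is_maximiser \<Omega>) \<and>
    (\<forall>\<Omega>. is_maximiser \<Omega> \<longrightarrow>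
      inradius \<Omega> / diameter \<Omega> \<ge>
        unit_ball_vol (real (d - 1)) * pi ^ d / (real d * unit_ball_vol (real d) * 2 ^ d)
        * (real d * (real d + 2)) powr (real d * q / (2 * (1 - q)))
        * Bessel_J_zero ((real d - 2) / 2) powr (real d / (q - 1)))"
proof -
  \<comment> \<open>\<open>is_arg_max\<close> asks that no competitor be strictly larger; on the
    reals this means that all are at most as large.\<close>
  have max: "is_maximiser \<Omega> \<longleftrightarrow> convex_body \<Omega> \<and> (\<forall>\<Omega>'::'a set. convex_body \<Omega>' \<longrightarrow> shape_functional q \<Omega>' \<le> shape_functional q \<Omega>)" for \<Omega>
    unfolding is_maximiser_def is_arg_max_def convex_body_iff[symmetric] by (auto simp: not_less)
  show ?thesis
  proof (intro conjI allI impI)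
    show "\<exists>\<Omega>. is_maximiser \<Omega>"
      unfolding max using shape_functional_maximiser_exists[OF assms(1)] .
    fix \<Omega> assume "is_maximiser \<Omega>"
    then have \<Omega>: "convex_body \<Omega>" "shape_functional q (ball (0::'a) 1) \<le> shape_functional q \<Omega>"
      unfolding max using convex_body_ball[of 1 "0::'a"] by auto
    show "unit_ball_vol (real (d - 1)) * pi ^ d / (real d * unit_ball_vol (real d) * 2 ^ d)
        * (real d * (real d + 2)) powr (real d * q / (2 * (1 - q)))
        * Bessel_J_zero ((real d - 2) / 2) powr (real d / (q - 1)) \<le> inradius \<Omega> / diameter \<Omega>"
      unfolding d_def by (rule convex_body.inradius_diameter_bound[OF \<Omega>(1) assms(1) \<Omega>(2)])
  qed
qed

end
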